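(* In the AD-PSGD setting described in the context, let $$\gamma=\frac{n}{10ML+\sqrt{\sigma^2+6M\varsigma^2}\,\sqrt{KM}}.$$ If the total number of iterations $K$ satisfies $$K\geqslant\frac{ML^2n^2}{\sigma^2+6M\varsigma^2}\max\left\{192\left(T\frac{n-1}{n}+\bar\rho\right),\ \frac{64T^4}{n^2},\ 1024n^2\bar\rho^2,\ \frac{\left(8\sqrt6\,T^{2/3}+8\right)^2\left(T+\bar\rho\frac{n}{n-1}\right)^{2/3}(n-1)^{1/2}}{n^{1/6}}\right\},$$ then $$\frac{\sum_{k=0}^{K-1}\mathbb{E}\left\|\nabla f\left(\frac{X_k\mathbf{1}_n}{n}\right)\right\|^2}{K}\leqslant\frac{20(f(x_0)-f^* )L}{K}+\frac{2(f(x_0)-f^*+L)\sqrt{\sigma^2/M+6\varsigma^2}}{\sqrt K}.$$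
   Context: Notation: $\|\cdot\|$ is the vector $\ell_2$ norm (or matrix spectral norm); $\mathbf{1}_n\in\mathbb{R}^n$ is the all-ones column vector; $\lambda_i(\cdot)$ is the $i$-th largest eigenvalue. Problem. There are $n$ workers. Worker $i$ has a data distribution $\mathcal{D}_i$ and a local loss $f_i(x)=\mathbb{E}_{\xi\sim\mathcal{D}_i}F_i(x;\xi)$ on $\mathbb{R}^N$; the stochastic gradient computed by worker $i$ at $x$ from the sample $\xi\sim\mathcal{D}_i$ is written $\nabla F(x;\xi)$. Let $p_1,\dots,p_n\ge 0$, $\sum_i p_i=1$, define a distribution $\mathcal{I}$ on $\{1,\dots,n\}$. The problem is $\min_{x\in\mathbb{R}^N} f(x):=\mathbb{E}_{i\sim\mathcal{I}}f_i(x)=\sum_{i=1}^n p_i f_i(x)$, with optimal value $f^*$. Algorithm (AD-PSGD). Let $M\ge 1$ be the batch size, $K\ge 1$ the number of iterations, $\gamma>0$ the learning rate. Local models at iteration $k$ are the columns of $X_k=[x_k^1\ \cdots\ x_k^n]\in\mathbb{R}^{N\times n}$. All workers start from the same model: $x_0^i=x_0$ for all $i$. For $k=0,1,2,\dots$, $$X_{k+1}=X_kW_k-\gamma\,\partial g(\hat X_k;\xi_k^{i_k},i_k),$$ where $i_k\sim\mathcal{I}$ is the worker performing the $k$-th update, $W_k\in\mathbb{R}^{n\times n}$ is a random averaging matrix, $\xi_k^{i}=(\xi_{k,1}^{i},\dots,\xi_{k,M}^{i})$ is a batch of independent samples from $\mathcal{D}_i$, $\hat X_k=[\hat x_k^1\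 \cdots\ \hat x_k^n]=X_{k-\tau_k}$ for a nonnegative integer $\tau_k$ (with $\tau_k\le k$), and $\partial g(\hat X_k;\xi_k^{i_k},i_k)\in\mathbb{R}^{N\times n}$ has $i_k$-th column $\sum_{j=1}^M\nabla F(\hat x_k^{i_k};\xi_{k,j}^{i_k})$ and all other columns $0$. Standing assumptions. 1. Each $f_i$ has $L$-Lipschitz gradient. 2. $W_k$ is doubly stochastic for all $k$. 3. There is $\rho\in[0,1)$ with $\max\{|\lambda_2(\mathbb{E}[W_k^\top W_k])|,|\lambda_n(\mathbb{E}[W_k^\top W_k])|\}\le\rho$ for all $k$. 4. $\mathbb{E}_{\xi\sim\mathcal{D}_i}\nabla F(x;\xi)=\nabla f_i(x)$ and $\mathbb{E}_{i\sim\mathcal{I}}\mathbb{E}_{\xi\sim\mathcal{D}_i}\nabla F(x;\xi)=\nabla f(x)$. 5. There are constants $\sigma,\varsigma\ge 0$ with $\mathbb{E}_{\xi\sim\mathcal{D}_i}\|\nabla F(x;\xi)-\nabla f_i(x)\|^2\le\sigma^2$ for all $i,x$, and $\mathbb{E}_{i\sim\mathcal{I}}\|\nabla f_i(x)-\nabla f(x)\|^2\le\varsigma^2$ for all $x$. 6. The random variables $\xi_k,i_k$ ($k=0,1,2,\dots$) are independent; $W_k$ is a random variable that may depend on $i_k$ (but the pairs $(i_k,W_k)$ are independent across $k$ and independent of the samples $\xi$). 7. There is a constant $T$ with $\max_k\tau_k\le T$. Constant: $$\bar\rho:=\frac{n-1}{n}\left(\frac{1}{1-\rho}+\frac{2\sqrt\rho}{(1-\sqrt\rho)^2}\right).$$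 *)

theory Defs
  imports "HOL-Probability.Probability"
begin

definition gradient :: "('a::real_inner \<Rightarrow> real) \<Rightarrow> 'a \<Rightarrow> 'a" where
  "gradient h x = (THE g. GDERIV h x :> g)"

definition doubly_stochastic :: "real^'n^'n \<Rightarrow> bool" where
  "doubly_stochastic A \<longleftrightarrow>
     (\<forall>i j. 0 \<le> A $ i $ j) \<and> (\<forall>i. (\<Sum>j\<in>UNIV. A $ i $ j) = 1) \<and> (\<forall>j. (\<Sum>i\<in>UNIV. A $ i $ j) = 1)"

(* Multiplicity is the dimension of the eigenspace. This is used only for symmetric matrices,
   where it agrees with the multiplicity as a root of the characteristic polynomial. *)
definition eigenvalues :: "real^'n^'n \<Rightarrow> real multiset" where
  "eigenvalues A =
     (\<Sum>t\<in>{t. \<exists>v. v \<noteq> 0 \<and> A *v v = t *\<^sub>R v}. replicate_mset (dim {v. A *v v = t *\<^sub>R v}) t)"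

(* The i-th largest eigenvalue, for i from 1 to the number of eigenvalues. *)
definition eigenvalue_nth :: "nat \<Rightarrow> real^'n^'n \<Rightarrow> real" where
  "eigenvalue_nth i A = rev (sorted_list_of_multiset (eigenvalues A)) ! (i - 1)"

definition local_loss ::
  "('n \<Rightarrow> 's measure) \<Rightarrow> ('n \<Rightarrow> 'x \<Rightarrow> 's \<Rightarrow> real) \<Rightarrow> 'n \<Rightarrow> 'x \<Rightarrow> real" where
  "local_loss D F i x = (\<integral>\<xi>. F i x \<xi> \<partial>D i)"

definition global_loss ::
  "'n pmf \<Rightarrow> ('n \<Rightarrow> 's measure) \<Rightarrow> ('n \<Rightarrow> 'x \<Rightarrow> 's \<Rightarrow> real) \<Rightarrow> 'x \<Rightarrow> real" where
  "global_loss I D F x = measure_pmf.expectation I (\<lambda>i. local_loss D F i x)"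

(* The matrix whose i-th column is the summed batch gradient at the i-th column of Xh,
   all other columns being 0. *)
definition batch_update ::
  "('n \<Rightarrow> real^'d \<Rightarrow> 's \<Rightarrow> real^'d) \<Rightarrow> nat \<Rightarrow> real^'n^'d \<Rightarrow> (nat \<Rightarrow> 's) \<Rightarrow> 'n \<Rightarrow> real^'n^'d" where
  "batch_update gF M Xh b i =
     (\<chi> r c. if c = i then (\<Sum>j=1..M. gF i (column i Xh) (b j)) $ r else 0)"

definition events_of :: "'w measure \<Rightarrow> 'b measure \<Rightarrow> ('w \<Rightarrow> 'b) \<Rightarrow> 'w set set" where
  "events_of P N Y = {Y -` A \<inter> space P | A. A \<in> sets N}"

(* Joint independence of all the variables (i_k, W_k) and xi_k = (xi_{k,j}^i)_{i,j}, k = 0,1,2,...: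
   indep_vars for a family whose members take values in two different types. Nothing is required
   here of the components of a single xi_k, nor of the pair i_k, W_k. *)
definition independent_sources ::
  "'w measure \<Rightarrow> ('n::finite \<Rightarrow> 's measure) \<Rightarrow> nat \<Rightarrow> (nat \<Rightarrow> 'w \<Rightarrow> 'n) \<Rightarrow> (nat \<Rightarrow> 'w \<Rightarrow> real^'n^'n)
     \<Rightarrow> (nat \<Rightarrow> 'n \<Rightarrow> nat \<Rightarrow> 'w \<Rightarrow> 's) \<Rightarrow> bool" where
  "independent_sources P D M ik W \<xi> \<longleftrightarrow>
     prob_space.indep_sets P
       (case_sum
          (\<lambda>k. events_of P (count_space UNIV \<Otimes>\<^sub>M borel) (\<lambda>\<omega>. (ik k \<omega>, W k \<omega>)))
          (\<lambda>k. events_of P (PiM (UNIV \<times> {1..M}) (\<lambda>(i, j). D i))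
                 (\<lambda>\<omega>. \<lambda>(i, j)\<in>UNIV \<times> {1..M}. \<xi> k i j \<omega>)))
       UNIV"

definition rho_bar :: "real \<Rightarrow> real \<Rightarrow> real" where
  "rho_bar n \<rho> = (n - 1) / n * (1 / (1 - \<rho>) + 2 * sqrt \<rho> / (1 - sqrt \<rho>)\<^sup>2)"

end

theory Submission
  imports Defs
begin

text \<open>
  The averaged model xbar k = X k 1 / n moves by plain stochastic gradient steps: W k maps the
  all-ones vector to itself, so xbar (k + 1) = xbar k - (gamma / n) g k, where g k is the batch
  gradient of the active worker. The gradient of f is Lipschitz, so f (xbar k) obeys the usual
  descent inequality (descent), with two error terms: the staleness norm (xbar k - xbar (k - tau))^2,
  because g k is computed from an old model, and the disagreement norm (column i X - xbar)^2, because
  it is computed from a local model. The rate of serial stochastic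
  gradient descent survives because, for small gamma, both errors are dominated by the terms that a
  descent step gains.

  The staleness is the norm of a sum of at most T recent steps, so the Cauchy-Schwarz inequality bounds it
  (staleness_bound). For the disagreement, unroll the recursion: the update of step j enters
  column i X k - xbar k through one entry of the vector W (j+1) ... W (k-1) (e_i - 1/n). This vector
  has zero sum and is built from averaging matrices that are independent of g j. For a fixed vector y
  of zero sum, E (norm (W y))^2 = y . E(W^T W) y <= rho (norm y)^2, because 1 is an eigenvector of
  E(W^T W) of eigenvalue 1 and rho < 1 bounds the second eigenvalue; hence the second moment of the
  entry decays like rho^(k-1-j), and disagreement_bound sums the contributions by a Cauchy-Schwarz
  inequality with geometric weights s^(k-1-j), where sqrt rho < s < 1.

  Both bounds involve E (norm (g k))^2. A batch of M independent samples has variance at most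
  M sigma^2, and the Lipschitz gradients bound the spread of the local gradients, so
  g_second_moment_bound estimates this quantity by a noise constant, the squared mean gradient (which
  the descent inequality pays for) and the disagreement itself. Summing over k gives a closed system of
  inequalities between finitely many totals, solved in delayed_descent_bound. In the
  disagreement, the constant noise is summed by a geometric series at each step and is not amplified
  by the delay, which enters only through the mean gradient and the feedback of the disagreement.

  All quantities of step k are functions of the sources of randomness (i_k, W_k) and xi_k. Every
  conditional expectation is replaced by one principle: if a function depends on two independent
  sub-sigma-algebras, one of the two arguments may be frozen while integrating over the other
  (nn_integral_freeze, integral_freeze).
\<close>

section \<open>The second eigenvalue bounds the quadratic form off the constants\<close>

lemma symmetric_inner:
  fixes A :: "real^'n^'n"
  assumes "transpose A = A"
  shows "x \<bullet> (A *v y) = (A *v x) \<bullet> y"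
  using dot_lmul_matrix[of x A y] transpose_matrix_vector[of A x] assms by simp

lemma symmetric_eigenvectors_orthogonal:
  fixes A :: "real^'n^'n"
  assumes "transpose A = A" "A *v x = s *\<^sub>R x" "A *v y = t *\<^sub>R y" "s \<noteq> t"
  shows "x \<bullet> y = 0"
  using symmetric_inner[OF assms(1), of x y] assms(2-4) by auto

text \<open>
  A symmetric matrix has infinitely many eigenvalues only if some orthogonal family of nonzero vectors is
  infinite. Finiteness matters here because the multiset of eigenvalues is a sum over this set,
  which would collapse to the empty multiset otherwise.
\<close>
lemma finite_eigenvalues_symmetric:
  fixes A :: "real^'n^'n"
  assumes "transpose A = A"
  shows "finite {t. \<exists>v. v \<noteq> 0 \<and> A *v v = t *\<^sub>R v}"
proof -
  let ?E = "{t. \<exists>v. v \<noteq> 0 \<and> A *v v = t *\<^sub>R v}"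
  have "\<forall>t\<in>?E. \<exists>v. v \<noteq> 0 \<and> A *v v = t *\<^sub>R v" by simp
  from bchoice[OF this] obtain v where v: "\<And>t. t \<in> ?E \<Longrightarrow> v t \<noteq> 0 \<and> A *v v t = t *\<^sub>R v t"
    by blast
  have orth: "v s \<bullet> v t = 0" if "s \<in> ?E" "t \<in> ?E" "s \<noteq> t" for s t
    using symmetric_eigenvectors_orthogonal[OF assms] v that by blast
  have inj: "inj_on v ?E"
  proof (rule inj_onI, rule ccontr)
    fix s t assume st: "s \<in> ?E" "t \<in> ?E" "v s = v t" "s \<noteq> t"
    then have "v t \<bullet> v t = 0" using orth[of s t] by simp
    then show False using v[OF st(2)] by simp
  qed
  have "independent (v ` ?E)"
  proof (rule pairwise_orthogonal_independent)
    show "pairwise orthogonal (v ` ?E)"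
      unfolding pairwise_def orthogonal_def using orth by blast
    show "0 \<notin> v ` ?E" using v by (metis (no_types, lifting) imageE)
  qed
  then have "finite (v ` ?E)" by (rule independent_imp_finite)
  then show ?thesis using inj finite_imageD by blast
qed

lemma second_largest_ge:
  fixes xs :: "'a::linorder list"
  assumes "sorted xs" and sub: "{#u, w#} \<subseteq># mset xs"
  shows "min u w \<le> rev xs ! 1"
proof -
  have "u \<in> set xs" using mset_subset_eqD[OF sub, of u] by simp
  then obtain ys zs where xs: "xs = ys @ u # zs" by (meson split_list)
  have "w \<in># mset (ys @ zs)" using sub unfolding xs by (simp add: insert_subset_eq_iff)
  then have w: "w \<in> set ys \<or> w \<in> set zs" by auto
  have "\<exists>i. i + 2 \<le> length xs \<and> xs ! i \<in> {u, w}"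
  proof (cases "zs = []")
    case True
    then obtain i where "i < length ys" "ys ! i = w" using w by (auto simp: in_set_conv_nth)
    then show ?thesis using True by (intro exI[of _ i]) (auto simp: xs nth_append)
  next
    case False
    then show ?thesis by (intro exI[of _ "length ys"]) (cases zs, auto simp: xs nth_append)
  qed
  then obtain i where i: "i + 2 \<le> length xs" "xs ! i \<in> {u, w}" by blast
  then have "min u w \<le> xs ! i" by auto
  also have "\<dots> \<le> xs ! (length xs - 2)" using assms(1) i by (intro sorted_nth_mono) auto
  also have "\<dots> = rev xs ! 1" using i by (subst rev_nth) (auto simp: numeral_2_eq_2)
  finally show ?thesis .
qed

text \<open>
  Two orthogonal eigenvectors contribute two entries to the multiset of eigenvalues, also when
  their eigenvalues coincide: then the eigenspace has dimension at least two.
\<close>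
lemma eigenvalue_nth_2_ge:
  fixes A :: "real^'n^'n"
  assumes sym: "transpose A = A" and x: "x \<noteq> 0" "A *v x = s *\<^sub>R x" and y: "y \<noteq> 0" "A *v y = t *\<^sub>R y"
    and orth: "x \<bullet> y = 0"
  shows "min s t \<le> eigenvalue_nth 2 A"
proof -
  let ?E = "{t. \<exists>v. v \<noteq> 0 \<and> A *v v = t *\<^sub>R v}"
  let ?m = "\<lambda>t. dim {v. A *v v = t *\<^sub>R v}"
  have fin: "finite ?E" by (rule finite_eigenvalues_symmetric[OF sym])
  have sub: "(\<Sum>t\<in>S. replicate_mset (?m t) t) \<subseteq># eigenvalues A" if "S \<subseteq> ?E" for S
    unfolding eigenvalues_def using sum.subset_diff[OF that fin, of "\<lambda>t. replicate_mset (?m t) t"] by auto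
  have mem: "s \<in> ?E" "t \<in> ?E" using x y by auto
  have pos: "1 \<le> ?m c" if "v \<noteq> 0" "A *v v = c *\<^sub>R v" for v c
  proof -
    have "dim {v} \<le> ?m c" using that by (intro dim_subset) auto
    then show ?thesis using that by simp
  qed
  have "{#s, t#} \<subseteq># eigenvalues A"
  proof (cases "s = t")
    case True
    have "x \<noteq> y" using orth x by auto
    moreover have "independent {x, y}"
      by (rule pairwise_orthogonal_independent) (use orth x y in \<open>auto simp: pairwise_def orthogonal_def inner_commute\<close>)
    ultimately have "dim {x, y} = 2" by (simp add: dim_eq_card_independent)
    moreover have "dim {x, y} \<le> ?m s" using x y True by (intro dim_subset) auto
    ultimately have "2 \<le> ?m s" by simp
    then have "{#s, t#} \<subseteq># replicate_mset (?m s) s"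
      using True by (auto simp: subseteq_mset_def)
    also have "\<dots> \<subseteq># eigenvalues A" using sub[of "{s}"] mem by simp
    finally show ?thesis .
  next
    case False
    have "{#s, t#} \<subseteq># replicate_mset (?m s) s + replicate_mset (?m t) t"
      using pos[OF x] pos[OF y] False by (auto simp: subseteq_mset_def)
    also have "\<dots> \<subseteq># eigenvalues A" using sub[of "{s, t}"] mem False by simp
    finally show ?thesis .
  qed
  then show ?thesis
    unfolding eigenvalue_nth_def using second_largest_ge[of "sorted_list_of_multiset (eigenvalues A)" s t] by simp
qed

text \<open>
  The maximizer of the Rayleigh quotient on the unit sphere of a hyperplane. The residual
  w = A v - t v lies in the hyperplane, since A is symmetric and fixes its normal 1; if w were
  nonzero, moving from v in the direction of w would increase the quotient to first order.
\<close>
lemma rayleigh_max_eigenvector: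
  fixes A :: "real^'n^'n" and x :: "real^'n"
  assumes sym: "transpose A = A" and A1: "A *v 1 = 1" and x: "x \<bullet> 1 = 0" "x \<noteq> 0"
  obtains v t where "v \<noteq> 0" "v \<bullet> 1 = 0" "A *v v = t *\<^sub>R v" "\<And>y. y \<bullet> 1 = 0 \<Longrightarrow> y \<bullet> (A *v y) \<le> t * (y \<bullet> y)"
proof -
  define S :: "(real^'n) set" where "S = sphere 0 1 \<inter> {y. 1 \<bullet> y = 0}"
  have "compact S" unfolding S_def by (intro compact_Int_closed closed_hyperplane) simp
  moreover have "x /\<^sub>R norm x \<in> S" using x by (simp add: S_def inner_commute)
  moreover have "continuous_on S (\<lambda>y. y \<bullet> (A *v y))"
    by (intro continuous_on_inner continuous_on_id linear_continuous_on matrix_vector_mul_bounded_linear)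
  ultimately obtain v where v: "v \<in> S" and vmax: "\<And>y. y \<in> S \<Longrightarrow> y \<bullet> (A *v y) \<le> v \<bullet> (A *v v)"
    using continuous_attains_sup[of S "\<lambda>y. y \<bullet> (A *v y)"] by blast
  define t where "t = v \<bullet> (A *v v)"
  have v1: "v \<bullet> 1 = 0" and vv: "v \<bullet> v = 1" using v by (auto simp: S_def inner_commute norm_eq_1)
  have max: "y \<bullet> (A *v y) \<le> t * (y \<bullet> y)" if "y \<bullet> 1 = 0" for y
  proof (cases "y = 0")
    case False
    let ?z = "y /\<^sub>R norm y"
    have "?z \<bullet> (A *v ?z) \<le> t" unfolding t_def by (rule vmax) (use that False in \<open>simp add: S_def inner_commute\<close>)
    then have "(y \<bullet> (A *v y)) / (norm y)\<^sup>2 \<le> t"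
      by (simp add: matrix_vector_mult_scaleR power2_eq_square divide_inverse mult_ac)
    then show ?thesis using False by (simp add: field_simps dot_square_norm)
  qed auto
  define w where "w = A *v v - t *\<^sub>R v"
  have w1: "w \<bullet> 1 = 0" using symmetric_inner[OF sym, of v 1] v1 A1 by (simp add: w_def inner_diff_left)
  have "w \<bullet> w = 0"
  proof (rule ccontr)
    assume "w \<bullet> w \<noteq> 0"
    then have ww: "w \<bullet> w > 0" by (simp add: inner_gt_zero_iff)
    define c where "c = t * (w \<bullet> w) - w \<bullet> (A *v w)"
    have quad: "2 * \<epsilon> * (w \<bullet> w) \<le> \<epsilon>\<^sup>2 * c" for \<epsilon>
    proof -
      have "(v + \<epsilon> *\<^sub>R w) \<bullet> 1 = 0" using v1 w1 by (simp add: inner_add_left)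
      from max[OF this] have "(v + \<epsilon> *\<^sub>R w) \<bullet> (A *v (v + \<epsilon> *\<^sub>R w)) \<le> t * ((v + \<epsilon> *\<^sub>R w) \<bullet> (v + \<epsilon> *\<^sub>R w))" .
      moreover have "(v + \<epsilon> *\<^sub>R w) \<bullet> (A *v (v + \<epsilon> *\<^sub>R w))
          = v \<bullet> (A *v v) + \<epsilon> * (v \<bullet> (A *v w)) + \<epsilon> * (w \<bullet> (A *v v)) + \<epsilon>\<^sup>2 * (w \<bullet> (A *v w))"
        by (simp add: matrix_vector_right_distrib matrix_vector_mult_scaleR inner_add_left inner_add_right
          power2_eq_square distrib_left)
      moreover have "v \<bullet> (A *v w) = w \<bullet> (A *v v)"
        using symmetric_inner[OF sym, of v w] by (simp only: inner_commute[of w])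
      moreover have "(v + \<epsilon> *\<^sub>R w) \<bullet> (v + \<epsilon> *\<^sub>R w) = 1 + 2 * \<epsilon> * (w \<bullet> v) + \<epsilon>\<^sup>2 * (w \<bullet> w)"
        by (simp add: inner_add_left inner_add_right vv inner_commute[of v w] power2_eq_square distrib_left)
      ultimately have "t + \<epsilon> * (w \<bullet> (A *v v)) + \<epsilon> * (w \<bullet> (A *v v)) + \<epsilon>\<^sup>2 * (w \<bullet> (A *v w))
          \<le> t * (1 + 2 * \<epsilon> * (w \<bullet> v) + \<epsilon>\<^sup>2 * (w \<bullet> w))"
        by (simp only: t_def[symmetric])
      then have "2 * \<epsilon> * (w \<bullet> (A *v v) - t * (w \<bullet> v)) \<le> \<epsilon>\<^sup>2 * c"
        unfolding c_def by (simp add: algebra_simps)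
      moreover have "w \<bullet> (A *v v) - t * (w \<bullet> v) = w \<bullet> w"
        by (simp add: w_def inner_diff_right)
      ultimately show ?thesis by simp
    qed
    define \<epsilon> where "\<epsilon> = (w \<bullet> w) / (\<bar>c\<bar> + 1)"
    have "\<epsilon> > 0" using ww by (simp add: \<epsilon>_def add_nonneg_pos)
    then have "2 * (w \<bullet> w) \<le> \<epsilon> * c" using quad[of \<epsilon>] by (simp add: power2_eq_square)
    also have "\<dots> \<le> \<epsilon> * (\<bar>c\<bar> + 1)" using \<open>\<epsilon> > 0\<close> by (intro mult_left_mono) auto
    also have "\<dots> = w \<bullet> w" by (simp add: \<epsilon>_def add_nonneg_eq_0_iff)
    finally show False using ww by simp
  qed
  then have "A *v v = t *\<^sub>R v" by (simp add: w_def)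
  moreover have "v \<noteq> 0" using vv by auto
  ultimately show ?thesis using that v1 max by blast
qed

text \<open>
  The two orthogonal eigenvectors are 1, with eigenvalue 1, and the maximizer of the Rayleigh
  quotient. As \<rho> < 1, the smaller of their two eigenvalues can only be that of the maximizer.
\<close>
lemma quadratic_form_le_second_eigenvalue:
  fixes A :: "real^'n^'n"
  assumes sym: "transpose A = A" and A1: "A *v 1 = 1" and \<rho>: "\<rho> < 1" "eigenvalue_nth 2 A \<le> \<rho>"
    and x: "x \<bullet> 1 = 0"
  shows "x \<bullet> (A *v x) \<le> \<rho> * (norm x)\<^sup>2"
proof (cases "x = 0")
  case False
  obtain v t where v: "v \<noteq> 0" "v \<bullet> 1 = 0" "A *v v = t *\<^sub>R v"
    and max: "\<And>y. y \<bullet> 1 = 0 \<Longrightarrow> y \<bullet> (A *v y) \<le> t * (y \<bullet> y)"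
    using rayleigh_max_eigenvector[OF sym A1 x False] by blast
  have "min 1 t \<le> eigenvalue_nth 2 A"
    by (rule eigenvalue_nth_2_ge[OF sym, of 1 _ v]) (use A1 v in \<open>auto simp: inner_commute vec_eq_iff\<close>)
  then have "t \<le> \<rho>" using \<rho> by auto
  then have "t * (x \<bullet> x) \<le> \<rho> * (x \<bullet> x)" by (intro mult_right_mono) auto
  then show ?thesis using max[OF x] by (simp add: dot_square_norm)
qed auto

section \<open>A descent recursion with delays\<close>

lemma geometric_sum_le:
  fixes s :: real
  assumes "0 \<le> s" "s < 1" "finite A"
  shows "(\<Sum>i\<in>A. s ^ i) \<le> 1 / (1 - s)"
proof -
  have "(\<Sum>i\<in>A. s ^ i) \<le> (\<Sum>i. s ^ i)"
    by (rule sum_le_suminf) (use assms in \<open>auto intro: summable_geometric\<close>)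
  then show ?thesis using assms by (simp add: suminf_geometric)
qed

text \<open>
  The weight that step j receives in all later steps. While k - 1 - j < T, the model read at step k
  may be any one between j + 1 and k, so each of these at most T weights is bounded by 1; afterwards
  the exponent is at least k - 1 - j - T.
\<close>
lemma delayed_geometric_sum_le:
  fixes s :: real and \<tau> :: "nat \<Rightarrow> nat"
  assumes s: "0 \<le> s" "s < 1" and \<tau>: "\<And>k. \<tau> k \<le> T"
  shows "(\<Sum>k | k < K \<and> j < k - \<tau> k. s ^ (k - \<tau> k - 1 - j)) \<le> T + 1 / (1 - s)"
proof -
  define A where "A = {k. k < K \<and> j < k - \<tau> k}"
  have fin: "finite A" unfolding A_def by simp
  have "(\<Sum>k\<in>A. s ^ (k - \<tau> k - 1 - j)) \<le>
      (\<Sum>k\<in>A. (if k - Suc j < T then 1 else 0) + (if k - Suc j < T then 0 else s ^ (k - Suc j - T)))"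
  proof (rule sum_mono)
    fix k assume k: "k \<in> A"
    show "s ^ (k - \<tau> k - 1 - j) \<le> (if k - Suc j < T then 1 else 0) + (if k - Suc j < T then 0 else s ^ (k - Suc j - T))"
      using s \<tau>[of k] k by (auto simp: A_def power_le_one intro!: power_decreasing)
  qed
  also have "\<dots> = card {k\<in>A. k - Suc j < T} + (\<Sum>k\<in>{k\<in>A. \<not> k - Suc j < T}. s ^ (k - Suc j - T))"
    using fin by (simp add: sum.distrib sum.If_cases Int_def conj_commute flip: sum.inter_filter)
  also have "card {k\<in>A. k - Suc j < T} \<le> card ((\<lambda>i. i + Suc j) ` {..<T})"
  proof (rule card_mono)
    show "{k\<in>A. k - Suc j < T} \<subseteq> (\<lambda>i. i + Suc j) ` {..<T}"
    proof
      fix k assume "k \<in> {k\<in>A. k - Suc j < T}"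
      then have "k = (k - Suc j) + Suc j" "k - Suc j \<in> {..<T}" by (auto simp: A_def)
      then show "k \<in> (\<lambda>i. i + Suc j) ` {..<T}" by (rule image_eqI)
    qed
  qed simp
  also have "\<dots> \<le> T" using card_image_le[of "{..<T}" "\<lambda>i. i + Suc j"] by simp
  also have "(\<Sum>k\<in>{k\<in>A. \<not> k - Suc j < T}. s ^ (k - Suc j - T)) =
      (\<Sum>i\<in>(\<lambda>k. k - Suc j - T) ` {k\<in>A. \<not> k - Suc j < T}. s ^ i)"
    by (rule sum.reindex_cong[symmetric, where l = "\<lambda>k. k - Suc j - T"])
      (auto simp: inj_on_def A_def)
  also have "\<dots> \<le> 1 / (1 - s)"
    by (rule geometric_sum_le) (use s fin in auto)
  finally show ?thesis unfolding A_def by simp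
qed

text \<open>
  The constant part b of u is summed over j first, which costs a factor R for each k and does not
  see the delay. The variable part h must be summed over k first, which costs T + R for each j.
\<close>
lemma delayed_convolution_sum_le:
  fixes s b R :: real and u h :: "nat \<Rightarrow> real" and \<tau> :: "nat \<Rightarrow> nat"
  assumes s: "0 \<le> s" "s < 1" and R: "R = 1 / (1 - s)"
    and \<tau>: "\<And>k. \<tau> k \<le> T" and b: "0 \<le> b" and h: "\<And>j. 0 \<le> h j" and u: "\<And>j. u j \<le> b + h j"
  shows "(\<Sum>k<K. \<Sum>j<k - \<tau> k. s ^ (k - \<tau> k - 1 - j) * u j) \<le> K * (b * R) + (T + R) * (\<Sum>j<K. h j)"
proof -
  have geo: "(\<Sum>j<m. s ^ (m - 1 - j)) \<le> R" for m
  proof -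
    have "(\<Sum>j<m. s ^ (m - 1 - j)) = (\<Sum>j<m. s ^ j)"
      using sum.nat_diff_reindex[of "\<lambda>j. s ^ j" m] by simp
    also have "\<dots> \<le> R" unfolding R by (rule geometric_sum_le) (use s in auto)
    finally show ?thesis .
  qed
  have "(\<Sum>k<K. \<Sum>j<k - \<tau> k. s ^ (k - \<tau> k - 1 - j) * u j) \<le>
      (\<Sum>k<K. \<Sum>j<k - \<tau> k. s ^ (k - \<tau> k - 1 - j) * (b + h j))"
    using s u by (intro sum_mono mult_left_mono) auto
  also have "\<dots> = (\<Sum>k<K. b * (\<Sum>j<k - \<tau> k. s ^ (k - \<tau> k - 1 - j)))
      + (\<Sum>k<K. \<Sum>j<k - \<tau> k. s ^ (k - \<tau> k - 1 - j) * h j)"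
    by (simp add: algebra_simps sum.distrib sum_distrib_left)
  also have "(\<Sum>k<K. b * (\<Sum>j<k - \<tau> k. s ^ (k - \<tau> k - 1 - j))) \<le> (\<Sum>k<K. b * R)"
    using b by (intro sum_mono mult_left_mono geo) auto
  also have "(\<Sum>k<K. \<Sum>j<k - \<tau> k. s ^ (k - \<tau> k - 1 - j) * h j)
      = (\<Sum>k<K. \<Sum>j<K. if j < k - \<tau> k then s ^ (k - \<tau> k - 1 - j) * h j else 0)"
  proof (rule sum.cong[OF refl])
    fix k assume "k \<in> {..<K}"
    then have "{..<k - \<tau> k} = {j \<in> {..<K}. j < k - \<tau> k}" by auto
    then show "(\<Sum>j<k - \<tau> k. s ^ (k - \<tau> k - 1 - j) * h j)
      = (\<Sum>j<K. if j < k - \<tau> k then s ^ (k - \<tau> k - 1 - j) * h j else 0)"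
      using sum.inter_filter[of "{..<K}" "\<lambda>j. s ^ (k - \<tau> k - 1 - j) * h j" "\<lambda>j. j < k - \<tau> k"] by simp
  qed
  also have "\<dots> = (\<Sum>j<K. \<Sum>k<K. if j < k - \<tau> k then s ^ (k - \<tau> k - 1 - j) * h j else 0)"
    by (rule sum.swap)
  also have "\<dots> = (\<Sum>j<K. (\<Sum>k | k < K \<and> j < k - \<tau> k. s ^ (k - \<tau> k - 1 - j)) * h j)"
    by (intro sum.cong refl) (simp add: sum_distrib_right flip: sum.inter_filter)
  also have "\<dots> \<le> (\<Sum>j<K. (T + R) * h j)"
    using delayed_geometric_sum_le[OF s \<tau>] h R by (intro sum_mono mult_right_mono) auto
  finally show ?thesis by (simp add: sum_distrib_left)
qed

lemma sliding_window_sum_le: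
  fixes u :: "nat \<Rightarrow> real" and \<tau> :: "nat \<Rightarrow> nat"
  assumes \<tau>: "\<And>k. \<tau> k \<le> T" and u: "\<And>j. 0 \<le> u j"
  shows "(\<Sum>k<K. \<tau> k * (\<Sum>j=k - \<tau> k..<k. u j)) \<le> (real T)\<^sup>2 * (\<Sum>j<K. u j)"
proof -
  have "(\<Sum>k<K. \<tau> k * (\<Sum>j=k - \<tau> k..<k. u j)) \<le> (\<Sum>k<K. T * (\<Sum>j<K. if k - T \<le> j \<and> j < k then u j else 0))"
  proof (intro sum_mono mult_mono)
    fix k assume k: "k \<in> {..<K}"
    have "(\<Sum>j=k - \<tau> k..<k. u j) \<le> (\<Sum>j | j < K \<and> (k - T \<le> j \<and> j < k). u j)"
      using \<tau>[of k] u k by (intro sum_mono2) auto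
    also have "\<dots> = (\<Sum>j<K. if k - T \<le> j \<and> j < k then u j else 0)"
      using sum.inter_filter[of "{..<K}" u "\<lambda>j. k - T \<le> j \<and> j < k"] by simp
    finally show "(\<Sum>j=k - \<tau> k..<k. u j) \<le> \<dots>" .
  qed (use \<tau> u in \<open>auto intro: sum_nonneg\<close>)
  also have "\<dots> = T * (\<Sum>j<K. \<Sum>k<K. if k - T \<le> j \<and> j < k then u j else 0)"
    by (subst sum.swap) (simp add: sum_distrib_left)
  also have "\<dots> \<le> T * (\<Sum>j<K. T * u j)"
  proof (intro mult_left_mono sum_mono)
    fix j
    have "(\<Sum>k<K. if k - T \<le> j \<and> j < k then u j else 0) = (\<Sum>k | k < K \<and> k - T \<le> j \<and> j < k. u j)"
      using sum.inter_filter[of "{..<K}" "\<lambda>_. u j" "\<lambda>k. k - T \<le> j \<and> j < k"] by simp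
    also have "\<dots> \<le> (\<Sum>k\<in>{j<..j+T}. u j)"
      using u by (intro sum_mono2) auto
    finally show "(\<Sum>k<K. if k - T \<le> j \<and> j < k then u j else 0) \<le> T * u j" by simp
  qed auto
  finally show ?thesis by (simp add: sum_distrib_left power2_eq_square mult.assoc)
qed

text \<open>
  The scalar core of the argument. N and H stand for the sums of the squared norms of the true and
  the mean gradient, w for the scaled second moments of the updates, y for the scaled disagreement
  and b for the noise. The inequality for y is implicit, with a coefficient small enough to solve it
  for y; what remains of H on the right of the last hypothesis is absorbed by H on its left, and the
  total coefficient of b stays below 2 a / n.
\<close>
lemma gradient_sum_bound_of_totals:
  fixes a b n q R T C H N w y :: real
  assumes n: "1 \<le> n" and nn: "0 \<le> a" "0 \<le> R" "0 \<le> T" "0 \<le> H" "0 \<le> b" "0 \<le> y"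
    and small: "10 * a \<le> n" "8 * (a * T\<^sup>2) \<le> n" "8 * (a * (n - 1) * R\<^sup>2) \<le> 1" "32 * (a * (n - 1)) \<le> 1"
    and w: "w \<le> b + H + 2 * y"
    and y: "y \<le> a\<^sup>2 * ((n - 1) / n) * R * (R * b + (T + R) * (H + 2 * y))"
    and N: "N + H \<le> C + 2 * (a\<^sup>2 * T\<^sup>2 / n\<^sup>2 * w + y) + a / n * w"
  shows "N \<le> C + 2 * (a / n) * b"
proof -
  define \<alpha> where "\<alpha> = a / n"
  have a: "a = \<alpha> * n" using n by (simp add: \<alpha>_def)
  have \<alpha>: "0 \<le> \<alpha>" "\<alpha> \<le> 1 / 10" "\<alpha> * T\<^sup>2 \<le> 1 / 8"
    using n nn small by (auto simp: \<alpha>_def field_simps)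
  have c1: "a\<^sup>2 * ((n - 1) / n) * R\<^sup>2 \<le> \<alpha> / 8"
  proof -
    have "a\<^sup>2 * ((n - 1) / n) * R\<^sup>2 = \<alpha> * (a * (n - 1) * R\<^sup>2)"
      by (simp add: \<alpha>_def power2_eq_square)
    also have "\<dots> \<le> \<alpha> * (1 / 8)" using small(3) \<alpha>(1) by (intro mult_left_mono) auto
    finally show ?thesis by simp
  qed
  have c2: "a\<^sup>2 * ((n - 1) / n) * T\<^sup>2 \<le> 1 / 256"
  proof -
    have "a\<^sup>2 * ((n - 1) / n) * T\<^sup>2 = (a * (n - 1)) * (\<alpha> * T\<^sup>2)"
      by (simp add: \<alpha>_def power2_eq_square)
    also have "\<dots> \<le> (1 / 32) * (1 / 8)" using small(4) \<alpha> n nn by (intro mult_mono) auto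
    finally show ?thesis by simp
  qed
  have c3: "a\<^sup>2 * ((n - 1) / n) * R * (T + R) \<le> 1 / 48"
  proof -
    \<comment> \<open>Neither T nor R is small against the other, so R T is split between their squares.\<close>
    have "R * (T + R) \<le> (T\<^sup>2 + 3 * R\<^sup>2) / 2"
      using sum_squares_bound[of R T] by (simp add: power2_eq_square algebra_simps)
    then have "a\<^sup>2 * ((n - 1) / n) * (R * (T + R)) \<le> a\<^sup>2 * ((n - 1) / n) * ((T\<^sup>2 + 3 * R\<^sup>2) / 2)"
      using n by (intro mult_left_mono) auto
    also have "\<dots> = (a\<^sup>2 * ((n - 1) / n) * T\<^sup>2 + 3 * (a\<^sup>2 * ((n - 1) / n) * R\<^sup>2)) / 2"
      by (simp add: distrib_left)
    also have "\<dots> \<le> (1 / 256 + 3 * (1 / 80)) / 2"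
    proof (intro divide_right_mono add_mono mult_left_mono)
      show "a\<^sup>2 * ((n - 1) / n) * R\<^sup>2 \<le> 1 / 80" using c1 \<alpha>(2) by linarith
    qed (use c2 in auto)
    also have "\<dots> \<le> 1 / 48" by simp
    finally show ?thesis by (simp only: mult.assoc)
  qed
  have "y \<le> a\<^sup>2 * ((n - 1) / n) * R\<^sup>2 * b + a\<^sup>2 * ((n - 1) / n) * R * (T + R) * (H + 2 * y)"
    using y by (simp only: distrib_left[of _ "R * b"] power2_eq_square mult.assoc)
  also have "\<dots> \<le> \<alpha> / 8 * b + 1 / 48 * (H + 2 * y)"
    using c1 c3 nn by (intro add_mono mult_right_mono) auto
  finally have y': "y \<le> \<alpha> * b / 8 + H / 48 + y / 24" by (simp add: field_simps)
  have "a\<^sup>2 * T\<^sup>2 / n\<^sup>2 = \<alpha> * (\<alpha> * T\<^sup>2)" by (simp add: \<alpha>_def power2_eq_square)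
  also have "\<dots> \<le> \<alpha> * (1 / 8)" using \<alpha> by (intro mult_left_mono)
  finally have c4: "2 * (a\<^sup>2 * T\<^sup>2 / n\<^sup>2) + \<alpha> \<le> 5 / 4 * \<alpha>" by linarith
  have "(2 * (a\<^sup>2 * T\<^sup>2 / n\<^sup>2) + \<alpha>) * w \<le> (2 * (a\<^sup>2 * T\<^sup>2 / n\<^sup>2) + \<alpha>) * (b + H + 2 * y)"
    using w \<alpha> by (intro mult_left_mono) auto
  also have "\<dots> \<le> 5 / 4 * \<alpha> * (b + H + 2 * y)"
    using c4 nn by (intro mult_right_mono) auto
  also have "\<dots> \<le> 5 / 4 * (\<alpha> * b) + 1 / 8 * (H + 2 * y)"
    using mult_right_mono[OF \<alpha>(2), of "H + 2 * y"] nn by (simp add: algebra_simps)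
  finally have "N + H \<le> C + 5 / 4 * (\<alpha> * b) + 1 / 8 * (H + 2 * y) + 2 * y"
    using N by (simp add: \<alpha>_def algebra_simps)
  moreover define z where "z = \<alpha> * b"
  ultimately have "N + H \<le> C + 5 / 4 * z + 1 / 8 * (H + 2 * y) + 2 * y" "y \<le> z / 8 + H / 48 + y / 24"
    using y' by (simp_all only: z_def)
  moreover have "0 \<le> z" using \<alpha> nn by (auto simp: z_def)
  ultimately have "N \<le> C + 2 * z" using nn(4) by (simp add: field_simps)
  then have "N \<le> C + 2 * (\<alpha> * b)" by (simp only: z_def)
  then show ?thesis by (simp add: \<alpha>_def)
qed

text \<open>
  Summation over k of the per-step inequalities for the updates u, the disagreement D, the staleness
  Z and the objective e, followed by a change of units that makes the totals dimensionless.
\<close>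
lemma delayed_descent_bound:
  fixes u H N D Z e :: "nat \<Rightarrow> real" and \<tau> :: "nat \<Rightarrow> nat" and L \<gamma> n M s R b fstar :: real
  assumes n: "1 \<le> n" and M: "0 < M" and \<gamma>: "0 < \<gamma>" and L: "0 \<le> L" and b: "0 \<le> b"
    and s: "0 \<le> s" "s < 1" and R: "R = 1 / (1 - s)"
    and \<tau>: "\<And>k. \<tau> k \<le> T"
    and small: "10 * (\<gamma> * M * L) \<le> n" "8 * (\<gamma> * M * L * (real T)\<^sup>2) \<le> n"
      "8 * (\<gamma> * M * L * (n - 1) * R\<^sup>2) \<le> 1" "32 * (\<gamma> * M * L * (n - 1)) \<le> 1"
    and H: "\<And>k. 0 \<le> H k" and D: "\<And>k. 0 \<le> D k" and u0: "\<And>k. 0 \<le> u k"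
    and u: "\<And>k. u k \<le> b + M\<^sup>2 * (H k + 2 * L\<^sup>2 * D (k - \<tau> k))"
    and consensus: "\<And>k. D k \<le> \<gamma>\<^sup>2 * ((n - 1) / n) * R * (\<Sum>j<k. s ^ (k - 1 - j) * u j)"
    and staleness: "\<And>k. Z k \<le> \<gamma>\<^sup>2 / n\<^sup>2 * (\<tau> k * (\<Sum>j=k - \<tau> k..<k. u j))"
    and descent: "\<And>k. e (Suc k) \<le> e k - \<gamma> * M / (2 * n) * (N k + H k)
      + \<gamma> * M * L\<^sup>2 / n * (Z k + D (k - \<tau> k)) + L * \<gamma>\<^sup>2 / (2 * n\<^sup>2) * u k"
    and e: "fstar \<le> e K"
  shows "(\<Sum>k<K. N k) \<le> 2 * n * (e 0 - fstar) / (\<gamma> * M) + 2 * (\<gamma> * L / (n * M)) * (K * b)"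
proof -
  define a where "a = \<gamma> * M * L"
  define U where "U = (\<Sum>k<K. u k)"
  define V where "V = (\<Sum>k<K. D (k - \<tau> k))"
  define Hs where "Hs = (\<Sum>k<K. H k)"
  define Zs where "Zs = (\<Sum>k<K. Z k)"
  define Ns where "Ns = (\<Sum>k<K. N k)"
  have sumh: "(\<Sum>k<K. M\<^sup>2 * (H k + 2 * L\<^sup>2 * D (k - \<tau> k))) = M\<^sup>2 * (Hs + 2 * (L\<^sup>2 * V))"
    by (simp add: Hs_def V_def sum_distrib_left[symmetric] sum.distrib mult.assoc)
  have R0: "0 \<le> R" using R s by simp
  have U: "U \<le> K * b + M\<^sup>2 * (Hs + 2 * (L\<^sup>2 * V))"
  proof -
    have "U \<le> (\<Sum>k<K. b + M\<^sup>2 * (H k + 2 * L\<^sup>2 * D (k - \<tau> k)))"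
      unfolding U_def using u by (rule sum_mono)
    then show ?thesis by (simp add: sum.distrib sumh)
  qed
  have V: "V \<le> \<gamma>\<^sup>2 * ((n - 1) / n) * R * (K * (b * R) + (T + R) * (M\<^sup>2 * (Hs + 2 * (L\<^sup>2 * V))))"
  proof -
    have "V \<le> (\<Sum>k<K. \<gamma>\<^sup>2 * ((n - 1) / n) * R * (\<Sum>j<k - \<tau> k. s ^ (k - \<tau> k - 1 - j) * u j))"
      unfolding V_def using consensus by (rule sum_mono)
    also have "\<dots> = \<gamma>\<^sup>2 * ((n - 1) / n) * R * (\<Sum>k<K. \<Sum>j<k - \<tau> k. s ^ (k - \<tau> k - 1 - j) * u j)"
      by (simp add: sum_distrib_left)
    also have "\<dots> \<le> \<gamma>\<^sup>2 * ((n - 1) / n) * R * (K * (b * R) + (T + R) *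
        (\<Sum>j<K. M\<^sup>2 * (H j + 2 * L\<^sup>2 * D (j - \<tau> j))))"
      using n R0 H D by (intro mult_left_mono delayed_convolution_sum_le[OF s R \<tau> b _ u]) auto
    finally show ?thesis by (simp add: sumh)
  qed
  have Zs: "Zs \<le> \<gamma>\<^sup>2 / n\<^sup>2 * ((real T)\<^sup>2 * U)"
  proof -
    have "Zs \<le> \<gamma>\<^sup>2 / n\<^sup>2 * (\<Sum>k<K. \<tau> k * (\<Sum>j=k - \<tau> k..<k. u j))"
      unfolding Zs_def sum_distrib_left[of "\<gamma>\<^sup>2 / n\<^sup>2"] using staleness by (rule sum_mono)
    also have "\<dots> \<le> \<gamma>\<^sup>2 / n\<^sup>2 * ((real T)\<^sup>2 * U)"
      unfolding U_def by (intro mult_left_mono sliding_window_sum_le \<tau> u0) auto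
    finally show ?thesis .
  qed
  have E: "fstar - e 0 \<le> - (\<gamma> * M / (2 * n)) * (Ns + Hs) + \<gamma> * M * L\<^sup>2 / n * (Zs + V)
      + L * \<gamma>\<^sup>2 / (2 * n\<^sup>2) * U"
  proof -
    have "fstar - e 0 \<le> (\<Sum>k<K. e (Suc k) - e k)" using e by (simp add: sum_lessThan_telescope)
    also have "\<dots> \<le> (\<Sum>k<K. - (\<gamma> * M / (2 * n)) * (N k + H k)
      + \<gamma> * M * L\<^sup>2 / n * (Z k + D (k - \<tau> k)) + L * \<gamma>\<^sup>2 / (2 * n\<^sup>2) * u k)"
    proof (rule sum_mono)
      fix k show "e (Suc k) - e k \<le> - (\<gamma> * M / (2 * n)) * (N k + H k)
      + \<gamma> * M * L\<^sup>2 / n * (Z k + D (k - \<tau> k)) + L * \<gamma>\<^sup>2 / (2 * n\<^sup>2) * u k"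
        using descent[of k] by simp
    qed
    also have "\<dots> = - (\<gamma> * M / (2 * n)) * (Ns + Hs) + \<gamma> * M * L\<^sup>2 / n * (Zs + V)
      + L * \<gamma>\<^sup>2 / (2 * n\<^sup>2) * U"
      by (simp only: sum.distrib sum_distrib_left[symmetric] Ns_def Hs_def Zs_def V_def U_def)
    finally show ?thesis .
  qed
  have "Ns \<le> 2 * n * (e 0 - fstar) / (\<gamma> * M) + 2 * (a / n) * (K * b / M\<^sup>2)"
  proof (rule gradient_sum_bound_of_totals[where R = R and T = T and H = Hs and w = "U / M\<^sup>2" and y = "L\<^sup>2 * V"])
    show "U / M\<^sup>2 \<le> K * b / M\<^sup>2 + Hs + 2 * (L\<^sup>2 * V)"
      using U M by (simp add: field_simps)
    have "L\<^sup>2 * V \<le> L\<^sup>2 * (\<gamma>\<^sup>2 * ((n - 1) / n) * R * (K * (b * R) + (T + R) * (M\<^sup>2 * (Hs + 2 * (L\<^sup>2 * V)))))"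
      using V by (intro mult_left_mono) auto
    also have "\<dots> = a\<^sup>2 * ((n - 1) / n) * R * (R * (K * b / M\<^sup>2) + (T + R) * (Hs + 2 * (L\<^sup>2 * V)))"
      using M n by (simp add: a_def field_simps power2_eq_square)
    finally show "L\<^sup>2 * V \<le> \<dots>" .
    have "Ns + Hs = 2 * n * (e 0 - fstar) / (\<gamma> * M)
       + 2 * n / (\<gamma> * M) * ((fstar - e 0) + \<gamma> * M / (2 * n) * (Ns + Hs))"
      using M n \<gamma> by (simp add: field_simps)
    also have "\<dots> \<le> 2 * n * (e 0 - fstar) / (\<gamma> * M)
       + 2 * n / (\<gamma> * M) * (\<gamma> * M * L\<^sup>2 / n * (\<gamma>\<^sup>2 / n\<^sup>2 * ((real T)\<^sup>2 * U) + V) + L * \<gamma>\<^sup>2 / (2 * n\<^sup>2) * U)"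
    proof (intro add_left_mono mult_left_mono)
      have "\<gamma> * M * L\<^sup>2 / n * (Zs + V) \<le> \<gamma> * M * L\<^sup>2 / n * (\<gamma>\<^sup>2 / n\<^sup>2 * ((real T)\<^sup>2 * U) + V)"
        using M n \<gamma> Zs by (intro mult_left_mono) auto
      then show "fstar - e 0 + \<gamma> * M / (2 * n) * (Ns + Hs) \<le>
        \<gamma> * M * L\<^sup>2 / n * (\<gamma>\<^sup>2 / n\<^sup>2 * ((real T)\<^sup>2 * U) + V) + L * \<gamma>\<^sup>2 / (2 * n\<^sup>2) * U"
        using E by simp
    qed (use M n \<gamma> in auto)
    also have "\<dots> = 2 * n * (e 0 - fstar) / (\<gamma> * M)
       + 2 * (a\<^sup>2 * (real T)\<^sup>2 / n\<^sup>2 * (U / M\<^sup>2) + L\<^sup>2 * V) + a / n * (U / M\<^sup>2)"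
      using M n \<gamma> by (simp add: a_def field_simps power2_eq_square)
    finally show "Ns + Hs \<le> \<dots>" .
  qed (use n small M \<gamma> L b H D R0 in \<open>auto simp: a_def Hs_def V_def intro!: sum_nonneg mult_nonneg_nonneg\<close>)
  also have "2 * (a / n) * (K * b / M\<^sup>2) = 2 * (\<gamma> * L / (n * M)) * (K * b)"
    using M by (simp add: a_def field_simps power2_eq_square)
  finally show ?thesis by (simp add: Ns_def)
qed

section \<open>Norm inequalities and smooth functions\<close>

lemma norm_add_power2_le:
  fixes x y :: "'a::real_normed_vector"
  shows "(norm (x + y))\<^sup>2 \<le> 2 * (norm x)\<^sup>2 + 2 * (norm y)\<^sup>2"
proof -
  have "(norm (x + y))\<^sup>2 \<le> (norm x + norm y)\<^sup>2" by (intro power_mono norm_triangle_ineq) auto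
  also have "\<dots> \<le> 2 * (norm x)\<^sup>2 + 2 * (norm y)\<^sup>2"
    using sum_squares_bound[of "norm x" "norm y"] by (simp add: power2_sum)
  finally show ?thesis .
qed

text \<open>
  The weights allow a sum of geometrically decaying terms to be bounded independently of its length.
\<close>
lemma norm_sum_power2_le_weighted:
  fixes y :: "'i \<Rightarrow> 'b::real_normed_vector"
  assumes w: "\<And>j. j \<in> J \<Longrightarrow> 0 < w j"
  shows "(norm (\<Sum>j\<in>J. y j))\<^sup>2 \<le> (\<Sum>j\<in>J. w j) * (\<Sum>j\<in>J. (norm (y j))\<^sup>2 / w j)"
proof -
  have "(norm (\<Sum>j\<in>J. y j))\<^sup>2 \<le> (\<Sum>j\<in>J. norm (y j))\<^sup>2"
    by (intro power_mono norm_sum) auto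
  also have "(\<Sum>j\<in>J. norm (y j)) = (\<Sum>j\<in>J. sqrt (w j) * (norm (y j) / sqrt (w j)))"
    using w by (intro sum.cong) (auto simp: less_imp_neq[THEN not_sym])
  also have "(\<dots>)\<^sup>2 \<le> (\<Sum>j\<in>J. (sqrt (w j))\<^sup>2) * (\<Sum>j\<in>J. (norm (y j) / sqrt (w j))\<^sup>2)"
    by (rule Cauchy_Schwarz_ineq_sum)
  also have "\<dots> = (\<Sum>j\<in>J. w j) * (\<Sum>j\<in>J. (norm (y j))\<^sup>2 / w j)"
    using w by (intro arg_cong2[where f = "(*)"] sum.cong) (auto simp: power_divide less_imp_le)
  finally show ?thesis .
qed

text \<open>
  Both parts follow from the decomposition of the second moment of y around any point c; the second
  uses that the mean minimizes the mean squared distance.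
\<close>
lemma norm_convex_sum_power2_le:
  fixes y :: "'i \<Rightarrow> 'b::real_inner"
  assumes p: "\<And>i. i \<in> S \<Longrightarrow> 0 \<le> p i" "(\<Sum>i\<in>S. p i) = 1"
  shows "(norm (\<Sum>i\<in>S. p i *\<^sub>R y i))\<^sup>2 \<le> (\<Sum>i\<in>S. p i * (norm (y i))\<^sup>2)"
    and "(\<Sum>i\<in>S. p i * (norm (y i))\<^sup>2) \<le> (norm (\<Sum>i\<in>S. p i *\<^sub>R y i))\<^sup>2 + (\<Sum>i\<in>S. p i * (norm (y i - c))\<^sup>2)"
proof -
  define m where "m = (\<Sum>i\<in>S. p i *\<^sub>R y i)"
  have eq: "(\<Sum>i\<in>S. p i * (norm (y i - c))\<^sup>2) = (\<Sum>i\<in>S. p i * (norm (y i))\<^sup>2) - 2 * (m \<bullet> c) + (norm c)\<^sup>2" for c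
  proof -
    have "(\<Sum>i\<in>S. p i * (norm (y i - c))\<^sup>2) = (\<Sum>i\<in>S. p i * (norm (y i))\<^sup>2 - 2 * ((p i *\<^sub>R y i) \<bullet> c) + p i * (norm c)\<^sup>2)"
      by (intro sum.cong refl) (simp add: power2_norm_eq_inner inner_diff_left inner_diff_right inner_commute algebra_simps)
    then show ?thesis
      using p(2) by (simp add: sum.distrib sum_subtractf m_def inner_sum_left flip: sum_distrib_left sum_distrib_right)
  qed
  have "0 \<le> (\<Sum>i\<in>S. p i * (norm (y i - m))\<^sup>2)" using p by (intro sum_nonneg) auto
  then show "(norm (\<Sum>i\<in>S. p i *\<^sub>R y i))\<^sup>2 \<le> (\<Sum>i\<in>S. p i * (norm (y i))\<^sup>2)"
    unfolding eq by (simp add: m_def[symmetric] power2_norm_eq_inner)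
  have "0 \<le> (norm (m - c))\<^sup>2" by simp
  then show "(\<Sum>i\<in>S. p i * (norm (y i))\<^sup>2) \<le> (norm (\<Sum>i\<in>S. p i *\<^sub>R y i))\<^sup>2 + (\<Sum>i\<in>S. p i * (norm (y i - c))\<^sup>2)"
    unfolding eq m_def[symmetric] by (simp add: power2_norm_eq_inner inner_diff_left inner_diff_right inner_commute)
qed

lemma gradient_eqI:
  assumes "GDERIV h x :> g"
  shows "gradient h x = g"
  unfolding gradient_def
proof (rule the_equality)
  show "GDERIV h x :> g" by (rule assms)
  fix g' assume "GDERIV h x :> g'"
  then have "(\<lambda>y. y \<bullet> g') = (\<lambda>y. y \<bullet> g)"
    using assms unfolding gderiv_def by (rule has_derivative_unique)
  then show "g' = g" by (metis vector_eq_ldot)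
qed

lemma differentiable_imp_GDERIV_gradient:
  fixes h :: "'a::euclidean_space \<Rightarrow> real"
  assumes "h differentiable (at x)"
  shows "GDERIV h x :> gradient h x"
proof -
  obtain h' where h': "(h has_derivative h') (at x)" using assms by (auto simp: differentiable_def)
  interpret bounded_linear h' using h' by (rule has_derivative_bounded_linear)
  define g where "g = (\<Sum>b\<in>Basis. h' b *\<^sub>R b)"
  have "h' y = y \<bullet> g" for y
  proof -
    have "h' y = h' (\<Sum>b\<in>Basis. (y \<bullet> b) *\<^sub>R b)" by (simp add: euclidean_representation)
    also have "\<dots> = (\<Sum>b\<in>Basis. (y \<bullet> b) * h' b)" by (simp add: sum scaleR)
    finally show ?thesis by (simp add: g_def inner_sum_right mult.commute)
  qed
  then have "h' = (\<lambda>y. y \<bullet> g)" by (rule ext)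
  with h' have "GDERIV h x :> g" by (simp add: gderiv_def)
  then show ?thesis using gradient_eqI by metis
qed

text \<open>
  Along the segment from x to x + v, the difference between h and the quadratic on the right has a
  derivative that is nonpositive by the Lipschitz bound.
\<close>
lemma lipschitz_gradient_upper_bound:
  fixes h :: "'a::euclidean_space \<Rightarrow> real"
  assumes h: "\<And>x. GDERIV h x :> g x" and g: "L-lipschitz_on UNIV g"
  shows "h (x + v) \<le> h x + g x \<bullet> v + L / 2 * (norm v)\<^sup>2"
proof -
  define \<phi> where "\<phi> t = h (x + t *\<^sub>R v) - t * (g x \<bullet> v) - L / 2 * t\<^sup>2 * (norm v)\<^sup>2" for t
  have der: "(\<phi> has_real_derivative (v \<bullet> g (x + t *\<^sub>R v) - g x \<bullet> v - L * t * (norm v)\<^sup>2)) (at t)" for t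
  proof -
    have "((\<lambda>t. x + t *\<^sub>R v) has_derivative (\<lambda>s. s *\<^sub>R v)) (at t)"
      by (auto intro!: derivative_eq_intros)
    moreover have "(h has_derivative (\<lambda>y. y \<bullet> g (x + t *\<^sub>R v))) (at (x + t *\<^sub>R v))"
      using h[of "x + t *\<^sub>R v"] by (simp add: gderiv_def)
    ultimately have "((\<lambda>t. h (x + t *\<^sub>R v)) has_derivative (\<lambda>s. (s *\<^sub>R v) \<bullet> g (x + t *\<^sub>R v))) (at t)"
      by (rule has_derivative_compose)
    then have "((\<lambda>t. h (x + t *\<^sub>R v)) has_real_derivative (v \<bullet> g (x + t *\<^sub>R v))) (at t)"
      unfolding has_field_derivative_def by (rule has_derivative_eq_rhs) (auto simp: mult.commute)
    then show ?thesis unfolding \<phi>_def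
      by (auto intro!: derivative_eq_intros)
  qed
  have "\<phi> 1 \<le> \<phi> 0"
  proof (rule DERIV_nonpos_imp_nonincreasing[of 0 1 \<phi>])
    fix t :: real assume t: "0 \<le> t" "t \<le> 1"
    have "v \<bullet> g (x + t *\<^sub>R v) - g x \<bullet> v = v \<bullet> (g (x + t *\<^sub>R v) - g x)"
      by (simp add: inner_diff_right inner_commute)
    also have "\<dots> \<le> norm v * norm (g (x + t *\<^sub>R v) - g x)" by (rule norm_cauchy_schwarz)
    also have "\<dots> \<le> norm v * (L * (t * norm v))"
      using lipschitz_onD[OF g, of "x + t *\<^sub>R v" x] t by (intro mult_left_mono) (auto simp: dist_norm)
    also have "\<dots> = L * t * (norm v)\<^sup>2" by (simp add: power2_eq_square)
    finally show "\<exists>y. (\<phi> has_real_derivative y) (at t) \<and> y \<le> 0" using der[of t] by auto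
  qed simp
  then show ?thesis by (simp add: \<phi>_def)
qed

section \<open>Independent sub-sigma-algebras and square-integrable variables\<close>

lemma Int_stable_events_of: "Int_stable (events_of P N Y)"
proof (rule Int_stableI)
  fix a b assume "a \<in> events_of P N Y" "b \<in> events_of P N Y"
  then obtain A B where "a = Y -` A \<inter> space P" "b = Y -` B \<inter> space P" "A \<in> sets N" "B \<in> sets N"
    by (auto simp: events_of_def)
  then show "a \<inter> b \<in> events_of P N Y"
    unfolding events_of_def by (intro CollectI exI[of _ "A \<inter> B"]) auto
qed

context prob_space
begin

text \<open>
  Independence of two sub-sigma-algebras, read as a statement about measures: the identity maps into
  them are independent random variables, so the diagonal embedding carries the probability measure to
  a product measure.
\<close>
lemma indep_set_imp_distr_diagonal:
  assumes A: "subalgebra M A" and B: "subalgebra M B" and ind: "indep_set (sets A) (sets B)"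
  shows "distr M A (\<lambda>x. x) \<Otimes>\<^sub>M distr M B (\<lambda>x. x) = distr M (A \<Otimes>\<^sub>M B) (\<lambda>x. (x, x))"
proof -
  have gen: "sigma_sets (space M) {(\<lambda>x. x) -` a \<inter> space M | a. a \<in> sets C} = sets C" if "subalgebra M C" for C
  proof -
    have "{(\<lambda>x. x) -` a \<inter> space M | a. a \<in> sets C} = sets C"
      using that sets.sets_into_space[of _ C] by (auto simp: subalgebra_def intro!: exI Int_absorb2[symmetric]) 
    then show ?thesis
      using sets.sigma_sets_eq[of C] that by (simp add: subalgebra_def)
  qed
  have "indep_var A (\<lambda>x. x) B (\<lambda>x. x)"
    unfolding indep_var_eq gen[OF A] gen[OF B]
    using ind measurable_from_subalg[OF A measurable_ident] measurable_from_subalg[OF B measurable_ident]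
    by (simp add: id_def)
  then show ?thesis unfolding indep_var_distribution_eq by simp
qed

text \<open>
  The first argument of h only sees A and the second only B, so they may be replaced by independent
  copies. This serves as the conditional expectation given A, without choosing versions.
\<close>
lemma nn_integral_freeze:
  fixes h :: "'a \<times> 'a \<Rightarrow> ennreal"
  assumes A: "subalgebra M A" and B: "subalgebra M B" and ind: "indep_set (sets A) (sets B)"
    and h: "h \<in> borel_measurable (A \<Otimes>\<^sub>M B)"
  shows "(\<integral>\<^sup>+x. h (x, x) \<partial>M) = (\<integral>\<^sup>+x. \<integral>\<^sup>+y. h (x, y) \<partial>M \<partial>M)"
proof -
  have id: "(\<lambda>x. x) \<in> measurable M A" "(\<lambda>x. x) \<in> measurable M B"
    using measurable_from_subalg[OF A measurable_ident] measurable_from_subalg[OF B measurable_ident]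
    by (simp_all add: id_def)
  then have diag: "(\<lambda>x. (x, x)) \<in> measurable M (A \<Otimes>\<^sub>M B)" by measurable
  let ?A = "distr M A (\<lambda>x. x)" and ?B = "distr M B (\<lambda>x. x)"
  interpret B: prob_space ?B by (rule prob_space_distr[OF id(2)])
  have h': "h \<in> borel_measurable (?A \<Otimes>\<^sub>M ?B)" using h by simp
  have "(\<integral>\<^sup>+x. h (x, x) \<partial>M) = (\<integral>\<^sup>+z. h z \<partial>(?A \<Otimes>\<^sub>M ?B))"
    unfolding indep_set_imp_distr_diagonal[OF A B ind] by (rule nn_integral_distr[OF diag, symmetric]) (simp add: h)
  also have "\<dots> = (\<integral>\<^sup>+x. \<integral>\<^sup>+y. h (x, y) \<partial>?B \<partial>?A)"
    by (rule B.nn_integral_fst[OF h', symmetric])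
  also have "\<dots> = (\<integral>\<^sup>+x. \<integral>\<^sup>+y. h (x, y) \<partial>?B \<partial>M)"
    using B.borel_measurable_nn_integral_fst[OF h'] by (intro nn_integral_distr id) simp
  also have "\<dots> = (\<integral>\<^sup>+x. \<integral>\<^sup>+y. h (x, y) \<partial>M \<partial>M)"
  proof (rule nn_integral_cong)
    fix x assume "x \<in> space M"
    then have "x \<in> space A" using A by (simp add: subalgebra_def)
    then have "(\<lambda>y. h (x, y)) \<in> borel_measurable B" by (rule measurable_Pair2[OF h])
    then show "(\<integral>\<^sup>+y. h (x, y) \<partial>?B) = (\<integral>\<^sup>+y. h (x, y) \<partial>M)"
      by (intro nn_integral_distr id) simp
  qed
  finally show ?thesis .
qed

lemma integral_freeze:
  fixes h :: "'a \<times> 'a \<Rightarrow> real"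
  assumes A: "subalgebra M A" and B: "subalgebra M B" and ind: "indep_set (sets A) (sets B)"
    and h: "h \<in> borel_measurable (A \<Otimes>\<^sub>M B)" and int: "integrable M (\<lambda>x. h (x, x))"
  shows "(\<integral>x. h (x, x) \<partial>M) = (\<integral>x. \<integral>y. h (x, y) \<partial>M \<partial>M)"
proof -
  have id: "(\<lambda>x. x) \<in> measurable M A" "(\<lambda>x. x) \<in> measurable M B"
    using measurable_from_subalg[OF A measurable_ident] measurable_from_subalg[OF B measurable_ident]
    by (simp_all add: id_def)
  then have diag: "(\<lambda>x. (x, x)) \<in> measurable M (A \<Otimes>\<^sub>M B)" by measurable
  let ?A = "distr M A (\<lambda>x. x)" and ?B = "distr M B (\<lambda>x. x)"
  interpret A: prob_space ?A by (rule prob_space_distr[OF id(1)])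
  interpret B: prob_space ?B by (rule prob_space_distr[OF id(2)])
  interpret AB: pair_sigma_finite ?A ?B ..
  have h': "h \<in> borel_measurable (?A \<Otimes>\<^sub>M ?B)" using h by simp
  have "integrable (?A \<Otimes>\<^sub>M ?B) h"
    unfolding indep_set_imp_distr_diagonal[OF A B ind] using h int by (simp add: integrable_distr_eq[OF diag])
  note fst = AB.integral_fst'[OF this]
  have "(\<integral>x. h (x, x) \<partial>M) = (\<integral>z. h z \<partial>(?A \<Otimes>\<^sub>M ?B))"
    unfolding indep_set_imp_distr_diagonal[OF A B ind] by (rule integral_distr[OF diag, symmetric]) (simp add: h)
  also have "\<dots> = (\<integral>x. \<integral>y. h (x, y) \<partial>?B \<partial>?A)"
    using fst by simp
  also have "\<dots> = (\<integral>x. \<integral>y. h (x, y) \<partial>?B \<partial>M)"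
    using B.borel_measurable_lebesgue_integral[of "\<lambda>x y. h (x, y)" ?A] h' by (intro integral_distr id) simp
  also have "\<dots> = (\<integral>x. \<integral>y. h (x, y) \<partial>M \<partial>M)"
  proof (rule Bochner_Integration.integral_cong[OF refl])
    fix x assume "x \<in> space M"
    then have "x \<in> space A" using A by (simp add: subalgebra_def)
    then have "(\<lambda>y. h (x, y)) \<in> borel_measurable B" by (rule measurable_Pair2[OF h])
    then show "(\<integral>y. h (x, y) \<partial>?B) = (\<integral>y. h (x, y) \<partial>M)"
      by (intro integral_distr id)
  qed
  finally show ?thesis .
qed

definition square_integrable :: "('a \<Rightarrow> 'b::euclidean_space) \<Rightarrow> bool" where
  "square_integrable Y \<longleftrightarrow> Y \<in> borel_measurable M \<and> integrable M (\<lambda>x. (norm (Y x))\<^sup>2)"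

lemma square_integrableD:
  assumes "square_integrable Y"
  shows "Y \<in> borel_measurable M" "integrable M (\<lambda>x. (norm (Y x))\<^sup>2)"
  using assms by (auto simp: square_integrable_def)

text \<open>
  The bridge from moment bounds in the extended nonnegative reals, as freezing produces them, to
  integrability and real-valued moments.
\<close>
lemma square_integrableI_nn:
  assumes "Y \<in> borel_measurable M" "(\<integral>\<^sup>+x. ennreal ((norm (Y x))\<^sup>2) \<partial>M) \<le> ennreal c" "0 \<le> c"
  shows "square_integrable Y" "(\<integral>x. (norm (Y x))\<^sup>2 \<partial>M) \<le> c"
proof -
  have "(\<integral>\<^sup>+x. ennreal ((norm (Y x))\<^sup>2) \<partial>M) < \<infinity>"
    using le_less_trans[OF assms(2) ennreal_less_top] by simp
  then have i: "integrable M (\<lambda>x. (norm (Y x))\<^sup>2)"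
    using assms(1) by (intro integrableI_nonneg) auto
  then show "square_integrable Y" using assms(1) by (simp add: square_integrable_def)
  have "ennreal (\<integral>x. (norm (Y x))\<^sup>2 \<partial>M) \<le> ennreal c"
    using assms(2) by (subst nn_integral_eq_integral[symmetric, OF i]) auto
  then show "(\<integral>x. (norm (Y x))\<^sup>2 \<partial>M) \<le> c" using assms(3) by (simp add: ennreal_le_iff)
qed

lemma square_integrable_AE_bound:
  fixes Y :: "'a \<Rightarrow> 'b::euclidean_space" and Z :: "'a \<Rightarrow> 'c::euclidean_space"
  assumes Z: "square_integrable Z" and Y: "Y \<in> borel_measurable M" and le: "AE x in M. norm (Y x) \<le> norm (Z x)"
  shows "square_integrable Y"
  unfolding square_integrable_def
proof (intro conjI Y Bochner_Integration.integrable_bound[OF square_integrableD(2)[OF Z]])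
  show "AE x in M. norm ((norm (Y x))\<^sup>2) \<le> norm ((norm (Z x))\<^sup>2)"
    using le by eventually_elim (auto intro: power_mono)
qed (use Y in measurable)

lemma square_integrable_const [simp]: "square_integrable (\<lambda>_. c)"
  by (simp add: square_integrable_def)

lemma square_integrable_norm: "square_integrable Y \<Longrightarrow> square_integrable (\<lambda>x. norm (Y x))"
  by (auto simp: square_integrable_def)

lemma square_integrable_scaleR: "square_integrable Y \<Longrightarrow> square_integrable (\<lambda>x. c *\<^sub>R Y x)"
  by (auto simp: square_integrable_def power_mult_distrib)

lemma square_integrable_add:
  assumes "square_integrable Y" "square_integrable Z"
  shows "square_integrable (\<lambda>x. Y x + Z x)"
  unfolding square_integrable_def
proof
  note [measurable] = square_integrableD(1)[OF assms(1)] square_integrableD(1)[OF assms(2)]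
  show "(\<lambda>x. Y x + Z x) \<in> borel_measurable M" by measurable
  have "integrable M (\<lambda>x. 2 * (norm (Y x))\<^sup>2 + 2 * (norm (Z x))\<^sup>2)"
    using assms by (auto simp: square_integrable_def)
  then show "integrable M (\<lambda>x. (norm (Y x + Z x))\<^sup>2)"
  proof (rule Bochner_Integration.integrable_bound)
    show "AE x in M. norm ((norm (Y x + Z x))\<^sup>2) \<le> norm (2 * (norm (Y x))\<^sup>2 + 2 * (norm (Z x))\<^sup>2)"
      by (rule AE_I2) (simp add: norm_add_power2_le)
  qed measurable
qed

lemma square_integrable_diff:
  assumes "square_integrable Y" "square_integrable Z"
  shows "square_integrable (\<lambda>x. Y x - Z x)"
  using square_integrable_add[OF assms(1) square_integrable_scaleR[OF assms(2), of "-1"]] by simp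

lemma square_integrable_sum:
  assumes "\<And>i. i \<in> S \<Longrightarrow> square_integrable (Y i)"
  shows "square_integrable (\<lambda>x. \<Sum>i\<in>S. Y i x)"
  using assms by (induction S rule: infinite_finite_induct) (auto intro: square_integrable_add)

lemma square_integrable_lipschitz:
  fixes h :: "'b::euclidean_space \<Rightarrow> 'c::euclidean_space"
  assumes "square_integrable Y" and h: "L-lipschitz_on UNIV h"
  shows "square_integrable (\<lambda>x. h (Y x))"
proof (rule square_integrable_AE_bound)
  have [measurable]: "h \<in> borel_measurable borel"
    by (intro borel_measurable_continuous_onI lipschitz_on_continuous_on[OF h])
  show "(\<lambda>x. h (Y x)) \<in> borel_measurable M" using square_integrableD(1)[OF assms(1)] by measurable
  show "square_integrable (\<lambda>x. norm (h 0) + L *\<^sub>R norm (Y x))"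
    by (intro square_integrable_add square_integrable_scaleR square_integrable_norm assms(1)) simp
  show "AE x in M. norm (h (Y x)) \<le> norm (norm (h 0) + L *\<^sub>R norm (Y x))"
  proof (rule AE_I2)
    fix x
    have "norm (h (Y x)) \<le> norm (h 0) + norm (h (Y x) - h 0)" using norm_triangle_sub by blast
    also have "norm (h (Y x) - h 0) \<le> L * norm (Y x)" using lipschitz_onD[OF h, of "Y x" 0] by (simp add: dist_norm)
    finally show "norm (h (Y x)) \<le> norm (norm (h 0) + L *\<^sub>R norm (Y x))" by simp
  qed
qed

lemma integrable_inner_square_integrable:
  assumes "square_integrable Y" "square_integrable Z"
  shows "integrable M (\<lambda>x. Y x \<bullet> Z x)"
proof (rule Bochner_Integration.integrable_bound)
  note [measurable] = square_integrableD(1)[OF assms(1)] square_integrableD(1)[OF assms(2)]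
  show "integrable M (\<lambda>x. (norm (Y x))\<^sup>2 + (norm (Z x))\<^sup>2)"
    using assms by (auto simp: square_integrable_def)
  show "(\<lambda>x. Y x \<bullet> Z x) \<in> borel_measurable M" by measurable
  show "AE x in M. norm (Y x \<bullet> Z x) \<le> norm ((norm (Y x))\<^sup>2 + (norm (Z x))\<^sup>2)"
  proof (rule AE_I2)
    fix x
    have "\<bar>Y x \<bullet> Z x\<bar> \<le> norm (Y x) * norm (Z x)" by (rule Cauchy_Schwarz_ineq2)
    also have "\<dots> \<le> (norm (Y x))\<^sup>2 + (norm (Z x))\<^sup>2"
      using sum_squares_bound[of "norm (Y x)" "norm (Z x)"] mult_nonneg_nonneg[OF norm_ge_zero[of "Y x"] norm_ge_zero[of "Z x"]]
      by linarith
    finally show "norm (Y x \<bullet> Z x) \<le> norm ((norm (Y x))\<^sup>2 + (norm (Z x))\<^sup>2)" by simp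
  qed
qed

lemma square_integrable_imp_integrable:
  fixes Y :: "'a \<Rightarrow> 'b::euclidean_space"
  assumes Y: "square_integrable Y"
  shows "integrable M Y"
proof (rule Bochner_Integration.integrable_bound)
  show "integrable M (\<lambda>x. 1 + (norm (Y x))\<^sup>2)" using Y by (auto simp: square_integrable_def)
  show "Y \<in> borel_measurable M" using Y by (rule square_integrableD)
  show "AE x in M. norm (Y x) \<le> norm (1 + (norm (Y x))\<^sup>2)"
  proof (rule AE_I2)
    fix x show "norm (Y x) \<le> norm (1 + (norm (Y x))\<^sup>2)"
      using sum_squares_bound[of 1 "norm (Y x)"] norm_ge_zero[of "Y x"] by (simp del: norm_ge_zero)
  qed
qed

text \<open>
  Independent centered vectors are orthogonal in the mean, so only the diagonal terms remain. This is
  why the variance of a batch grows like M and not like its square.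
\<close>
lemma expectation_norm_sum_centered_indep:
  fixes Y :: "'i \<Rightarrow> 'a \<Rightarrow> 'b::euclidean_space"
  assumes "finite J" and ind: "indep_vars (\<lambda>_. borel) Y J"
    and sq: "\<And>j. j \<in> J \<Longrightarrow> square_integrable (Y j)" and mean: "\<And>j. j \<in> J \<Longrightarrow> (\<integral>x. Y j x \<partial>M) = 0"
  shows "(\<integral>x. (norm (\<Sum>j\<in>J. Y j x))\<^sup>2 \<partial>M) = (\<Sum>j\<in>J. \<integral>x. (norm (Y j x))\<^sup>2 \<partial>M)"
proof -
  have cross: "(\<integral>x. Y j x \<bullet> Y l x \<partial>M) = 0" if "j \<in> J" "l \<in> J" "j \<noteq> l" for j l
  proof -
    have iv: "indep_vars (\<lambda>_. borel) (\<lambda>i x. Y i x \<bullet> b) {j, l}" for b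
      using indep_vars_compose2[OF indep_vars_subset[OF ind], of "{j, l}" "\<lambda>_ v. v \<bullet> b" "\<lambda>_. borel"] that by simp
    have ij: "integrable M (\<lambda>x. Y i x \<bullet> b)" if "i \<in> {j, l}" for i b
      using that \<open>j \<in> J\<close> \<open>l \<in> J\<close> sq square_integrable_imp_integrable by (auto intro: integrable_inner_left)
    have prod: "integrable M (\<lambda>x. (Y j x \<bullet> b) * (Y l x \<bullet> b))"
      "(\<integral>x. (Y j x \<bullet> b) * (Y l x \<bullet> b) \<partial>M) = (\<integral>x. Y j x \<bullet> b \<partial>M) * (\<integral>x. Y l x \<bullet> b \<partial>M)" for b
      using indep_vars_integrable[OF _ iv ij] indep_vars_lebesgue_integral[OF _ iv ij] that(3) by simp_all
    have "(\<integral>x. Y j x \<bullet> Y l x \<partial>M) = (\<integral>x. (\<Sum>b\<in>Basis. (Y j x \<bullet> b) * (Y l x \<bullet> b)) \<partial>M)"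
      by (subst euclidean_inner) simp
    also have "\<dots> = (\<Sum>b\<in>Basis. \<integral>x. (Y j x \<bullet> b) * (Y l x \<bullet> b) \<partial>M)"
      by (intro Bochner_Integration.integral_sum prod)
    also have "\<dots> = (\<Sum>b\<in>Basis. (\<integral>x. Y j x \<bullet> b \<partial>M) * (\<integral>x. Y l x \<bullet> b \<partial>M))"
      by (intro sum.cong refl prod)
    also have "\<dots> = 0"
      using integral_inner_left[of _ M "Y j"] mean[OF that(1)] square_integrable_imp_integrable[OF sq[OF that(1)]]
      by simp
    finally show ?thesis .
  qed
  have "(norm (\<Sum>j\<in>J. Y j x))\<^sup>2 = (\<Sum>j\<in>J. \<Sum>l\<in>J. Y j x \<bullet> Y l x)" for x
    unfolding power2_norm_eq_inner inner_sum_left inner_sum_right by (rule sum.swap)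
  then have "(\<integral>x. (norm (\<Sum>j\<in>J. Y j x))\<^sup>2 \<partial>M) = (\<integral>x. (\<Sum>j\<in>J. \<Sum>l\<in>J. Y j x \<bullet> Y l x) \<partial>M)"
    by simp
  also have "\<dots> = (\<Sum>j\<in>J. \<Sum>l\<in>J. \<integral>x. Y j x \<bullet> Y l x \<partial>M)"
    using sq by (simp add: Bochner_Integration.integral_sum Bochner_Integration.integrable_sum integrable_inner_square_integrable)
  also have "\<dots> = (\<Sum>j\<in>J. \<Sum>l\<in>J. if l = j then \<integral>x. Y j x \<bullet> Y j x \<partial>M else 0)"
    using cross by (intro sum.cong refl) auto
  also have "\<dots> = (\<Sum>j\<in>J. \<integral>x. (norm (Y j x))\<^sup>2 \<partial>M)"
    using \<open>finite J\<close> by (simp add: power2_norm_eq_inner)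
  finally show ?thesis .
qed

end

section \<open>Matrices and finite distributions\<close>

lemma nn_integral_pmf_distr:
  fixes h :: "'n::finite \<Rightarrow> ennreal"
  assumes "distr P (count_space UNIV) c = measure_pmf I" "c \<in> measurable P (count_space UNIV)"
  shows "(\<integral>\<^sup>+\<omega>. h (c \<omega>) \<partial>P) = (\<Sum>i\<in>UNIV. ennreal (pmf I i) * h i)"
proof -
  have "(\<integral>\<^sup>+\<omega>. h (c \<omega>) \<partial>P) = (\<integral>\<^sup>+i. h i \<partial>measure_pmf I)"
    unfolding assms(1)[symmetric] by (rule nn_integral_distr[symmetric]) (use assms(2) in auto)
  also have "\<dots> = (\<Sum>i\<in>UNIV. h i * ennreal (pmf I i))"
    by (rule nn_integral_measure_pmf_support) auto
  finally show ?thesis by (simp add: mult.commute)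
qed

lemma integral_pmf_distr:
  fixes h :: "'n::finite \<Rightarrow> real"
  assumes "distr P (count_space UNIV) c = measure_pmf I" "c \<in> measurable P (count_space UNIV)"
  shows "(\<integral>\<omega>. h (c \<omega>) \<partial>P) = (\<Sum>i\<in>UNIV. pmf I i * h i)"
proof -
  have "(\<integral>\<omega>. h (c \<omega>) \<partial>P) = (\<integral>i. h i \<partial>measure_pmf I)"
    unfolding assms(1)[symmetric] by (rule integral_distr[symmetric]) (use assms(2) in auto)
  also have "\<dots> = (\<Sum>i\<in>UNIV. h i * pmf I i)"
    by (rule integral_measure_pmf_real) auto
  finally show ?thesis by (simp add: mult.commute)
qed

lemma continuous_on_column: "continuous_on UNIV (column i :: real^'n^'d \<Rightarrow> real^'d)"
  unfolding column_def by (intro continuous_intros)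

lemma borel_measurable_column [measurable]: "(column i :: real^'n^'d \<Rightarrow> real^'d) \<in> borel_measurable borel"
  by (intro borel_measurable_continuous_onI continuous_on_column)

lemma borel_measurable_matrix_mult [measurable (raw)]:
  fixes A :: "'a \<Rightarrow> real^'n^'m" and B :: "'a \<Rightarrow> real^'k^'n"
  assumes "A \<in> borel_measurable N" "B \<in> borel_measurable N"
  shows "(\<lambda>x. A x ** B x) \<in> borel_measurable N"
proof (rule borel_measurable_continuous_Pair[OF assms])
  show "continuous_on UNIV (\<lambda>x. fst x ** snd x :: real^'k^'m)"
    unfolding matrix_matrix_mult_def by (intro continuous_intros)
qed

lemma borel_measurable_matrix_vector_mult [measurable (raw)]:
  fixes A :: "'a \<Rightarrow> real^'n^'m" and v :: "'a \<Rightarrow> real^'n"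
  assumes "A \<in> borel_measurable N" "v \<in> borel_measurable N"
  shows "(\<lambda>x. A x *v v x) \<in> borel_measurable N"
proof (rule borel_measurable_continuous_Pair[OF assms])
  show "continuous_on UNIV (\<lambda>x. fst x *v snd x :: real^'m)"
    unfolding matrix_vector_mult_def by (intro continuous_intros)
qed

lemma norm_matrix_le_sum_entries: "norm (A :: real^'n^'m) \<le> (\<Sum>i\<in>UNIV. \<Sum>j\<in>UNIV. \<bar>A $ i $ j\<bar>)"
proof -
  have "norm A \<le> (\<Sum>i\<in>UNIV. norm (A $ i))" unfolding norm_vec_def by (rule L2_set_le_sum) auto
  also have "\<dots> \<le> (\<Sum>i\<in>UNIV. \<Sum>j\<in>UNIV. \<bar>A $ i $ j\<bar>)" by (intro sum_mono norm_le_l1_cart)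
  finally show ?thesis .
qed

lemma doubly_stochastic_mult_1:
  assumes "doubly_stochastic A"
  shows "A *v 1 = 1" "transpose A *v 1 = 1"
  using assms by (auto simp: doubly_stochastic_def vec_eq_iff matrix_vector_mult_def transpose_def)

lemma doubly_stochastic_le_1:
  assumes "doubly_stochastic A"
  shows "A $ i $ j \<le> 1"
proof -
  have "A $ i $ j \<le> (\<Sum>j\<in>UNIV. A $ i $ j)" using assms by (intro member_le_sum) (auto simp: doubly_stochastic_def)
  then show ?thesis using assms by (simp add: doubly_stochastic_def)
qed

lemma column_matrix_mult: "column j (A ** B) = (\<Sum>k\<in>UNIV. (B $ k $ j) *\<^sub>R column k A)"
  for A :: "real^'n^'m" and B :: "real^'k^'n"
  by (simp add: vec_eq_iff column_def matrix_matrix_mult_def mult.commute)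

lemma bounded_linear_transpose: "bounded_linear (transpose :: real^'n^'m \<Rightarrow> real^'m^'n)"
  by (simp add: linear_conv_bounded_linear[symmetric] linear_iff transpose_def vec_eq_iff)

lemma bounded_linear_matrix_vector_mult_left: "bounded_linear (\<lambda>A :: real^'n^'m. A *v x)"
  by (simp add: linear_conv_bounded_linear[symmetric] linear_iff matrix_vector_mult_add_rdistrib scaleR_matrix_vector_assoc)

lemma norm_matrix_vector_mult_power2: "(norm (A *v x))\<^sup>2 = x \<bullet> ((transpose A ** A) *v x)"
  for A :: "real^'n^'m"
  unfolding power2_norm_eq_inner matrix_vector_mul_assoc[symmetric] transpose_matrix_vector
  by (metis dot_lmul_matrix inner_commute)

lemma doubly_stochastic_inner_1:
  assumes "doubly_stochastic A"
  shows "(A *v x) \<bullet> 1 = x \<bullet> 1"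
  using dot_lmul_matrix[of 1 A x] doubly_stochastic_mult_1(2)[OF assms]
  by (simp add: transpose_matrix_vector inner_commute)

section \<open>The random process and its sources of randomness\<close>

text \<open>
  The algorithm with the losses replaced by what is used of them: G i stands for the gradient of the
  local loss i, and gF i for its unbiased estimator. The bound T on the delays is a natural number,
  because it counts steps.
\<close>
locale ad_psgd = prob_space P
  for P :: "'w measure" +
  fixes I :: "'n::finite pmf"
    and D :: "'n \<Rightarrow> 's measure"
    and gF :: "'n \<Rightarrow> real^'d \<Rightarrow> 's \<Rightarrow> real^'d"
    and G :: "'n \<Rightarrow> real^'d \<Rightarrow> real^'d"
    and f :: "real^'d \<Rightarrow> real"
    and fstar n L \<sigma> \<zeta> \<rho> \<gamma> :: real
    and M T :: nat
    and x0 :: "real^'d"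
    and ik :: "nat \<Rightarrow> 'w \<Rightarrow> 'n"
    and W :: "nat \<Rightarrow> 'w \<Rightarrow> real^'n^'n"
    and \<xi> :: "nat \<Rightarrow> 'n \<Rightarrow> nat \<Rightarrow> 'w \<Rightarrow> 's"
    and \<tau> :: "nat \<Rightarrow> nat"
    and X :: "nat \<Rightarrow> 'w \<Rightarrow> real^'n^'d"
  assumes n: "n = real CARD('n)" and M: "1 \<le> M" and \<gamma>: "0 < \<gamma>"
    and gF_measurable: "\<And>i. (\<lambda>(x, s). gF i x s) \<in> borel_measurable (borel \<Otimes>\<^sub>M D i)"
    and gF_integrable: "\<And>i x. integrable (D i) (gF i x)"
    and gF_mean: "\<And>i x. (\<integral>s. gF i x s \<partial>D i) = G i x"
    and gF_variance_integrable: "\<And>i x. integrable (D i) (\<lambda>s. (norm (gF i x s - G i x))\<^sup>2)"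
    and gF_variance: "\<And>i x. (\<integral>s. (norm (gF i x s - G i x))\<^sup>2 \<partial>D i) \<le> \<sigma>\<^sup>2"
    and G_lipschitz: "\<And>i. L-lipschitz_on UNIV (G i)"
    and f_GDERIV: "\<And>x. GDERIV f x :> (\<Sum>i\<in>UNIV. pmf I i *\<^sub>R G i x)"
    and f_lower: "\<And>x. fstar \<le> f x"
    and G_heterogeneity: "\<And>x. (\<Sum>i\<in>UNIV. pmf I i * (norm (G i x - (\<Sum>i\<in>UNIV. pmf I i *\<^sub>R G i x)))\<^sup>2) \<le> \<zeta>\<^sup>2"
    and ik_rv [measurable]: "\<And>k. ik k \<in> measurable P (count_space UNIV)"
    and ik_distr: "\<And>k. distr P (count_space UNIV) (ik k) = measure_pmf I"
    and W_rv [measurable]: "\<And>k. W k \<in> borel_measurable P"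
    and \<xi>_rv: "\<And>k i j. j \<in> {1..M} \<Longrightarrow> \<xi> k i j \<in> measurable P (D i)"
    and \<xi>_distr: "\<And>k i j. j \<in> {1..M} \<Longrightarrow> distr P (D i) (\<xi> k i j) = D i"
    and \<xi>_batch: "\<And>k i. indep_vars (\<lambda>_. D i) (\<xi> k i) {1..M}"
    and sources: "independent_sources P D M ik W \<xi>"
    and \<tau>_le_T: "\<And>k. \<tau> k \<le> T"
    and W_doubly_stochastic: "\<And>k. AE \<omega> in P. doubly_stochastic (W k \<omega>)"
    and \<rho>: "0 \<le> \<rho>" "\<rho> < 1"
    and W_spectral: "\<And>k. eigenvalue_nth 2 (\<integral>\<omega>. transpose (W k \<omega>) ** W k \<omega> \<partial>P) \<le> \<rho>"
    and X_init: "\<And>\<omega> i. \<omega> \<in> space P \<Longrightarrow> column i (X 0 \<omega>) = x0"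
    and X_step: "\<And>k \<omega>. \<omega> \<in> space P \<Longrightarrow>
        X (Suc k) \<omega> = X k \<omega> ** W k \<omega>
          - \<gamma> *\<^sub>R batch_update gF M (X (k - \<tau> k) \<omega>) (\<lambda>j. \<xi> k (ik k \<omega>) j \<omega>) (ik k \<omega>)"
begin

text \<open>
  The independent families of events: index Inl k holds the worker and the averaging matrix of
  step k, index Inr k its samples.
\<close>
definition source :: "nat + nat \<Rightarrow> 'w set set" where
  "source = case_sum
     (\<lambda>k. events_of P (count_space UNIV \<Otimes>\<^sub>M borel) (\<lambda>\<omega>. (ik k \<omega>, W k \<omega>)))
     (\<lambda>k. events_of P (PiM (UNIV \<times> {1..M}) (\<lambda>(i, j). D i)) (\<lambda>\<omega>. \<lambda>(i, j)\<in>UNIV \<times> {1..M}. \<xi> k i j \<omega>))"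

definition sig :: "(nat + nat) set \<Rightarrow> 'w measure" where
  "sig S = sigma (space P) (\<Union>s\<in>S. source s)"

text \<open>
  The sources that determine the models X 0, ..., X k.
\<close>
definition past :: "nat \<Rightarrow> (nat + nat) set" where "past k = Inl ` {..<k} \<union> Inr ` {..<k}"

lemma indep_source: "indep_sets source UNIV"
  using sources by (simp add: independent_sources_def source_def)

lemma source_events: "source s \<subseteq> events"
  using indep_source by (auto simp: indep_sets_def)

lemma space_sig [simp]: "space (sig S) = space P"
  unfolding sig_def using source_events sets.space_closed[of P] by (intro space_measure_of) blast

lemma sets_sig: "sets (sig S) = sigma_sets (space P) (\<Union>s\<in>S. source s)"
  unfolding sig_def using source_events sets.space_closed[of P] by (intro sets_measure_of) blast

lemma subalgebra_sig: "subalgebra P (sig S)"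
  unfolding subalgebra_def sets_sig using source_events by (auto intro!: sets.sigma_sets_subset)

lemma measurable_sig: "Y \<in> measurable (sig S) N \<Longrightarrow> Y \<in> measurable P N"
  by (rule measurable_from_subalg[OF subalgebra_sig])

lemma measurable_sig_mono: "Y \<in> measurable (sig S) N \<Longrightarrow> S \<subseteq> S' \<Longrightarrow> Y \<in> measurable (sig S') N"
proof (rule measurable_from_subalg[rotated])
  assume "S \<subseteq> S'"
  then have "sets (sig S) \<subseteq> sets (sig S')" unfolding sets_sig by (intro sigma_sets_mono') blast
  then show "subalgebra (sig S') (sig S)" by (simp add: subalgebra_def)
qed

text \<open>
  Sources are closed under intersection, which allows passing from the generators to the generated
  sigma-algebras.
\<close>
lemma indep_sig:
  assumes "S \<inter> S' = {}"
  shows "indep_set (sets (sig S)) (sets (sig S'))"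
proof -
  have "indep_sets (\<lambda>j. sigma_sets (space P) (\<Union>s\<in>case_bool S S' j. source s)) UNIV"
  proof (rule indep_sets_collect_sigma)
    show "indep_sets source (\<Union>j\<in>UNIV. case_bool S S' j)"
      by (rule indep_sets_mono_index[OF _ indep_source]) auto
    show "Int_stable (source s)" for s
      by (cases s) (auto simp: source_def Int_stable_events_of)
    show "disjoint_family_on (case_bool S S') UNIV"
      using assms by (auto simp: disjoint_family_on_def split: bool.splits)
  qed
  also have "(\<lambda>j. sigma_sets (space P) (\<Union>s\<in>case_bool S S' j. source s)) = case_bool (sets (sig S)) (sets (sig S'))"
    by (auto simp: sets_sig split: bool.splits)
  finally show ?thesis by (simp add: indep_set_def)
qed

lemmas nn_integral_freeze_sig = nn_integral_freeze[OF subalgebra_sig subalgebra_sig indep_sig]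
lemmas integral_freeze_sig = integral_freeze[OF subalgebra_sig subalgebra_sig indep_sig]

lemma measurable_sig_of_events:
  assumes "s \<in> S" "source s = events_of P N V" "V \<in> space P \<rightarrow> space N"
  shows "V \<in> measurable (sig S) N"
proof (rule measurableI)
  fix A assume "A \<in> sets N"
  then have "V -` A \<inter> space P \<in> source s" using assms(2) by (auto simp: events_of_def)
  then show "V -` A \<inter> space (sig S) \<in> sets (sig S)"
    using assms(1) by (auto simp: sets_sig intro!: sigma_sets.Basic)
qed (use assms(3) in auto)

lemma ik_W_measurable_sig:
  assumes "Inl k \<in> S"
  shows "ik k \<in> measurable (sig S) (count_space UNIV)" "W k \<in> borel_measurable (sig S)"
proof -
  have *: "(\<lambda>\<omega>. (ik k \<omega>, W k \<omega>)) \<in> measurable (sig S) (count_space UNIV \<Otimes>\<^sub>M borel)"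
    by (rule measurable_sig_of_events[OF assms]) (auto simp: source_def space_pair_measure)
  show "ik k \<in> measurable (sig S) (count_space UNIV)" "W k \<in> borel_measurable (sig S)"
    using measurable_compose[OF * measurable_fst] measurable_compose[OF * measurable_snd] by simp_all
qed

lemma \<xi>_measurable_sig:
  assumes "Inr k \<in> S" "j \<in> {1..M}"
  shows "\<xi> k i j \<in> measurable (sig S) (D i)"
proof -
  have *: "(\<lambda>\<omega>. \<lambda>(i, j)\<in>UNIV \<times> {1..M}. \<xi> k i j \<omega>) \<in> measurable (sig S) (PiM (UNIV \<times> {1..M}) (\<lambda>(i, j). D i))"
  proof (rule measurable_sig_of_events[OF assms(1)])
    show "(\<lambda>\<omega>. \<lambda>(i, j)\<in>UNIV \<times> {1..M}. \<xi> k i j \<omega>) \<in> space P \<rightarrow> space (PiM (UNIV \<times> {1..M}) (\<lambda>(i, j). D i))"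
      using measurable_space[OF \<xi>_rv] by (fastforce simp: space_PiM PiE_def extensional_def split: prod.splits)
  qed (simp add: source_def)
  have "(\<lambda>h. h (i, j)) \<in> measurable (PiM (UNIV \<times> {1..M}) (\<lambda>(i, j). D i)) (case (i, j) of (i, j) \<Rightarrow> D i)"
    by (rule measurable_component_singleton) (use assms in auto)
  from measurable_compose[OF * this] show ?thesis using assms by simp
qed

definition batch_gradient :: "'n \<Rightarrow> real^'n^'d \<Rightarrow> (nat \<Rightarrow> 's) \<Rightarrow> real^'d" where
  "batch_gradient i Y b = (\<Sum>j=1..M. gF i (column i Y) (b j))"

definition g :: "nat \<Rightarrow> 'w \<Rightarrow> real^'d" where
  "g k \<omega> = batch_gradient (ik k \<omega>) (X (k - \<tau> k) \<omega>) (\<lambda>j. \<xi> k (ik k \<omega>) j \<omega>)"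

definition xbar :: "nat \<Rightarrow> 'w \<Rightarrow> real^'d" where "xbar k \<omega> = (1 / n) *\<^sub>R (X k \<omega> *v 1)"

text \<open>
  The gradient of f, in the form that f_GDERIV gives it.
\<close>
definition gf :: "real^'d \<Rightarrow> real^'d" where "gf x = (\<Sum>i\<in>UNIV. pmf I i *\<^sub>R G i x)"

definition mean_gradient :: "real^'n^'d \<Rightarrow> real^'d" where
  "mean_gradient Y = (\<Sum>i\<in>UNIV. pmf I i *\<^sub>R G i (column i Y))"

lemma sum_pmf: "(\<Sum>i\<in>UNIV. pmf I i) = 1"
  by (rule sum_pmf_eq_1) auto

lemma gf_lipschitz: "L-lipschitz_on UNIV gf"
proof (rule lipschitz_onI)
  fix x y :: "real^'d"
  have "dist (gf x) (gf y) = norm (\<Sum>i\<in>UNIV. pmf I i *\<^sub>R (G i x - G i y))"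
    by (simp add: gf_def dist_norm sum_subtractf scaleR_diff_right)
  also have "\<dots> \<le> (\<Sum>i\<in>UNIV. pmf I i * (L * dist x y))"
    using lipschitz_onD[OF G_lipschitz, of x y]
    by (intro sum_norm_le) (auto simp: dist_norm intro!: mult_left_mono)
  also have "\<dots> = L * dist x y" by (simp add: sum_distrib_right[symmetric] sum_pmf)
  finally show "dist (gf x) (gf y) \<le> L * dist x y" .
qed (rule lipschitz_on_nonneg[OF G_lipschitz])

lemma L: "0 \<le> L" by (rule lipschitz_on_nonneg[OF G_lipschitz])

lemma gf_measurable [measurable]: "gf \<in> borel_measurable borel"
  by (intro borel_measurable_continuous_onI lipschitz_on_continuous_on[OF gf_lipschitz])

lemma batch_gradient_measurable:
  assumes "c \<in> measurable N (count_space UNIV)" "Y \<in> borel_measurable N"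
    and b: "\<And>i j. j \<in> {1..M} \<Longrightarrow> b i j \<in> measurable N (D i)"
  shows "(\<lambda>\<omega>. batch_gradient (c \<omega>) (Y \<omega>) (\<lambda>j. b (c \<omega>) j \<omega>)) \<in> borel_measurable N"
proof (rule measurable_compose_countable[where g = c and f = "\<lambda>i \<omega>. batch_gradient i (Y \<omega>) (\<lambda>j. b i j \<omega>)"])
  fix i
  have "(\<lambda>\<omega>. gF i (column i (Y \<omega>)) (b i j \<omega>)) \<in> borel_measurable N" if "j \<in> {1..M}" for j
  proof -
    have "(\<lambda>\<omega>. (column i (Y \<omega>), b i j \<omega>)) \<in> measurable N (borel \<Otimes>\<^sub>M D i)"
      using b[OF that] assms(2) by measurable
    from measurable_compose[OF this gF_measurable] show ?thesis by simp
  qed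
  then show "(\<lambda>\<omega>. batch_gradient i (Y \<omega>) (\<lambda>j. b i j \<omega>)) \<in> borel_measurable N"
    unfolding batch_gradient_def by (intro borel_measurable_sum) auto
qed (rule assms(1))

lemma X_Suc:
  assumes "\<omega> \<in> space P"
  shows "X (Suc k) \<omega> = X k \<omega> ** W k \<omega> - \<gamma> *\<^sub>R (\<chi> r c. if c = ik k \<omega> then g k \<omega> $ r else 0)"
  unfolding X_step[OF assms] batch_update_def g_def batch_gradient_def ..

lemma past_mono: "j \<le> k \<Longrightarrow> past j \<subseteq> past k"
  by (auto simp: past_def)

lemma borel_measurable_single_column:
  assumes "c \<in> measurable N (count_space UNIV)" "v \<in> borel_measurable N"
  shows "(\<lambda>\<omega>. \<chi> r (c' :: 'n). if c' = c \<omega> then v \<omega> $ r else 0 :: real^'n^'d) \<in> borel_measurable N"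
proof (rule measurable_compose_countable[OF _ assms(1), where f = "\<lambda>i \<omega>. \<chi> r (c' :: 'n). if c' = i then v \<omega> $ r else 0"])
  fix i
  have "continuous_on UNIV (\<lambda>x :: real^'d. \<chi> r (c' :: 'n). if c' = i then x $ r else 0 :: real^'n^'d)"
  proof (intro continuous_on_vec_lambda)
    fix r c' show "continuous_on UNIV (\<lambda>x :: real^'d. if c' = i then x $ r else 0)"
      by (cases "c' = i") (auto intro: continuous_intros)
  qed
  from measurable_compose[OF assms(2) borel_measurable_continuous_onI[OF this]]
  show "(\<lambda>\<omega>. \<chi> r (c' :: 'n). if c' = i then v \<omega> $ r else 0 :: real^'n^'d) \<in> borel_measurable N" .
qed

lemma X_measurable_past: "X k \<in> borel_measurable (sig (past k))"
proof (induction k rule: less_induct)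
  case (less k)
  show ?case
  proof (cases k)
    case 0
    have "X 0 \<omega> = (\<chi> r c. x0 $ r)" if "\<omega> \<in> space P" for \<omega>
      using X_init[OF that] by (simp add: vec_eq_iff column_def)
    then have "X 0 \<in> borel_measurable (sig (past 0)) \<longleftrightarrow> (\<lambda>_. \<chi> r c. x0 $ r :: real^'n^'d) \<in> borel_measurable (sig (past 0))"
      by (intro measurable_cong) simp
    then show ?thesis using 0 by simp
  next
    case (Suc m)
    have old: "X j \<in> borel_measurable (sig (past k))" if "j \<le> m" for j
      using less[of j] that past_mono[of j k] Suc by (auto intro: measurable_sig_mono)
    have mem: "Inl m \<in> past k" "Inr m \<in> past k" using Suc by (auto simp: past_def)
    note [measurable] = ik_W_measurable_sig[OF mem(1)]
    have [measurable]: "g m \<in> borel_measurable (sig (past k))"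
      unfolding g_def[abs_def]
      by (intro batch_gradient_measurable old \<xi>_measurable_sig mem ik_W_measurable_sig) auto
    have [measurable]: "X m \<in> borel_measurable (sig (past k))" by (rule old) simp
    have "X k \<in> borel_measurable (sig (past k)) \<longleftrightarrow>
      (\<lambda>\<omega>. X m \<omega> ** W m \<omega> - \<gamma> *\<^sub>R (\<chi> r c. if c = ik m \<omega> then g m \<omega> $ r else 0)) \<in> borel_measurable (sig (past k))"
      using X_Suc[of _ m] Suc by (intro measurable_cong) simp
    moreover have "(\<lambda>\<omega>. X m \<omega> ** W m \<omega> - \<gamma> *\<^sub>R (\<chi> r c. if c = ik m \<omega> then g m \<omega> $ r else 0)) \<in> borel_measurable (sig (past k))"
      by (intro borel_measurable_diff borel_measurable_scaleR borel_measurable_single_column) measurable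
    ultimately show ?thesis by simp
  qed
qed

lemma X_measurable_past': "j \<le> k \<Longrightarrow> X j \<in> borel_measurable (sig (past k))"
  by (rule measurable_sig_mono[OF X_measurable_past past_mono])

lemma X_measurable [measurable]: "X k \<in> borel_measurable P"
  by (rule measurable_sig[OF X_measurable_past])

lemma g_measurable_past: "g k \<in> borel_measurable (sig (past (Suc k)))"
  unfolding g_def[abs_def]
  by (intro batch_gradient_measurable X_measurable_past' \<xi>_measurable_sig ik_W_measurable_sig) (auto simp: past_def)

lemma g_measurable [measurable]: "g k \<in> borel_measurable P"
  by (rule measurable_sig[OF g_measurable_past])

section \<open>Moments of the stochastic gradient\<close>

text \<open>
  A batch of worker i at a fixed model y: the sum of M copies of G i y and of M independent centered
  errors.
\<close>
lemma batch_moments: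
  fixes k :: nat and y :: "real^'d" and i :: 'n
  defines "S \<equiv> \<lambda>\<omega>. \<Sum>j=1..M. gF i y (\<xi> k i j \<omega>)"
  shows "square_integrable S" "(\<integral>\<omega>. S \<omega> \<partial>P) = M *\<^sub>R G i y"
    "(\<integral>\<omega>. (norm (S \<omega>))\<^sup>2 \<partial>P) \<le> M * \<sigma>\<^sup>2 + M\<^sup>2 * (norm (G i y))\<^sup>2"
proof -
  define Y where "Y j \<omega> = gF i y (\<xi> k i j \<omega>) - G i y" for j \<omega>
  have gF1: "gF i y \<in> borel_measurable (D i)"
    using gF_integrable[of i y] by auto
  have D: "(\<integral>\<omega>. h (\<xi> k i j \<omega>) \<partial>P) = (\<integral>s. h s \<partial>D i)"
    "integrable P (\<lambda>\<omega>. h (\<xi> k i j \<omega>)) \<longleftrightarrow> integrable (D i) h"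
    if "j \<in> {1..M}" "h \<in> borel_measurable (D i)" for j and h :: "'s \<Rightarrow> 'b::{banach, second_countable_topology}"
    using integral_distr[OF \<xi>_rv[OF that(1)] that(2)] integrable_distr_eq[OF \<xi>_rv[OF that(1)] that(2)]
    by (simp_all add: \<xi>_distr[OF that(1)])
  have Ym: "Y j \<in> borel_measurable P" if "j \<in> {1..M}" for j
    unfolding Y_def using measurable_compose[OF \<xi>_rv[OF that] gF1] by measurable
  have Ysq: "square_integrable (Y j)" if "j \<in> {1..M}" for j
    using Ym[OF that] D(2)[OF that, of "\<lambda>s. (norm (gF i y s - G i y))\<^sup>2"] gF_variance_integrable[of i y] gF1
    by (simp add: square_integrable_def Y_def)
  have Ymean: "(\<integral>\<omega>. Y j \<omega> \<partial>P) = 0" if "j \<in> {1..M}" for j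
    using D[OF that, of "gF i y"] gF1 gF_integrable gF_mean by (simp add: Y_def prob_space)
  have Yvar: "(\<integral>\<omega>. (norm (Y j \<omega>))\<^sup>2 \<partial>P) \<le> \<sigma>\<^sup>2" if "j \<in> {1..M}" for j
    using D(1)[OF that, of "\<lambda>s. (norm (gF i y s - G i y))\<^sup>2"] gF1 gF_variance[of i y] by (simp add: Y_def)
  have ind: "indep_vars (\<lambda>_. borel) Y {1..M}"
    using indep_vars_compose2[OF \<xi>_batch[of i k], of "\<lambda>_ s. gF i y s - G i y" "\<lambda>_. borel"] gF1
    by (simp add: Y_def[abs_def])
  define Z where "Z \<omega> = (\<Sum>j=1..M. Y j \<omega>)" for \<omega>
  have S: "S \<omega> = M *\<^sub>R G i y + Z \<omega>" for \<omega>
    by (simp add: S_def Z_def Y_def sum_subtractf scaleR_conv_of_real sum_constant_scaleR)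
  have Zsq: "square_integrable Z" unfolding Z_def by (intro square_integrable_sum Ysq)
  show "square_integrable S" unfolding S[abs_def] by (intro square_integrable_add Zsq) simp
  have Zmean: "(\<integral>\<omega>. Z \<omega> \<partial>P) = 0"
    unfolding Z_def using Ysq Ymean by (subst Bochner_Integration.integral_sum) (auto intro: square_integrable_imp_integrable)
  note Zint = square_integrable_imp_integrable[OF Zsq]
  show "(\<integral>\<omega>. S \<omega> \<partial>P) = M *\<^sub>R G i y" unfolding S using Zint Zmean by (simp add: prob_space)
  have "(\<integral>\<omega>. (norm (S \<omega>))\<^sup>2 \<partial>P) = (\<integral>\<omega>. M\<^sup>2 * (norm (G i y))\<^sup>2 + 2 * ((M *\<^sub>R G i y) \<bullet> Z \<omega>) + (norm (Z \<omega>))\<^sup>2 \<partial>P)"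
  proof (rule Bochner_Integration.integral_cong[OF refl])
    fix \<omega>
    have "(norm (S \<omega>))\<^sup>2 = (norm (M *\<^sub>R G i y))\<^sup>2 + 2 * ((M *\<^sub>R G i y) \<bullet> Z \<omega>) + (norm (Z \<omega>))\<^sup>2"
      unfolding S power2_norm_eq_inner by (simp only: inner_add_left inner_add_right inner_commute[of "Z \<omega>" "M *\<^sub>R G i y"])
    then show "(norm (S \<omega>))\<^sup>2 = M\<^sup>2 * (norm (G i y))\<^sup>2 + 2 * ((M *\<^sub>R G i y) \<bullet> Z \<omega>) + (norm (Z \<omega>))\<^sup>2"
      by (simp add: power_mult_distrib)
  qed
  also have "\<dots> = M\<^sup>2 * (norm (G i y))\<^sup>2 + (\<integral>\<omega>. (norm (Z \<omega>))\<^sup>2 \<partial>P)"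
    using Zint Zmean square_integrableD(2)[OF Zsq] by (simp add: prob_space)
  also have "(\<integral>\<omega>. (norm (Z \<omega>))\<^sup>2 \<partial>P) = (\<Sum>j=1..M. \<integral>\<omega>. (norm (Y j \<omega>))\<^sup>2 \<partial>P)"
    unfolding Z_def by (intro expectation_norm_sum_centered_indep ind Ysq Ymean) auto
  also have "\<dots> \<le> (\<Sum>j=1..M. \<sigma>\<^sup>2)" by (intro sum_mono Yvar)
  finally show "(\<integral>\<omega>. (norm (S \<omega>))\<^sup>2 \<partial>P) \<le> M * \<sigma>\<^sup>2 + M\<^sup>2 * (norm (G i y))\<^sup>2" by simp
qed

text \<open>
  One step of the algorithm at a fixed matrix of models: the worker is frozen while its samples are
  averaged.
\<close>
lemma step_second_moment:
  "(\<integral>\<^sup>+\<omega>. ennreal ((norm (batch_gradient (ik k \<omega>) Y (\<lambda>j. \<xi> k (ik k \<omega>) j \<omega>)))\<^sup>2) \<partial>P)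
    \<le> ennreal (M * \<sigma>\<^sup>2 + M\<^sup>2 * (\<Sum>i\<in>UNIV. pmf I i * (norm (G i (column i Y)))\<^sup>2))" (is "?l \<le> _")
proof -
  define h where "h = (\<lambda>(x, y). ennreal ((norm (batch_gradient (ik k x) Y (\<lambda>j. \<xi> k (ik k x) j y)))\<^sup>2))"
  have [measurable]: "(\<lambda>z. batch_gradient (ik k (fst z)) Y (\<lambda>j. \<xi> k (ik k (fst z)) j (snd z)))
      \<in> borel_measurable (sig {Inl k} \<Otimes>\<^sub>M sig {Inr k})"
    by (rule batch_gradient_measurable[where b = "\<lambda>i j z. \<xi> k i j (snd z)"])
      (auto intro: measurable_compose[OF measurable_fst ik_W_measurable_sig(1)] measurable_compose[OF measurable_snd \<xi>_measurable_sig])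
  have h: "h \<in> borel_measurable (sig {Inl k} \<Otimes>\<^sub>M sig {Inr k})"
    unfolding h_def case_prod_beta by measurable
  have "?l = (\<integral>\<^sup>+x. h (x, x) \<partial>P)" by (simp add: h_def)
  also have "\<dots> = (\<integral>\<^sup>+x. \<integral>\<^sup>+y. h (x, y) \<partial>P \<partial>P)"
    by (rule nn_integral_freeze_sig[OF _ h]) auto
  also have "\<dots> \<le> (\<integral>\<^sup>+x. ennreal (M * \<sigma>\<^sup>2 + M\<^sup>2 * (norm (G (ik k x) (column (ik k x) Y)))\<^sup>2) \<partial>P)"
  proof (rule nn_integral_mono)
    fix x
    note m = batch_moments[of "ik k x" "column (ik k x) Y" k]
    have "(\<integral>\<^sup>+y. h (x, y) \<partial>P) = ennreal (\<integral>\<omega>. (norm (\<Sum>j=1..M. gF (ik k x) (column (ik k x) Y) (\<xi> k (ik k x) j \<omega>)))\<^sup>2 \<partial>P)"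
      unfolding h_def batch_gradient_def prod.case
      using square_integrableD(2)[OF m(1)] by (intro nn_integral_eq_integral) auto
    also have "\<dots> \<le> ennreal (M * \<sigma>\<^sup>2 + M\<^sup>2 * (norm (G (ik k x) (column (ik k x) Y)))\<^sup>2)"
      using m(3) by (rule ennreal_leI)
    finally show "(\<integral>\<^sup>+y. h (x, y) \<partial>P) \<le> \<dots>" .
  qed
  also have "\<dots> = (\<Sum>i\<in>UNIV. ennreal (pmf I i) * ennreal (M * \<sigma>\<^sup>2 + M\<^sup>2 * (norm (G i (column i Y)))\<^sup>2))"
    by (rule nn_integral_pmf_distr[OF ik_distr ik_rv])
  also have "\<dots> = ennreal (\<Sum>i\<in>UNIV. pmf I i * (M * \<sigma>\<^sup>2 + M\<^sup>2 * (norm (G i (column i Y)))\<^sup>2))"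
    by (subst sum_ennreal[symmetric]) (auto simp: ennreal_mult)
  also have "(\<Sum>i\<in>UNIV. pmf I i * (M * \<sigma>\<^sup>2 + M\<^sup>2 * (norm (G i (column i Y)))\<^sup>2))
      = M * \<sigma>\<^sup>2 + M\<^sup>2 * (\<Sum>i\<in>UNIV. pmf I i * (norm (G i (column i Y)))\<^sup>2)"
  proof -
    have "(\<Sum>i\<in>UNIV. pmf I i * (M\<^sup>2 * (norm (G i (column i Y)))\<^sup>2)) = M\<^sup>2 * (\<Sum>i\<in>UNIV. pmf I i * (norm (G i (column i Y)))\<^sup>2)"
      by (simp add: sum_distrib_left mult.left_commute)
    then show ?thesis by (simp add: distrib_left sum.distrib sum_distrib_right[symmetric] sum_pmf)
  qed
  finally show ?thesis .
qed

lemma step_mean: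
  "(\<integral>\<omega>. v \<bullet> batch_gradient (ik k \<omega>) Y (\<lambda>j. \<xi> k (ik k \<omega>) j \<omega>) \<partial>P) = M * (v \<bullet> mean_gradient Y)" (is "?l = _")
proof -
  define h where "h = (\<lambda>(x, y). v \<bullet> batch_gradient (ik k x) Y (\<lambda>j. \<xi> k (ik k x) j y))"
  have [measurable]: "(\<lambda>z. batch_gradient (ik k (fst z)) Y (\<lambda>j. \<xi> k (ik k (fst z)) j (snd z)))
      \<in> borel_measurable (sig {Inl k} \<Otimes>\<^sub>M sig {Inr k})"
    by (rule batch_gradient_measurable[where b = "\<lambda>i j z. \<xi> k i j (snd z)"])
      (auto intro: measurable_compose[OF measurable_fst ik_W_measurable_sig(1)] measurable_compose[OF measurable_snd \<xi>_measurable_sig])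
  have h: "h \<in> borel_measurable (sig {Inl k} \<Otimes>\<^sub>M sig {Inr k})"
    unfolding h_def case_prod_beta by measurable
  have m: "(\<lambda>\<omega>. batch_gradient (ik k \<omega>) Y (\<lambda>j. \<xi> k (ik k \<omega>) j \<omega>)) \<in> borel_measurable P"
    by (intro batch_gradient_measurable \<xi>_rv) auto
  have sq: "square_integrable (\<lambda>\<omega>. batch_gradient (ik k \<omega>) Y (\<lambda>j. \<xi> k (ik k \<omega>) j \<omega>))"
    by (rule square_integrableI_nn[OF m step_second_moment]) (auto intro!: add_nonneg_nonneg sum_nonneg mult_nonneg_nonneg)
  have "?l = (\<integral>x. h (x, x) \<partial>P)" by (simp add: h_def)
  also have "\<dots> = (\<integral>x. \<integral>y. h (x, y) \<partial>P \<partial>P)"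
    using integrable_inner_square_integrable[OF square_integrable_const sq]
    by (intro integral_freeze_sig[OF _ h]) (auto simp: h_def)
  also have "\<dots> = (\<integral>x. M * (v \<bullet> G (ik k x) (column (ik k x) Y)) \<partial>P)"
  proof (rule Bochner_Integration.integral_cong[OF refl])
    fix x
    note m = batch_moments[of "ik k x" "column (ik k x) Y" k]
    show "(\<integral>y. h (x, y) \<partial>P) = M * (v \<bullet> G (ik k x) (column (ik k x) Y))"
      unfolding h_def batch_gradient_def prod.case
      using m(2) square_integrable_imp_integrable[OF m(1)] by (simp add: integral_inner_right)
  qed
  also have "\<dots> = (\<Sum>i\<in>UNIV. pmf I i * (M * (v \<bullet> G i (column i Y))))"
    by (rule integral_pmf_distr[OF ik_distr ik_rv])
  also have "\<dots> = M * (v \<bullet> mean_gradient Y)"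
    by (simp add: mean_gradient_def inner_sum_right sum_distrib_left mult.left_commute)
  finally show ?thesis .
qed

text \<open>
  The second moment of the local gradients is the square of their mean plus their spread, and the
  spread is at most the mean squared distance to the gradient of f at any common point c. The
  Lipschitz bound controls moving the workers to c, and the heterogeneity bound what is left there.
\<close>
lemma weighted_local_gradient_bound:
  "(\<Sum>i\<in>UNIV. pmf I i * (norm (G i (column i Y)))\<^sup>2)
    \<le> (norm (mean_gradient Y))\<^sup>2 + 2 * L\<^sup>2 * (\<Sum>i\<in>UNIV. pmf I i * (norm (column i Y - c))\<^sup>2) + 2 * \<zeta>\<^sup>2"
proof -
  have "(\<Sum>i\<in>UNIV. pmf I i * (norm (G i (column i Y)))\<^sup>2)
      \<le> (norm (mean_gradient Y))\<^sup>2 + (\<Sum>i\<in>UNIV. pmf I i * (norm (G i (column i Y) - gf c))\<^sup>2)"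
    unfolding mean_gradient_def by (rule norm_convex_sum_power2_le(2)) (auto simp: sum_pmf)
  also have "(\<Sum>i\<in>UNIV. pmf I i * (norm (G i (column i Y) - gf c))\<^sup>2)
      \<le> (\<Sum>i\<in>UNIV. pmf I i * (2 * (L\<^sup>2 * (norm (column i Y - c))\<^sup>2) + 2 * (norm (G i c - gf c))\<^sup>2))"
  proof (intro sum_mono mult_left_mono)
    fix i
    have "(norm (G i (column i Y) - gf c))\<^sup>2 \<le> 2 * (norm (G i (column i Y) - G i c))\<^sup>2 + 2 * (norm (G i c - gf c))\<^sup>2"
      using norm_add_power2_le[of "G i (column i Y) - G i c" "G i c - gf c"] by simp
    moreover have "(norm (G i (column i Y) - G i c))\<^sup>2 \<le> (L * norm (column i Y - c))\<^sup>2"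
      using lipschitz_onD[OF G_lipschitz, of "column i Y" c i] by (intro power_mono) (auto simp: dist_norm)
    ultimately show "(norm (G i (column i Y) - gf c))\<^sup>2
        \<le> 2 * (L\<^sup>2 * (norm (column i Y - c))\<^sup>2) + 2 * (norm (G i c - gf c))\<^sup>2"
      by (simp add: power_mult_distrib)
  qed auto
  also have "\<dots> = 2 * L\<^sup>2 * (\<Sum>i\<in>UNIV. pmf I i * (norm (column i Y - c))\<^sup>2)
      + 2 * (\<Sum>i\<in>UNIV. pmf I i * (norm (G i c - gf c))\<^sup>2)"
    by (simp add: distrib_left sum.distrib sum_distrib_left mult.assoc mult.left_commute)
  also have "\<dots> \<le> 2 * L\<^sup>2 * (\<Sum>i\<in>UNIV. pmf I i * (norm (column i Y - c))\<^sup>2) + 2 * \<zeta>\<^sup>2"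
    using G_heterogeneity[of c] by (simp add: gf_def)
  finally show ?thesis by simp
qed

lemma gf_minus_mean_gradient_bound:
  "(norm (gf x - mean_gradient Y))\<^sup>2
    \<le> 2 * L\<^sup>2 * ((norm (x - c))\<^sup>2 + (\<Sum>i\<in>UNIV. pmf I i * (norm (column i Y - c))\<^sup>2))"
proof -
  have "(norm (gf x - mean_gradient Y))\<^sup>2 \<le> 2 * (norm (gf x - gf c))\<^sup>2 + 2 * (norm (gf c - mean_gradient Y))\<^sup>2"
    using norm_add_power2_le[of "gf x - gf c" "gf c - mean_gradient Y"] by simp
  also have "(norm (gf x - gf c))\<^sup>2 \<le> (L * norm (x - c))\<^sup>2"
    using lipschitz_onD[OF gf_lipschitz, of x c] by (intro power_mono) (auto simp: dist_norm)
  also have "gf c - mean_gradient Y = (\<Sum>i\<in>UNIV. pmf I i *\<^sub>R (G i c - G i (column i Y)))"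
    by (simp add: gf_def mean_gradient_def sum_subtractf scaleR_diff_right)
  also have "(norm \<dots>)\<^sup>2 \<le> (\<Sum>i\<in>UNIV. pmf I i * (norm (G i c - G i (column i Y)))\<^sup>2)"
    by (rule norm_convex_sum_power2_le(1)) (auto simp: sum_pmf)
  also have "\<dots> \<le> (\<Sum>i\<in>UNIV. pmf I i * (L * norm (column i Y - c))\<^sup>2)"
  proof (intro sum_mono mult_left_mono power_mono)
    fix i show "norm (G i c - G i (column i Y)) \<le> L * norm (column i Y - c)"
      using lipschitz_onD[OF G_lipschitz, of c "column i Y" i] by (simp add: dist_norm norm_minus_commute)
  qed auto
  finally show ?thesis
    by (simp add: power_mult_distrib distrib_left sum_distrib_left mult.left_commute mult.assoc)
qed

text \<open>
  The update g k, given square-integrable models: all earlier randomness is frozen, while that of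
  step k is averaged out.
\<close>
lemma g_moments:
  assumes cols: "\<And>i. square_integrable (\<lambda>\<omega>. column i (X (k - \<tau> k) \<omega>))"
  shows "square_integrable (g k)"
    "(\<integral>\<omega>. (norm (g k \<omega>))\<^sup>2 \<partial>P)
      \<le> M * \<sigma>\<^sup>2 + M\<^sup>2 * (\<integral>\<omega>. (\<Sum>i\<in>UNIV. pmf I i * (norm (G i (column i (X (k - \<tau> k) \<omega>))))\<^sup>2) \<partial>P)"
proof -
  let ?Y = "X (k - \<tau> k)"
  define h where "h = (\<lambda>(x, y). ennreal ((norm (batch_gradient (ik k y) (?Y x) (\<lambda>j. \<xi> k (ik k y) j y)))\<^sup>2))"
  have [measurable]: "(\<lambda>z. batch_gradient (ik k (snd z)) (?Y (fst z)) (\<lambda>j. \<xi> k (ik k (snd z)) j (snd z)))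
      \<in> borel_measurable (sig (past k) \<Otimes>\<^sub>M sig {Inl k, Inr k})"
    by (rule batch_gradient_measurable[where b = "\<lambda>i j z. \<xi> k i j (snd z)"])
      (auto intro: measurable_compose[OF measurable_snd ik_W_measurable_sig(1)] measurable_compose[OF measurable_snd \<xi>_measurable_sig]
        measurable_compose[OF measurable_fst X_measurable_past'])
  have h: "h \<in> borel_measurable (sig (past k) \<Otimes>\<^sub>M sig {Inl k, Inr k})"
    unfolding h_def case_prod_beta by measurable
  define B where "B \<omega> = (\<Sum>i\<in>UNIV. pmf I i * (norm (G i (column i (?Y \<omega>))))\<^sup>2)" for \<omega>
  have B0: "0 \<le> B \<omega>" for \<omega> unfolding B_def by (intro sum_nonneg) auto
  have Bi: "integrable P B"
    unfolding B_def
    by (intro Bochner_Integration.integrable_sum integrable_mult_right square_integrableD square_integrable_lipschitz[OF cols G_lipschitz])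
  have "(\<integral>\<^sup>+\<omega>. ennreal ((norm (g k \<omega>))\<^sup>2) \<partial>P) = (\<integral>\<^sup>+x. h (x, x) \<partial>P)"
    by (simp add: h_def g_def)
  also have "\<dots> = (\<integral>\<^sup>+x. \<integral>\<^sup>+y. h (x, y) \<partial>P \<partial>P)"
    by (rule nn_integral_freeze_sig[OF _ h]) (auto simp: past_def)
  also have "\<dots> \<le> (\<integral>\<^sup>+x. ennreal (M * \<sigma>\<^sup>2 + M\<^sup>2 * B x) \<partial>P)"
    unfolding h_def prod.case B_def by (intro nn_integral_mono step_second_moment)
  also have "\<dots> = ennreal (\<integral>x. M * \<sigma>\<^sup>2 + M\<^sup>2 * B x \<partial>P)"
    using Bi B0 by (intro nn_integral_eq_integral) auto
  also have "(\<integral>x. M * \<sigma>\<^sup>2 + M\<^sup>2 * B x \<partial>P) = M * \<sigma>\<^sup>2 + M\<^sup>2 * (\<integral>x. B x \<partial>P)"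
    using Bi by (simp add: prob_space)
  finally have le: "(\<integral>\<^sup>+\<omega>. ennreal ((norm (g k \<omega>))\<^sup>2) \<partial>P) \<le> ennreal (M * \<sigma>\<^sup>2 + M\<^sup>2 * (\<integral>x. B x \<partial>P))" .
  have nn: "0 \<le> M * \<sigma>\<^sup>2 + M\<^sup>2 * (\<integral>x. B x \<partial>P)" using B0 by simp
  show "square_integrable (g k)"
    "(\<integral>\<omega>. (norm (g k \<omega>))\<^sup>2 \<partial>P)
      \<le> M * \<sigma>\<^sup>2 + M\<^sup>2 * (\<integral>\<omega>. (\<Sum>i\<in>UNIV. pmf I i * (norm (G i (column i (X (k - \<tau> k) \<omega>))))\<^sup>2) \<partial>P)"
    using square_integrableI_nn[OF g_measurable le nn] by (simp_all add: B_def)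
qed

text \<open>
  Strong induction, because g k is evaluated at the older model X (k - \<tau> k). The entries of a doubly
  stochastic matrix are at most 1, which keeps X k ** W k square-integrable.
\<close>
lemma square_integrable_column_X: "square_integrable (\<lambda>\<omega>. column i (X k \<omega>))"
proof (induction k arbitrary: i rule: less_induct)
  case (less k)
  show ?case
  proof (cases k)
    case 0
    show ?thesis
      by (rule square_integrable_AE_bound[of "\<lambda>_. x0"]) (auto simp: 0 X_init)
  next
    case (Suc m)
    have cols: "square_integrable (\<lambda>\<omega>. column c (X j \<omega>))" if "j \<le> m" for c j
      using less[of j] that Suc by auto
    have g: "square_integrable (g m)" by (intro g_moments cols) simp
    show ?thesis
    proof (rule square_integrable_AE_bound)
      show "square_integrable (\<lambda>\<omega>. (\<Sum>c\<in>UNIV. norm (column c (X m \<omega>))) + \<gamma> *\<^sub>R norm (g m \<omega>))"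
        by (intro square_integrable_add square_integrable_sum square_integrable_norm square_integrable_scaleR cols g) simp
      show "(\<lambda>\<omega>. column i (X k \<omega>)) \<in> borel_measurable P" by measurable
      show "AE \<omega> in P. norm (column i (X k \<omega>)) \<le> norm ((\<Sum>c\<in>UNIV. norm (column c (X m \<omega>))) + \<gamma> *\<^sub>R norm (g m \<omega>))"
        using W_doubly_stochastic[of m] AE_space
      proof eventually_elim
        case (elim \<omega>)
        have "column i (X k \<omega>) = (\<Sum>c\<in>UNIV. (W m \<omega> $ c $ i) *\<^sub>R column c (X m \<omega>)) - \<gamma> *\<^sub>R (if i = ik m \<omega> then g m \<omega> else 0)"
          unfolding Suc X_Suc[OF elim(2)] column_matrix_mult[symmetric] by (simp add: column_def vec_eq_iff)
        also have "norm \<dots> \<le> norm (\<Sum>c\<in>UNIV. (W m \<omega> $ c $ i) *\<^sub>R column c (X m \<omega>)) + norm (\<gamma> *\<^sub>R (if i = ik m \<omega> then g m \<omega> else 0))"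
          by (rule norm_triangle_ineq4)
        also have "norm (\<Sum>c\<in>UNIV. (W m \<omega> $ c $ i) *\<^sub>R column c (X m \<omega>)) \<le> (\<Sum>c\<in>UNIV. norm (column c (X m \<omega>)))"
          using doubly_stochastic_le_1[OF elim(1)] elim(1)
          by (intro sum_norm_le) (auto simp: doubly_stochastic_def intro!: mult_left_le_one_le)
        also have "norm (\<gamma> *\<^sub>R (if i = ik m \<omega> then g m \<omega> else 0)) \<le> \<gamma> *\<^sub>R norm (g m \<omega>)" using \<gamma> by auto
        finally show ?case by simp
      qed
    qed
  qed
qed

lemmas square_integrable_g = g_moments(1)[OF square_integrable_column_X]

lemma xbar_eq_sum_columns: "xbar k \<omega> = (\<Sum>i\<in>UNIV. (1 / n) *\<^sub>R column i (X k \<omega>))"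
  by (simp add: xbar_def vec_eq_iff matrix_vector_mult_def column_def sum_distrib_left)

lemma square_integrable_xbar: "square_integrable (xbar k)"
  unfolding xbar_eq_sum_columns[abs_def] by (intro square_integrable_sum square_integrable_scaleR square_integrable_column_X)

lemma xbar_measurable_past: "xbar k \<in> borel_measurable (sig (past k))"
  using X_measurable_past[of k] unfolding xbar_def[abs_def] by measurable

definition disagreement :: "nat \<Rightarrow> real" where
  "disagreement k = (\<Sum>i\<in>UNIV. pmf I i * (\<integral>\<omega>. (norm (column i (X k \<omega>) - xbar k \<omega>))\<^sup>2 \<partial>P))"

lemma disagreement_nonneg: "0 \<le> disagreement k"
  unfolding disagreement_def by (intro sum_nonneg) auto

lemma disagreement_integrable:
  "integrable P (\<lambda>\<omega>. \<Sum>i\<in>UNIV. pmf I i * (norm (column i (X k \<omega>) - xbar k \<omega>))\<^sup>2)"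
  "(\<integral>\<omega>. (\<Sum>i\<in>UNIV. pmf I i * (norm (column i (X k \<omega>) - xbar k \<omega>))\<^sup>2) \<partial>P) = disagreement k"
proof -
  have *: "integrable P (\<lambda>\<omega>. pmf I i * (norm (column i (X k \<omega>) - xbar k \<omega>))\<^sup>2)" for i
    by (intro integrable_mult_right square_integrableD square_integrable_diff square_integrable_column_X square_integrable_xbar)
  show "integrable P (\<lambda>\<omega>. \<Sum>i\<in>UNIV. pmf I i * (norm (column i (X k \<omega>) - xbar k \<omega>))\<^sup>2)"
    by (intro Bochner_Integration.integrable_sum *)
  show "(\<integral>\<omega>. (\<Sum>i\<in>UNIV. pmf I i * (norm (column i (X k \<omega>) - xbar k \<omega>))\<^sup>2) \<partial>P) = disagreement k"
    unfolding disagreement_def by (subst Bochner_Integration.integral_sum) (use * in auto)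
qed

lemma square_integrable_mean_gradient: "square_integrable (\<lambda>\<omega>. mean_gradient (X k \<omega>))"
  unfolding mean_gradient_def
  by (intro square_integrable_sum square_integrable_scaleR square_integrable_lipschitz[OF square_integrable_column_X G_lipschitz])

lemma g_second_moment_bound:
  "(\<integral>\<omega>. (norm (g k \<omega>))\<^sup>2 \<partial>P) \<le> (M * \<sigma>\<^sup>2 + 2 * M\<^sup>2 * \<zeta>\<^sup>2)
    + M\<^sup>2 * ((\<integral>\<omega>. (norm (mean_gradient (X (k - \<tau> k) \<omega>)))\<^sup>2 \<partial>P) + 2 * L\<^sup>2 * disagreement (k - \<tau> k))"
proof -
  let ?m = "k - \<tau> k"
  note di = disagreement_integrable[of ?m] and mi = square_integrableD(2)[OF square_integrable_mean_gradient[of ?m]]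
  have "(\<integral>\<omega>. (\<Sum>i\<in>UNIV. pmf I i * (norm (G i (column i (X ?m \<omega>))))\<^sup>2) \<partial>P)
    \<le> (\<integral>\<omega>. (norm (mean_gradient (X ?m \<omega>)))\<^sup>2
        + 2 * L\<^sup>2 * (\<Sum>i\<in>UNIV. pmf I i * (norm (column i (X ?m \<omega>) - xbar ?m \<omega>))\<^sup>2) + 2 * \<zeta>\<^sup>2 \<partial>P)"
  proof (rule integral_mono)
    show "integrable P (\<lambda>\<omega>. \<Sum>i\<in>UNIV. pmf I i * (norm (G i (column i (X ?m \<omega>))))\<^sup>2)"
      by (intro Bochner_Integration.integrable_sum integrable_mult_right square_integrableD
        square_integrable_lipschitz[OF square_integrable_column_X G_lipschitz])
    show "integrable P (\<lambda>\<omega>. (norm (mean_gradient (X ?m \<omega>)))\<^sup>2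
        + 2 * L\<^sup>2 * (\<Sum>i\<in>UNIV. pmf I i * (norm (column i (X ?m \<omega>) - xbar ?m \<omega>))\<^sup>2) + 2 * \<zeta>\<^sup>2)"
      by (intro Bochner_Integration.integrable_add integrable_mult_right di(1) mi) simp
  qed (rule weighted_local_gradient_bound)
  also have "\<dots> = (\<integral>\<omega>. (norm (mean_gradient (X ?m \<omega>)))\<^sup>2 \<partial>P) + 2 * L\<^sup>2 * disagreement ?m + 2 * \<zeta>\<^sup>2"
    using di mi by (simp add: prob_space)
  finally have "M\<^sup>2 * (\<integral>\<omega>. (\<Sum>i\<in>UNIV. pmf I i * (norm (G i (column i (X ?m \<omega>))))\<^sup>2) \<partial>P)
    \<le> M\<^sup>2 * ((\<integral>\<omega>. (norm (mean_gradient (X ?m \<omega>)))\<^sup>2 \<partial>P) + 2 * L\<^sup>2 * disagreement ?m + 2 * \<zeta>\<^sup>2)"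
    by (intro mult_left_mono) auto
  then show ?thesis using g_moments(2)[OF square_integrable_column_X, of k] by (simp add: distrib_left)
qed

section \<open>The averaged model\<close>

lemma single_column_mult_vector:
  "(\<chi> r c. if c = i then v $ r else 0 :: real^'n^'d) *v w = (w $ i) *\<^sub>R v"
  by (simp add: vec_eq_iff matrix_vector_mult_def if_distrib if_distribR cong: if_cong)

lemma xbar_Suc: "AE \<omega> in P. xbar (Suc k) \<omega> = xbar k \<omega> - (\<gamma> / n) *\<^sub>R g k \<omega>"
  using W_doubly_stochastic[of k] AE_space
proof eventually_elim
  case (elim \<omega>)
  have "X (Suc k) \<omega> *v 1 = X k \<omega> *v (W k \<omega> *v 1) - \<gamma> *\<^sub>R g k \<omega>"
    unfolding X_Suc[OF elim(2)] matrix_vector_mult_diff_rdistrib scaleR_matrix_vector_assoc[symmetric] single_column_mult_vector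
    by (simp add: matrix_vector_mul_assoc)
  then show ?case
    using doubly_stochastic_mult_1(1)[OF elim(1)] by (simp add: xbar_def scaleR_diff_right)
qed

lemma xbar_diff: "AE \<omega> in P. xbar k \<omega> - xbar (k - m) \<omega> = - (\<gamma> / n) *\<^sub>R (\<Sum>j=k - m..<k. g j \<omega>)"
proof -
  have "AE \<omega> in P. \<forall>k. xbar (Suc k) \<omega> = xbar k \<omega> - (\<gamma> / n) *\<^sub>R g k \<omega>"
    unfolding AE_all_countable using xbar_Suc by blast
  then show ?thesis
  proof eventually_elim
    case (elim \<omega>)
    have "(\<Sum>j=k - m..<k. xbar (Suc j) \<omega> - xbar j \<omega>) = xbar k \<omega> - xbar (k - m) \<omega>"
      by (rule sum_Suc_diff') simp
    moreover have "xbar (Suc j) \<omega> - xbar j \<omega> = - (\<gamma> / n) *\<^sub>R g j \<omega>" for j using elim by simp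
    ultimately show ?case by (simp only: scaleR_sum_right)
  qed
qed

lemma staleness_bound:
  "(\<integral>\<omega>. (norm (xbar k \<omega> - xbar (k - m) \<omega>))\<^sup>2 \<partial>P)
    \<le> \<gamma>\<^sup>2 / n\<^sup>2 * (m * (\<Sum>j=k - m..<k. \<integral>\<omega>. (norm (g j \<omega>))\<^sup>2 \<partial>P))"
proof -
  have gi: "integrable P (\<lambda>\<omega>. (norm (g j \<omega>))\<^sup>2)" for j
    by (rule square_integrableD[OF square_integrable_g])
  have "(\<integral>\<omega>. (norm (xbar k \<omega> - xbar (k - m) \<omega>))\<^sup>2 \<partial>P)
      \<le> (\<integral>\<omega>. \<gamma>\<^sup>2 / n\<^sup>2 * (m * (\<Sum>j=k - m..<k. (norm (g j \<omega>))\<^sup>2)) \<partial>P)"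
  proof (rule integral_mono_AE)
    show "AE \<omega> in P. (norm (xbar k \<omega> - xbar (k - m) \<omega>))\<^sup>2 \<le> \<gamma>\<^sup>2 / n\<^sup>2 * (m * (\<Sum>j=k - m..<k. (norm (g j \<omega>))\<^sup>2))"
      using xbar_diff[of k m]
    proof eventually_elim
      case (elim \<omega>)
      have "(norm (xbar k \<omega> - xbar (k - m) \<omega>))\<^sup>2 = \<gamma>\<^sup>2 / n\<^sup>2 * (norm (\<Sum>j=k - m..<k. g j \<omega>))\<^sup>2"
        unfolding elim by (simp add: power_mult_distrib power_divide)
      also have "\<dots> \<le> \<gamma>\<^sup>2 / n\<^sup>2 * ((\<Sum>j=k - m..<k. 1) * (\<Sum>j=k - m..<k. (norm (g j \<omega>))\<^sup>2 / 1))"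
        by (intro mult_left_mono norm_sum_power2_le_weighted) auto
      also have "\<dots> \<le> \<gamma>\<^sup>2 / n\<^sup>2 * (m * (\<Sum>j=k - m..<k. (norm (g j \<omega>))\<^sup>2))"
        by (intro mult_left_mono mult_mono) (auto intro: sum_nonneg)
      finally show ?case .
    qed
  qed (intro square_integrableD square_integrable_diff square_integrable_xbar integrable_mult_right
    Bochner_Integration.integrable_sum gi)+
  also have "\<dots> = \<gamma>\<^sup>2 / n\<^sup>2 * (m * (\<Sum>j=k - m..<k. \<integral>\<omega>. (norm (g j \<omega>))\<^sup>2 \<partial>P))"
    using gi by simp
  finally show ?thesis .
qed

text \<open>
  Against anything that is known before step k, the update acts like M times the mean gradient.
\<close>
lemma inner_g_expectation:
  assumes v: "v \<in> borel_measurable (sig (past k))" and sq: "square_integrable v"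
  shows "(\<integral>\<omega>. v \<omega> \<bullet> g k \<omega> \<partial>P) = M * (\<integral>\<omega>. v \<omega> \<bullet> mean_gradient (X (k - \<tau> k) \<omega>) \<partial>P)"
proof -
  let ?Y = "X (k - \<tau> k)"
  define h where "h = (\<lambda>(x, y). v x \<bullet> batch_gradient (ik k y) (?Y x) (\<lambda>j. \<xi> k (ik k y) j y))"
  have [measurable]: "(\<lambda>z. batch_gradient (ik k (snd z)) (?Y (fst z)) (\<lambda>j. \<xi> k (ik k (snd z)) j (snd z)))
      \<in> borel_measurable (sig (past k) \<Otimes>\<^sub>M sig {Inl k, Inr k})"
    by (rule batch_gradient_measurable[where b = "\<lambda>i j z. \<xi> k i j (snd z)"])
      (auto intro: measurable_compose[OF measurable_snd ik_W_measurable_sig(1)] measurable_compose[OF measurable_snd \<xi>_measurable_sig]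
        measurable_compose[OF measurable_fst X_measurable_past'])
  have h: "h \<in> borel_measurable (sig (past k) \<Otimes>\<^sub>M sig {Inl k, Inr k})"
    unfolding h_def case_prod_beta using v by measurable
  have "(\<integral>\<omega>. v \<omega> \<bullet> g k \<omega> \<partial>P) = (\<integral>x. h (x, x) \<partial>P)"
    by (simp add: h_def g_def)
  also have "\<dots> = (\<integral>x. \<integral>y. h (x, y) \<partial>P \<partial>P)"
    using integrable_inner_square_integrable[OF sq square_integrable_g[of k]]
    by (intro integral_freeze_sig[OF _ h]) (auto simp: past_def h_def g_def)
  also have "\<dots> = (\<integral>x. M * (v x \<bullet> mean_gradient (?Y x)) \<partial>P)"
    unfolding h_def prod.case step_mean ..
  finally show ?thesis by simp
qed

text \<open>
  The quadratic upper bound of f along the step of the averaged model. The inner product of the true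
  gradient a and the mean gradient m is written as half of (norm a)^2 + (norm m)^2 - (norm (a - m))^2,
  where the last term is bounded by staleness and disagreement.
\<close>
lemma descent:
  "integrable P (\<lambda>\<omega>. f (xbar k \<omega>))"
  "(\<integral>\<omega>. f (xbar (Suc k) \<omega>) \<partial>P) \<le> (\<integral>\<omega>. f (xbar k \<omega>) \<partial>P)
    - \<gamma> * M / (2 * n) * ((\<integral>\<omega>. (norm (gf (xbar k \<omega>)))\<^sup>2 \<partial>P) + (\<integral>\<omega>. (norm (mean_gradient (X (k - \<tau> k) \<omega>)))\<^sup>2 \<partial>P))
    + \<gamma> * M * L\<^sup>2 / n * ((\<integral>\<omega>. (norm (xbar k \<omega> - xbar (k - \<tau> k) \<omega>))\<^sup>2 \<partial>P) + disagreement (k - \<tau> k))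
    + L * \<gamma>\<^sup>2 / (2 * n\<^sup>2) * (\<integral>\<omega>. (norm (g k \<omega>))\<^sup>2 \<partial>P)"
proof -
  have n0: "0 < n" by (simp add: n)
  have f_gf: "GDERIV f x :> gf x" for x using f_GDERIV by (simp add: gf_def)
  have "continuous_on UNIV f"
    using f_gf by (intro differentiable_imp_continuous_on) (auto simp: differentiable_on_def differentiable_def gderiv_def)
  then have [measurable]: "f \<in> borel_measurable borel" by (rule borel_measurable_continuous_onI)
  have [measurable]: "xbar k \<in> borel_measurable P" for k by (rule square_integrableD[OF square_integrable_xbar])
  show fi: "integrable P (\<lambda>\<omega>. f (xbar k \<omega>))" for k
  proof (rule Bochner_Integration.integrable_bound)
    show "integrable P (\<lambda>\<omega>. \<bar>fstar\<bar> + \<bar>f 0\<bar> + \<bar>gf 0 \<bullet> xbar k \<omega>\<bar> + L / 2 * (norm (xbar k \<omega>))\<^sup>2)"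
      using integrable_inner_square_integrable[OF square_integrable_const square_integrable_xbar]
      by (intro Bochner_Integration.integrable_add integrable_mult_right integrable_abs square_integrableD(2)[OF square_integrable_xbar]) auto
    show "AE \<omega> in P. norm (f (xbar k \<omega>)) \<le> norm (\<bar>fstar\<bar> + \<bar>f 0\<bar> + \<bar>gf 0 \<bullet> xbar k \<omega>\<bar> + L / 2 * (norm (xbar k \<omega>))\<^sup>2)"
    proof (rule AE_I2)
      fix \<omega>
      have "f (xbar k \<omega>) \<le> f 0 + gf 0 \<bullet> xbar k \<omega> + L / 2 * (norm (xbar k \<omega>))\<^sup>2"
        using lipschitz_gradient_upper_bound[OF f_gf gf_lipschitz, of 0 "xbar k \<omega>"] by simp
      moreover have "0 \<le> L / 2 * (norm (xbar k \<omega>))\<^sup>2" using L by simp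
      ultimately show "norm (f (xbar k \<omega>)) \<le> norm (\<bar>fstar\<bar> + \<bar>f 0\<bar> + \<bar>gf 0 \<bullet> xbar k \<omega>\<bar> + L / 2 * (norm (xbar k \<omega>))\<^sup>2)"
        using f_lower[of "xbar k \<omega>"] by simp
    qed
  qed measurable
  define a where "a \<omega> = gf (xbar k \<omega>)" for \<omega>
  define m where "m \<omega> = mean_gradient (X (k - \<tau> k) \<omega>)" for \<omega>
  have a: "square_integrable a" "a \<in> borel_measurable (sig (past k))"
    unfolding a_def[abs_def] using square_integrable_lipschitz[OF square_integrable_xbar gf_lipschitz] xbar_measurable_past by measurable
  have m: "square_integrable m" unfolding m_def by (rule square_integrable_mean_gradient)
  note g = square_integrable_g[of k]
  have ag: "integrable P (\<lambda>\<omega>. a \<omega> \<bullet> g k \<omega>)" by (rule integrable_inner_square_integrable[OF a(1) g])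
  have "(\<integral>\<omega>. f (xbar (Suc k) \<omega>) \<partial>P) \<le> (\<integral>\<omega>. f (xbar k \<omega>) - \<gamma> / n * (a \<omega> \<bullet> g k \<omega>) + L * \<gamma>\<^sup>2 / (2 * n\<^sup>2) * (norm (g k \<omega>))\<^sup>2 \<partial>P)"
  proof (rule integral_mono_AE)
    show "integrable P (\<lambda>\<omega>. f (xbar k \<omega>) - \<gamma> / n * (a \<omega> \<bullet> g k \<omega>) + L * \<gamma>\<^sup>2 / (2 * n\<^sup>2) * (norm (g k \<omega>))\<^sup>2)"
      using fi ag square_integrableD(2)[OF g] by auto
    show "AE \<omega> in P. f (xbar (Suc k) \<omega>) \<le> f (xbar k \<omega>) - \<gamma> / n * (a \<omega> \<bullet> g k \<omega>) + L * \<gamma>\<^sup>2 / (2 * n\<^sup>2) * (norm (g k \<omega>))\<^sup>2"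
      using xbar_Suc[of k]
    proof eventually_elim
      case (elim \<omega>)
      show ?case
        using lipschitz_gradient_upper_bound[OF f_gf gf_lipschitz, of "xbar k \<omega>" "- (\<gamma> / n) *\<^sub>R g k \<omega>"] elim
        by (simp add: a_def power_mult_distrib power_divide)
    qed
  qed (rule fi)
  also have "\<dots> = (\<integral>\<omega>. f (xbar k \<omega>) \<partial>P) - \<gamma> / n * (M * (\<integral>\<omega>. a \<omega> \<bullet> m \<omega> \<partial>P)) + L * \<gamma>\<^sup>2 / (2 * n\<^sup>2) * (\<integral>\<omega>. (norm (g k \<omega>))\<^sup>2 \<partial>P)"
    using fi ag square_integrableD(2)[OF g] inner_g_expectation[OF a(2,1)] by (simp add: m_def)
  finally have 1: "(\<integral>\<omega>. f (xbar (Suc k) \<omega>) \<partial>P) \<le> \<dots>" .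
  define Z where "Z = (\<integral>\<omega>. (norm (xbar k \<omega> - xbar (k - \<tau> k) \<omega>))\<^sup>2 \<partial>P)"
  note ai = square_integrableD(2)[OF a(1)] and mi = square_integrableD(2)[OF m]
    and di = disagreement_integrable[of "k - \<tau> k"]
    and zi = square_integrableD(2)[OF square_integrable_diff[OF square_integrable_xbar[of k] square_integrable_xbar[of "k - \<tau> k"]]]
  have "(\<integral>\<omega>. (norm (a \<omega>))\<^sup>2 \<partial>P) + (\<integral>\<omega>. (norm (m \<omega>))\<^sup>2 \<partial>P) - 2 * (\<integral>\<omega>. a \<omega> \<bullet> m \<omega> \<partial>P)
      = (\<integral>\<omega>. (norm (a \<omega>))\<^sup>2 + (norm (m \<omega>))\<^sup>2 - 2 * (a \<omega> \<bullet> m \<omega>) \<partial>P)"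
    using ai mi integrable_inner_square_integrable[OF a(1) m] by simp
  also have "\<dots> \<le> (\<integral>\<omega>. 2 * L\<^sup>2 * ((norm (xbar k \<omega> - xbar (k - \<tau> k) \<omega>))\<^sup>2
      + (\<Sum>i\<in>UNIV. pmf I i * (norm (column i (X (k - \<tau> k) \<omega>) - xbar (k - \<tau> k) \<omega>))\<^sup>2)) \<partial>P)"
  proof (rule integral_mono)
    fix \<omega>
    have "(norm (a \<omega>))\<^sup>2 + (norm (m \<omega>))\<^sup>2 - 2 * (a \<omega> \<bullet> m \<omega>) = (norm (a \<omega> - m \<omega>))\<^sup>2"
      by (simp add: power2_norm_eq_inner inner_diff_left inner_diff_right inner_commute)
    also have "\<dots> \<le> 2 * L\<^sup>2 * ((norm (xbar k \<omega> - xbar (k - \<tau> k) \<omega>))\<^sup>2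
      + (\<Sum>i\<in>UNIV. pmf I i * (norm (column i (X (k - \<tau> k) \<omega>) - xbar (k - \<tau> k) \<omega>))\<^sup>2))"
      unfolding a_def m_def by (rule gf_minus_mean_gradient_bound)
    finally show "(norm (a \<omega>))\<^sup>2 + (norm (m \<omega>))\<^sup>2 - 2 * (a \<omega> \<bullet> m \<omega>) \<le> \<dots>" .
  next
    show "integrable P (\<lambda>\<omega>. (norm (a \<omega>))\<^sup>2 + (norm (m \<omega>))\<^sup>2 - 2 * (a \<omega> \<bullet> m \<omega>))"
      using ai mi integrable_inner_square_integrable[OF a(1) m] by auto
    show "integrable P (\<lambda>\<omega>. 2 * L\<^sup>2 * ((norm (xbar k \<omega> - xbar (k - \<tau> k) \<omega>))\<^sup>2
      + (\<Sum>i\<in>UNIV. pmf I i * (norm (column i (X (k - \<tau> k) \<omega>) - xbar (k - \<tau> k) \<omega>))\<^sup>2)))"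
      using zi di(1) by (intro integrable_mult_right Bochner_Integration.integrable_add)
  qed
  also have "\<dots> = 2 * L\<^sup>2 * (Z + disagreement (k - \<tau> k))"
    using zi di by (simp add: Z_def)
  finally have "(\<integral>\<omega>. (norm (a \<omega>))\<^sup>2 \<partial>P) + (\<integral>\<omega>. (norm (m \<omega>))\<^sup>2 \<partial>P)
      - 2 * L\<^sup>2 * (Z + disagreement (k - \<tau> k)) \<le> 2 * (\<integral>\<omega>. a \<omega> \<bullet> m \<omega> \<partial>P)" by simp
  then have "\<gamma> * M / (2 * n) * ((\<integral>\<omega>. (norm (a \<omega>))\<^sup>2 \<partial>P) + (\<integral>\<omega>. (norm (m \<omega>))\<^sup>2 \<partial>P)
      - 2 * L\<^sup>2 * (Z + disagreement (k - \<tau> k))) \<le> \<gamma> * M / (2 * n) * (2 * (\<integral>\<omega>. a \<omega> \<bullet> m \<omega> \<partial>P))"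
    using \<gamma> n0 by (intro mult_left_mono) auto
  with 1 show "(\<integral>\<omega>. f (xbar (Suc k) \<omega>) \<partial>P) \<le> (\<integral>\<omega>. f (xbar k \<omega>) \<partial>P)
    - \<gamma> * M / (2 * n) * ((\<integral>\<omega>. (norm (gf (xbar k \<omega>)))\<^sup>2 \<partial>P) + (\<integral>\<omega>. (norm (mean_gradient (X (k - \<tau> k) \<omega>)))\<^sup>2 \<partial>P))
    + \<gamma> * M * L\<^sup>2 / n * ((\<integral>\<omega>. (norm (xbar k \<omega> - xbar (k - \<tau> k) \<omega>))\<^sup>2 \<partial>P) + disagreement (k - \<tau> k))
    + L * \<gamma>\<^sup>2 / (2 * n\<^sup>2) * (\<integral>\<omega>. (norm (g k \<omega>))\<^sup>2 \<partial>P)"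
    unfolding a_def[symmetric] m_def[symmetric] Z_def[symmetric] by (simp add: algebra_simps add_divide_distrib)
qed

section \<open>Disagreement between the workers\<close>

lemma integrable_gram: "integrable P (\<lambda>\<omega>. transpose (W k \<omega>) ** W k \<omega>)"
proof (rule integrable_const_bound)
  have "(\<lambda>\<omega>. transpose (W k \<omega>)) \<in> borel_measurable P"
    by (rule measurable_compose[OF W_rv borel_measurable_continuous_onI])
      (intro linear_continuous_on bounded_linear_transpose)
  then show "(\<lambda>\<omega>. transpose (W k \<omega>) ** W k \<omega>) \<in> borel_measurable P" by measurable
  show "AE \<omega> in P. norm (transpose (W k \<omega>) ** W k \<omega>) \<le> (\<Sum>i\<in>(UNIV :: 'n set). \<Sum>j\<in>(UNIV :: 'n set). 1)"
    using W_doubly_stochastic[of k]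
  proof eventually_elim
    case (elim \<omega>)
    have "\<bar>(transpose (W k \<omega>) ** W k \<omega>) $ i $ j\<bar> \<le> 1" for i j
    proof -
      have "(transpose (W k \<omega>) ** W k \<omega>) $ i $ j = (\<Sum>l\<in>UNIV. W k \<omega> $ l $ i * W k \<omega> $ l $ j)"
        by (simp add: matrix_matrix_mult_def transpose_def)
      moreover have "(\<Sum>l\<in>UNIV. W k \<omega> $ l $ i * W k \<omega> $ l $ j) \<le> (\<Sum>l\<in>UNIV. W k \<omega> $ l $ i)"
        using elim doubly_stochastic_le_1[OF elim]
        by (intro sum_mono mult_right_le_one_le) (auto simp: doubly_stochastic_def)
      moreover have "0 \<le> (\<Sum>l\<in>UNIV. W k \<omega> $ l $ i * W k \<omega> $ l $ j)"
        using elim by (intro sum_nonneg mult_nonneg_nonneg) (auto simp: doubly_stochastic_def)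
      ultimately show ?thesis using elim by (simp add: doubly_stochastic_def)
    qed
    then show ?case by (intro order_trans[OF norm_matrix_le_sum_entries] sum_mono)
  qed
qed

text \<open>
  The second moment of W y is the quadratic form of E(W^T W) at y, a symmetric matrix that fixes 1.
\<close>
lemma W_contracts_centered:
  assumes "y \<bullet> 1 = 0"
  shows "(\<integral>\<^sup>+\<omega>. ennreal ((norm (W k \<omega> *v y))\<^sup>2) \<partial>P) \<le> ennreal (\<rho> * (norm y)\<^sup>2)"
proof -
  let ?B = "\<lambda>\<omega>. transpose (W k \<omega>) ** W k \<omega>"
  define A where "A = (\<integral>\<omega>. ?B \<omega> \<partial>P)"
  have Ay: "integrable P (\<lambda>\<omega>. ?B \<omega> *v z)" "(\<integral>\<omega>. ?B \<omega> *v z \<partial>P) = A *v z" for z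
    using integrable_bounded_linear[OF bounded_linear_matrix_vector_mult_left integrable_gram]
      integral_bounded_linear[OF bounded_linear_matrix_vector_mult_left integrable_gram]
    by (simp_all add: A_def)
  have "transpose A = (\<integral>\<omega>. transpose (?B \<omega>) \<partial>P)"
    unfolding A_def by (rule integral_bounded_linear[OF bounded_linear_transpose integrable_gram, symmetric])
  then have sym: "transpose A = A" by (simp add: A_def matrix_transpose_mul)
  have "AE \<omega> in P. ?B \<omega> *v 1 = 1"
    using W_doubly_stochastic[of k]
    by eventually_elim (simp only: matrix_vector_mul_assoc[symmetric] doubly_stochastic_mult_1)
  then have "(\<integral>\<omega>. ?B \<omega> *v 1 \<partial>P) = (\<integral>\<omega>. 1 \<partial>P)"
    using Ay(1)[of 1] by (intro integral_cong_AE) auto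
  then have A1: "A *v 1 = 1" using Ay(2)[of 1] by (simp add: prob_space)
  have "(\<integral>\<^sup>+\<omega>. ennreal ((norm (W k \<omega> *v y))\<^sup>2) \<partial>P) = (\<integral>\<^sup>+\<omega>. ennreal (y \<bullet> (?B \<omega> *v y)) \<partial>P)"
    by (simp add: norm_matrix_vector_mult_power2)
  also have "\<dots> = ennreal (\<integral>\<omega>. y \<bullet> (?B \<omega> *v y) \<partial>P)"
  proof (rule nn_integral_eq_integral)
    show "integrable P (\<lambda>\<omega>. y \<bullet> (?B \<omega> *v y))" using Ay(1)[of y] by (rule integrable_inner_right)
    show "AE \<omega> in P. 0 \<le> y \<bullet> (?B \<omega> *v y)" by (simp add: norm_matrix_vector_mult_power2[symmetric])
  qed
  also have "(\<integral>\<omega>. y \<bullet> (?B \<omega> *v y) \<partial>P) = y \<bullet> (A *v y)"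
    using Ay[of y] by simp
  also have "\<dots> \<le> \<rho> * (norm y)\<^sup>2"
    using W_spectral[of k] \<rho> assms by (intro quadratic_form_le_second_eigenvalue sym A1) (auto simp: A_def)
  finally show ?thesis by (simp add: ennreal_leI)
qed

text \<open>
  The vector W (k - m) ... W (k - 1) (e_i - 1/n), which carries an update made m steps before the last
  one to the difference between column i of X k and the average.
\<close>
primrec deviation :: "'n \<Rightarrow> nat \<Rightarrow> nat \<Rightarrow> 'w \<Rightarrow> real^'n" where
  "deviation i k 0 \<omega> = axis i 1 - (1 / n) *\<^sub>R 1"
| "deviation i k (Suc m) \<omega> = W (k - Suc m) \<omega> *v deviation i k m \<omega>"

lemma deviation_measurable:
  "m \<le> k \<Longrightarrow> deviation i k m \<in> borel_measurable (sig (Inl ` {k - m..<k}))"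
proof (induction m)
  case 0
  have "deviation i k 0 = (\<lambda>_. axis i 1 - (1 / n) *\<^sub>R 1)" by (rule ext) simp
  then show ?case by simp
next
  case (Suc m)
  have "deviation i k m \<in> borel_measurable (sig (Inl ` {k - Suc m..<k}))"
    using Suc by (intro measurable_sig_mono[OF Suc.IH]) auto
  moreover have "W (k - Suc m) \<in> borel_measurable (sig (Inl ` {k - Suc m..<k}))"
    using Suc.prems by (intro ik_W_measurable_sig) auto
  ultimately show ?case by (simp add: deviation.simps(2)[abs_def] borel_measurable_matrix_vector_mult)
qed

lemma n_pos: "0 < n"
  by (simp add: n)

lemma inner_axis_1: "axis i 1 \<bullet> (1 :: real^'n) = 1"
  by (simp add: inner_axis inner_commute)

lemma inner_1_1: "(1 :: real^'n) \<bullet> 1 = n"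
  by (simp add: inner_vec_def n)

lemma deviation_inner_1: "AE \<omega> in P. deviation i k m \<omega> \<bullet> 1 = 0"
proof (induction m)
  case 0
  show ?case using n_pos by (simp add: inner_diff_left inner_axis_1 inner_1_1)
next
  case (Suc m)
  then show ?case
    using W_doubly_stochastic[of "k - Suc m"] by eventually_elim (simp add: doubly_stochastic_inner_1)
qed

text \<open>
  Each new factor is an earlier averaging matrix, independent of the factors already present, so that
  the contraction applies to a frozen vector of zero sum.
\<close>
lemma deviation_second_moment:
  "m \<le> k \<Longrightarrow> (\<integral>\<^sup>+\<omega>. ennreal ((norm (deviation i k m \<omega>))\<^sup>2) \<partial>P) \<le> ennreal (\<rho> ^ m * ((n - 1) / n))"
proof (induction m)
  case 0
  have "(norm (axis i 1 - (1 / n) *\<^sub>R 1 :: real^'n))\<^sup>2 = (n - 1) / n"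
    using n_pos unfolding power2_norm_eq_inner
    by (simp add: inner_diff_left inner_diff_right inner_axis_1 inner_1_1 inner_commute[of 1 "axis i 1"]
      inner_axis_axis field_simps)
  then show ?case by (simp add: emeasure_space_1)
next
  case (Suc m)
  define h where "h = (\<lambda>(x, y). ennreal ((norm (W (k - Suc m) y *v deviation i k m x))\<^sup>2))"
  let ?A = "Inl ` {k - m..<k}" and ?B = "{Inl (k - Suc m)}"
  have [measurable]: "deviation i k m \<in> borel_measurable (sig ?A)"
    using Suc.prems by (intro deviation_measurable) simp
  have [measurable]: "W (k - Suc m) \<in> borel_measurable (sig ?B)"
    by (intro ik_W_measurable_sig) simp
  have h: "h \<in> borel_measurable (sig ?A \<Otimes>\<^sub>M sig ?B)" unfolding h_def case_prod_beta by measurable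
  have "(\<integral>\<^sup>+\<omega>. ennreal ((norm (deviation i k (Suc m) \<omega>))\<^sup>2) \<partial>P) = (\<integral>\<^sup>+x. h (x, x) \<partial>P)"
    by (simp add: h_def)
  also have "\<dots> = (\<integral>\<^sup>+x. \<integral>\<^sup>+y. h (x, y) \<partial>P \<partial>P)"
    using Suc.prems by (intro nn_integral_freeze_sig[OF _ h]) auto
  also have "\<dots> \<le> (\<integral>\<^sup>+x. ennreal \<rho> * ennreal ((norm (deviation i k m x))\<^sup>2) \<partial>P)"
  proof (rule nn_integral_mono_AE)
    show "AE x in P. (\<integral>\<^sup>+y. h (x, y) \<partial>P) \<le> ennreal \<rho> * ennreal ((norm (deviation i k m x))\<^sup>2)"
      using deviation_inner_1[of i k m]
    proof eventually_elim
      case (elim x)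
      show ?case using W_contracts_centered[OF elim] \<rho> by (simp add: h_def ennreal_mult)
    qed
  qed
  also have "\<dots> = ennreal \<rho> * (\<integral>\<^sup>+x. ennreal ((norm (deviation i k m x))\<^sup>2) \<partial>P)"
  proof -
    have [measurable]: "deviation i k m \<in> borel_measurable P"
      using Suc.prems by (intro measurable_sig[OF deviation_measurable]) simp
    show ?thesis by (intro nn_integral_cmult) measurable
  qed
  also have "\<dots> \<le> ennreal \<rho> * ennreal (\<rho> ^ m * ((n - 1) / n))"
    using Suc by (intro mult_left_mono) auto
  also have "\<dots> = ennreal (\<rho> ^ Suc m * ((n - 1) / n))"
    unfolding power_Suc mult.assoc ennreal_mult'[OF \<rho>(1)] ..
  finally show ?case .
qed

lemma X_unroll:
  assumes "\<omega> \<in> space P"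
  shows "m \<le> k \<Longrightarrow> X k \<omega> *v deviation i k 0 \<omega> = X (k - m) \<omega> *v deviation i k m \<omega>
    - \<gamma> *\<^sub>R (\<Sum>j=k - m..<k. (deviation i k (k - 1 - j) \<omega> $ ik j \<omega>) *\<^sub>R g j \<omega>)"
proof (induction m)
  case (Suc m)
  define l where "l = k - Suc m"
  have l: "k - m = Suc l" "k - 1 - l = m" "l < k" using Suc.prems by (auto simp: l_def)
  have "X (Suc l) \<omega> *v deviation i k m \<omega>
      = X l \<omega> *v deviation i k (Suc m) \<omega> - \<gamma> *\<^sub>R ((deviation i k m \<omega> $ ik l \<omega>) *\<^sub>R g l \<omega>)"
    unfolding X_Suc[OF assms] matrix_vector_mult_diff_rdistrib scaleR_matrix_vector_assoc[symmetric] single_column_mult_vector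
    by (simp add: matrix_vector_mul_assoc l_def)
  moreover have "(\<Sum>j=l..<k. (deviation i k (k - 1 - j) \<omega> $ ik j \<omega>) *\<^sub>R g j \<omega>)
      = (deviation i k m \<omega> $ ik l \<omega>) *\<^sub>R g l \<omega> + (\<Sum>j=Suc l..<k. (deviation i k (k - 1 - j) \<omega> $ ik j \<omega>) *\<^sub>R g j \<omega>)"
    using l by (subst sum.atLeast_Suc_lessThan) auto
  ultimately show ?case
    using Suc l by (simp add: l_def[symmetric] scaleR_add_right del: deviation.simps)
qed simp

lemma column_minus_xbar: "column i (X k \<omega>) - xbar k \<omega> = X k \<omega> *v deviation i k 0 \<omega>"
proof -
  have "X k \<omega> *v axis i 1 = column i (X k \<omega>)" by (rule matrix_vector_mult_basis)
  then show ?thesis by (simp add: xbar_def matrix_vector_mult_diff_distrib matrix_vector_mult_scaleR)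
qed

lemma column_minus_xbar_eq_sum:
  "AE \<omega> in P. column i (X k \<omega>) - xbar k \<omega> = - \<gamma> *\<^sub>R (\<Sum>j<k. (deviation i k (k - 1 - j) \<omega> $ ik j \<omega>) *\<^sub>R g j \<omega>)"
  using deviation_inner_1[of i k k] AE_space
proof eventually_elim
  case (elim \<omega>)
  have "(X 0 \<omega> *v v) = (v \<bullet> 1) *\<^sub>R x0" for v
  proof -
    have "X 0 \<omega> $ r $ c = x0 $ r" for r c
      using X_init[OF elim(2), of c] by (auto simp: vec_eq_iff column_def)
    then show ?thesis
      by (simp add: vec_eq_iff matrix_vector_mult_def inner_vec_def sum_distrib_left[symmetric] mult.commute)
  qed
  then show ?case
    using X_unroll[OF elim(2), of k k i] elim(1)
    by (simp add: column_minus_xbar atLeast0LessThan del: deviation.simps)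
qed

text \<open>
  The matrix W j may depend on the worker of step j, but only W (j+1), ..., W (k-1) occur in the
  deviation, so the two factors are independent once the entry of the deviation is bounded by the
  norm of the vector, which does not involve the worker.
\<close>
lemma propagated_update_second_moment:
  fixes i :: 'n
  assumes j: "j < k"
  defines "Y \<equiv> \<lambda>\<omega>. (deviation i k (k - 1 - j) \<omega> $ ik j \<omega>) *\<^sub>R g j \<omega>"
  shows "square_integrable Y"
    "(\<integral>\<omega>. (norm (Y \<omega>))\<^sup>2 \<partial>P) \<le> \<rho> ^ (k - 1 - j) * ((n - 1) / n) * (\<integral>\<omega>. (norm (g j \<omega>))\<^sup>2 \<partial>P)"
proof -
  let ?m = "k - 1 - j"
  let ?u = "\<integral>\<omega>. (norm (g j \<omega>))\<^sup>2 \<partial>P"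
  let ?A = "Inl ` {k - ?m..<k}" and ?B = "past (Suc j)"
  have dA [measurable]: "deviation i k ?m \<in> borel_measurable (sig ?A)"
    by (intro deviation_measurable) simp
  have dP: "deviation i k ?m \<in> borel_measurable P" by (rule measurable_sig[OF dA])
  have [measurable]: "g j \<in> borel_measurable (sig ?B)" by (rule g_measurable_past)
  have Ym: "Y \<in> borel_measurable P"
    unfolding Y_def
  proof (intro borel_measurable_scaleR g_measurable
      measurable_compose_countable[OF _ ik_rv[of j], where f = "\<lambda>c \<omega>. deviation i k ?m \<omega> $ c"])
    show "(\<lambda>\<omega>. deviation i k ?m \<omega> $ c) \<in> borel_measurable P" for c
      by (rule measurable_compose[OF dP borel_measurable_continuous_onI]) (intro continuous_intros)
  qed
  define h where "h = (\<lambda>(x, y). ennreal ((norm (deviation i k ?m x))\<^sup>2) * ennreal ((norm (g j y))\<^sup>2))"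
  have h: "h \<in> borel_measurable (sig ?A \<Otimes>\<^sub>M sig ?B)" unfolding h_def case_prod_beta by measurable
  have "(\<integral>\<^sup>+\<omega>. ennreal ((norm (Y \<omega>))\<^sup>2) \<partial>P) \<le> (\<integral>\<^sup>+x. h (x, x) \<partial>P)"
  proof (rule nn_integral_mono)
    fix \<omega>
    have "(norm (Y \<omega>))\<^sup>2 \<le> (norm (deviation i k ?m \<omega>) * norm (g j \<omega>))\<^sup>2"
      unfolding Y_def norm_scaleR
      by (intro power_mono mult_right_mono) (auto intro: component_le_norm_cart)
    then show "ennreal ((norm (Y \<omega>))\<^sup>2) \<le> h (\<omega>, \<omega>)"
      by (simp add: h_def power_mult_distrib ennreal_mult[symmetric] ennreal_leI)
  qed
  also have "\<dots> = (\<integral>\<^sup>+x. \<integral>\<^sup>+y. h (x, y) \<partial>P \<partial>P)"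
    using j by (intro nn_integral_freeze_sig[OF _ h]) (auto simp: past_def)
  also have "\<dots> = (\<integral>\<^sup>+x. ennreal ((norm (deviation i k ?m x))\<^sup>2) \<partial>P) * (\<integral>\<^sup>+y. ennreal ((norm (g j y))\<^sup>2) \<partial>P)"
    using dP by (simp add: h_def nn_integral_cmult nn_integral_multc)
  also have "(\<integral>\<^sup>+y. ennreal ((norm (g j y))\<^sup>2) \<partial>P) = ennreal ?u"
    by (intro nn_integral_eq_integral square_integrableD square_integrable_g) auto
  also have "(\<integral>\<^sup>+x. ennreal ((norm (deviation i k ?m x))\<^sup>2) \<partial>P) * ennreal ?u
      \<le> ennreal (\<rho> ^ ?m * ((n - 1) / n)) * ennreal ?u"
    by (intro mult_right_mono deviation_second_moment) auto
  also have "\<dots> = ennreal (\<rho> ^ ?m * ((n - 1) / n) * ?u)"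
    by (rule ennreal_mult''[symmetric]) simp
  finally have le: "(\<integral>\<^sup>+\<omega>. ennreal ((norm (Y \<omega>))\<^sup>2) \<partial>P) \<le> ennreal (\<rho> ^ ?m * ((n - 1) / n) * ?u)" .
  have "1 \<le> n" by (simp add: n Suc_leI)
  then have "0 \<le> \<rho> ^ ?m * ((n - 1) / n) * ?u" using \<rho> by simp
  then show "square_integrable Y" "(\<integral>\<omega>. (norm (Y \<omega>))\<^sup>2 \<partial>P) \<le> \<rho> ^ (k - 1 - j) * ((n - 1) / n) * ?u"
    using square_integrableI_nn[OF Ym le] by simp_all
qed

text \<open>
  The contributions decay like \<rho>^(k-1-j) in the mean square. The weights s^(k-1-j) of the
  Cauchy-Schwarz inequality have a bounded sum, and dividing by them leaves the factor s^(k-1-j), as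
  \<rho> is at most the square of s. Since the weights are divisors, s must be positive
  even if \<rho> = 0.
\<close>
lemma disagreement_bound:
  assumes s: "0 < s" "s < 1" "\<rho> \<le> s\<^sup>2"
  shows "disagreement k \<le> \<gamma>\<^sup>2 * ((n - 1) / n) * (1 / (1 - s)) *
    (\<Sum>j<k. s ^ (k - 1 - j) * (\<integral>\<omega>. (norm (g j \<omega>))\<^sup>2 \<partial>P))" (is "_ \<le> ?b")
proof -
  have n1: "1 \<le> n" by (simp add: n Suc_leI)
  have col: "(\<integral>\<omega>. (norm (column i (X k \<omega>) - xbar k \<omega>))\<^sup>2 \<partial>P) \<le> ?b" for i
  proof -
    define Y where "Y j \<omega> = (deviation i k (k - 1 - j) \<omega> $ ik j \<omega>) *\<^sub>R g j \<omega>" for j \<omega>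
    have Y: "square_integrable (Y j)"
      "(\<integral>\<omega>. (norm (Y j \<omega>))\<^sup>2 \<partial>P) \<le> \<rho> ^ (k - 1 - j) * ((n - 1) / n) * (\<integral>\<omega>. (norm (g j \<omega>))\<^sup>2 \<partial>P)"
      if "j < k" for j
      unfolding Y_def using propagated_update_second_moment[OF that] by auto
    have geo: "(\<Sum>j<k. s ^ (k - 1 - j)) \<le> 1 / (1 - s)"
      using sum.nat_diff_reindex[of "\<lambda>j. s ^ j" k] geometric_sum_le[of s "{..<k}"] s by simp
    have Yi: "integrable P (\<lambda>\<omega>. (norm (Y j \<omega>))\<^sup>2 / s ^ (k - 1 - j))" if "j < k" for j
      using square_integrableD(2)[OF Y(1)[OF that]] by simp
    have "(\<integral>\<omega>. (norm (column i (X k \<omega>) - xbar k \<omega>))\<^sup>2 \<partial>P)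
        \<le> (\<integral>\<omega>. \<gamma>\<^sup>2 * (1 / (1 - s)) * (\<Sum>j<k. (norm (Y j \<omega>))\<^sup>2 / s ^ (k - 1 - j)) \<partial>P)"
    proof (rule integral_mono_AE)
      show "AE \<omega> in P. (norm (column i (X k \<omega>) - xbar k \<omega>))\<^sup>2
          \<le> \<gamma>\<^sup>2 * (1 / (1 - s)) * (\<Sum>j<k. (norm (Y j \<omega>))\<^sup>2 / s ^ (k - 1 - j))"
        using column_minus_xbar_eq_sum[of i k]
      proof eventually_elim
        case (elim \<omega>)
        have "(norm (column i (X k \<omega>) - xbar k \<omega>))\<^sup>2 = \<gamma>\<^sup>2 * (norm (\<Sum>j<k. Y j \<omega>))\<^sup>2"
          unfolding elim Y_def by (simp add: power_mult_distrib)
        also have "\<dots> \<le> \<gamma>\<^sup>2 * ((\<Sum>j<k. s ^ (k - 1 - j)) * (\<Sum>j<k. (norm (Y j \<omega>))\<^sup>2 / s ^ (k - 1 - j)))"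
          using s by (intro mult_left_mono norm_sum_power2_le_weighted) auto
        also have "\<dots> \<le> \<gamma>\<^sup>2 * (1 / (1 - s) * (\<Sum>j<k. (norm (Y j \<omega>))\<^sup>2 / s ^ (k - 1 - j)))"
          using s geo by (intro mult_left_mono mult_right_mono) (auto intro!: sum_nonneg)
        finally show ?case by (simp only: mult.assoc)
      qed
      show "integrable P (\<lambda>\<omega>. \<gamma>\<^sup>2 * (1 / (1 - s)) * (\<Sum>j<k. (norm (Y j \<omega>))\<^sup>2 / s ^ (k - 1 - j)))"
        using Yi by (intro integrable_mult_right Bochner_Integration.integrable_sum) auto
    qed (intro square_integrableD square_integrable_diff square_integrable_column_X square_integrable_xbar)
    also have "\<dots> = \<gamma>\<^sup>2 * (1 / (1 - s)) * (\<Sum>j<k. (\<integral>\<omega>. (norm (Y j \<omega>))\<^sup>2 \<partial>P) / s ^ (k - 1 - j))"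
      using Yi by (simp add: Bochner_Integration.integral_sum)
    also have "\<dots> \<le> \<gamma>\<^sup>2 * (1 / (1 - s)) * (\<Sum>j<k. (n - 1) / n * (s ^ (k - 1 - j) * (\<integral>\<omega>. (norm (g j \<omega>))\<^sup>2 \<partial>P)))"
    proof (intro mult_left_mono sum_mono)
      fix j assume "j \<in> {..<k}"
      then have "j < k" by simp
      let ?m = "k - 1 - j" and ?u = "\<integral>\<omega>. (norm (g j \<omega>))\<^sup>2 \<partial>P"
      have "\<rho> ^ ?m \<le> (s\<^sup>2) ^ ?m" using \<rho> s by (intro power_mono)
      then have "\<rho> ^ ?m * ((n - 1) / n * ?u) \<le> (s\<^sup>2) ^ ?m * ((n - 1) / n * ?u)"
        using n1 by (intro mult_right_mono) auto
      also have "\<dots> = s ^ ?m * (s ^ ?m * ((n - 1) / n * ?u))"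
        by (simp add: power2_eq_square power_mult_distrib)
      finally have "(\<integral>\<omega>. (norm (Y j \<omega>))\<^sup>2 \<partial>P) \<le> s ^ ?m * (s ^ ?m * ((n - 1) / n * ?u))"
        using Y(2)[OF \<open>j < k\<close>] by (simp only: mult.assoc) 
      then show "(\<integral>\<omega>. (norm (Y j \<omega>))\<^sup>2 \<partial>P) / s ^ ?m \<le> (n - 1) / n * (s ^ ?m * ?u)"
        using s by (simp add: pos_divide_le_eq mult_ac)
    qed (use s in auto)
    also have "\<dots> = ?b" by (simp add: sum_distrib_left mult_ac)
    finally show ?thesis .
  qed
  have "disagreement k \<le> (\<Sum>i\<in>UNIV. pmf I i * ?b)"
    unfolding disagreement_def by (intro sum_mono mult_left_mono col) auto
  also have "\<dots> = ?b" by (simp only: sum_distrib_right[symmetric] sum_pmf mult_1)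
  finally show ?thesis .
qed

lemma square_integrable_gf_xbar: "square_integrable (\<lambda>\<omega>. gf (xbar k \<omega>))"
  by (rule square_integrable_lipschitz[OF square_integrable_xbar gf_lipschitz])

text \<open>
  The four per-step inequalities fed into the scalar recursion.
\<close>
lemma gradient_sum_bound:
  assumes s: "0 < s" "s < 1" "\<rho> \<le> s\<^sup>2" and R: "R = 1 / (1 - s)"
    and small: "10 * (\<gamma> * M * L) \<le> n" "8 * (\<gamma> * M * L * (real T)\<^sup>2) \<le> n"
      "8 * (\<gamma> * M * L * (n - 1) * R\<^sup>2) \<le> 1" "32 * (\<gamma> * M * L * (n - 1)) \<le> 1"
  shows "(\<Sum>k<K. \<integral>\<omega>. (norm (gf (xbar k \<omega>)))\<^sup>2 \<partial>P)
    \<le> 2 * n * (f x0 - fstar) / (\<gamma> * M) + 2 * (\<gamma> * L / (n * M)) * (K * (M * \<sigma>\<^sup>2 + 2 * M\<^sup>2 * \<zeta>\<^sup>2))"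
proof -
  have n1: "1 \<le> n" by (simp add: n Suc_leI)
  have "xbar 0 \<omega> = x0" if "\<omega> \<in> space P" for \<omega>
  proof -
    have "xbar 0 \<omega> = (n * (1 / n)) *\<^sub>R x0"
      unfolding xbar_eq_sum_columns X_init[OF that] sum_constant_scaleR scaleR_scaleR n[symmetric] ..
    then show ?thesis using n_pos by simp
  qed
  then have e0: "(\<integral>\<omega>. f (xbar 0 \<omega>) \<partial>P) = f x0"
    using Bochner_Integration.integral_cong[OF refl, of P "\<lambda>\<omega>. f (xbar 0 \<omega>)" "\<lambda>_. f x0"] by (simp add: prob_space)
  have eK: "fstar \<le> (\<integral>\<omega>. f (xbar K \<omega>) \<partial>P)"
    using integral_mono[OF integrable_const descent(1), of fstar K] f_lower by (simp add: prob_space)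
  have "(\<Sum>k<K. \<integral>\<omega>. (norm (gf (xbar k \<omega>)))\<^sup>2 \<partial>P)
    \<le> 2 * n * ((\<integral>\<omega>. f (xbar 0 \<omega>) \<partial>P) - fstar) / (\<gamma> * M) + 2 * (\<gamma> * L / (n * M)) * (K * (M * \<sigma>\<^sup>2 + 2 * M\<^sup>2 * \<zeta>\<^sup>2))"
  proof (rule delayed_descent_bound[where s = s and R = R and T = T and \<tau> = \<tau> and D = disagreement
      and H = "\<lambda>k. \<integral>\<omega>. (norm (mean_gradient (X (k - \<tau> k) \<omega>)))\<^sup>2 \<partial>P"
      and u = "\<lambda>k. \<integral>\<omega>. (norm (g k \<omega>))\<^sup>2 \<partial>P"
      and Z = "\<lambda>k. \<integral>\<omega>. (norm (xbar k \<omega> - xbar (k - \<tau> k) \<omega>))\<^sup>2 \<partial>P"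
      and e = "\<lambda>k. \<integral>\<omega>. f (xbar k \<omega>) \<partial>P"])
    show "disagreement k \<le> \<gamma>\<^sup>2 * ((n - 1) / n) * R * (\<Sum>j<k. s ^ (k - 1 - j) * (\<integral>\<omega>. (norm (g j \<omega>))\<^sup>2 \<partial>P))" for k
      unfolding R by (rule disagreement_bound[OF s])
  qed (use n1 M \<gamma> L s R small \<tau>_le_T disagreement_nonneg g_second_moment_bound staleness_bound descent(2) eK in auto)
  then show ?thesis by (simp only: e0)
qed

end

section \<open>The step size and the rate\<close>

text \<open>
  The two summands of the denominator of \<gamma> give the first two bounds. A lower bound on K of the
  shape of the hypothesis makes the second summand at least M L n sqrt c, which gives the third.
\<close>
lemma step_size_small:
  fixes n M L S K c \<gamma> :: real
  assumes pos: "1 \<le> n" "1 \<le> M" "0 \<le> L" "0 < S" "1 \<le> K" "0 \<le> c"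
    and \<gamma>: "\<gamma> = n / (10 * M * L + sqrt S * sqrt (K * M))"
    and K: "M * L\<^sup>2 * n\<^sup>2 / S * c \<le> K"
  shows "10 * (\<gamma> * M * L) \<le> n" "\<gamma> * (sqrt S * sqrt (K * M)) \<le> n" "\<gamma> * M * L * sqrt c \<le> 1"
proof -
  define q where "q = sqrt S * sqrt (K * M)"
  have q: "0 < q" using pos by (simp add: q_def)
  have den: "0 < 10 * M * L + q" using pos q by (intro add_nonneg_pos mult_nonneg_nonneg) auto
  have \<gamma>0: "0 \<le> \<gamma>" using \<gamma> den pos by (simp add: q_def[symmetric])
  have eq: "\<gamma> * (10 * M * L + q) = n" using \<gamma> den by (simp add: q_def[symmetric])
  have "0 \<le> \<gamma> * (10 * M * L)" "0 \<le> \<gamma> * q" using \<gamma>0 pos q by auto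
  then have le: "\<gamma> * (10 * M * L) \<le> n" "\<gamma> * q \<le> n" using eq unfolding distrib_left by linarith+
  show "10 * (\<gamma> * M * L) \<le> n" using le(1) by (simp add: mult_ac)
  show "\<gamma> * (sqrt S * sqrt (K * M)) \<le> n" using le(2) by (simp add: q_def)
  have "M * L * n * sqrt c = sqrt ((M * L * n)\<^sup>2 * c)"
    using pos by (simp add: real_sqrt_mult)
  also have "\<dots> \<le> sqrt (S * (K * M))"
  proof (rule real_sqrt_le_mono)
    have "M * L\<^sup>2 * n\<^sup>2 * c \<le> K * S" using K pos by (simp add: field_simps)
    then have "M * (M * L\<^sup>2 * n\<^sup>2 * c) \<le> M * (K * S)" using pos by (intro mult_left_mono) auto
    then show "(M * L * n)\<^sup>2 * c \<le> S * (K * M)" by (simp add: power2_eq_square mult_ac)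
  qed
  also have "\<dots> = q" by (simp add: q_def real_sqrt_mult)
  finally have "\<gamma> * (M * L * n * sqrt c) \<le> \<gamma> * q" using \<gamma>0 by (rule mult_left_mono)
  also note le(2)
  finally have "n * (\<gamma> * M * L * sqrt c) \<le> n * 1" by (simp add: mult_ac)
  then show "\<gamma> * M * L * sqrt c \<le> 1" by (rule mult_left_le_imp_le) (use pos in auto)
qed

text \<open>
  The constant that the weighted Cauchy-Schwarz argument produces is comparable to 1 / (1 - sqrt \<rho>)^2,
  which is dominated by the constant of the theorem.
\<close>
lemma rho_bar_lower_bound:
  fixes n \<rho> :: real
  assumes n: "1 \<le> n" and \<rho>: "0 \<le> \<rho>" "\<rho> < 1"
  shows "(n - 1) * (1 / (1 - sqrt \<rho>)\<^sup>2) \<le> n * rho_bar n \<rho>" "n - 1 \<le> n * rho_bar n \<rho>"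
proof -
  define t where "t = sqrt \<rho>"
  have t: "0 \<le> t" "t < 1" "\<rho> = t\<^sup>2" using \<rho> by (auto simp: t_def)
  define r where "r = 1 / (1 - \<rho>) + 2 * t / (1 - t)\<^sup>2"
  have nr: "n * rho_bar n \<rho> = (n - 1) * r" using n by (simp add: rho_bar_def r_def t_def)
  have "1 / (1 - \<rho>) - (1 - 2 * t) / (1 - t)\<^sup>2 = ((1 - t) - (1 - 2 * t) * (1 + t)) / ((1 - t)\<^sup>2 * (1 + t))"
  proof -
    have "1 / (u * v) - c / u\<^sup>2 = (u - c * v) / (u\<^sup>2 * v)" if "u \<noteq> 0" "v \<noteq> 0" for u v c :: real
      using that by (simp add: field_simps power2_eq_square)
    moreover have "1 - \<rho> = (1 - t) * (1 + t)" using t(3) by (simp add: power2_eq_square algebra_simps)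
    moreover have "1 - t \<noteq> 0" "1 + t \<noteq> 0" using t by auto
    ultimately show ?thesis by metis
  qed
  also have "\<dots> = 2 * t\<^sup>2 / ((1 - t)\<^sup>2 * (1 + t))"
    by (simp add: power2_eq_square algebra_simps)
  also have "\<dots> \<ge> 0" using t by simp
  finally have "1 / (1 - t)\<^sup>2 \<le> r"
    by (simp add: r_def diff_divide_distrib)
  then show "(n - 1) * (1 / (1 - sqrt \<rho>)\<^sup>2) \<le> n * rho_bar n \<rho>"
    unfolding nr t_def[symmetric] using n by (intro mult_left_mono) auto
  have "1 \<le> 1 / (1 - \<rho>)" using \<rho> by simp
  moreover have "0 \<le> 2 * t / (1 - t)\<^sup>2" using t by simp
  ultimately have "1 \<le> r" by (simp add: r_def)
  then have "(n - 1) * 1 \<le> (n - 1) * r" using n by (intro mult_left_mono) auto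
  then show "n - 1 \<le> n * rho_bar n \<rho>" unfolding nr by simp
qed

text \<open>
  The first term of the hypothesis contains n / \<gamma>, which is the denominator of the step size, and so
  splits into the L / K term and a 1 / sqrt K term. The second is proportional to \<gamma> / n, for which the
  noise part of the denominator gives an upper bound.
\<close>
lemma rate_of_sum_bound:
  fixes n M L \<sigma> \<zeta> K \<gamma> \<Delta> N :: real
  defines "S \<equiv> \<sigma>\<^sup>2 + 6 * M * \<zeta>\<^sup>2"
  assumes pos: "1 \<le> n" "1 \<le> M" "0 \<le> L" "0 < S" "1 \<le> K" "0 < \<gamma>"
    and \<gamma>: "\<gamma> = n / (10 * M * L + sqrt S * sqrt (K * M))"
    and \<gamma>_le: "\<gamma> * (sqrt S * sqrt (K * M)) \<le> n"
    and N: "N \<le> 2 * n * \<Delta> / (\<gamma> * M) + 2 * (\<gamma> * L / (n * M)) * (K * (M * \<sigma>\<^sup>2 + 2 * M\<^sup>2 * \<zeta>\<^sup>2))"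
  shows "N / K \<le> 20 * \<Delta> * L / K + 2 * (\<Delta> + L) * sqrt (\<sigma>\<^sup>2 / M + 6 * \<zeta>\<^sup>2) / sqrt K"
proof -
  define q where "q = sqrt S * sqrt (K * M)"
  have "S / M = \<sigma>\<^sup>2 / M + 6 * \<zeta>\<^sup>2" using pos by (simp add: S_def field_simps)
  then have sq: "sqrt (\<sigma>\<^sup>2 / M + 6 * \<zeta>\<^sup>2) = sqrt S / sqrt M" by (simp add: real_sqrt_divide[symmetric])
  have q0: "0 < q" using pos by (simp add: q_def)
  have "0 < 10 * M * L + q" using pos q0 by (intro add_nonneg_pos mult_nonneg_nonneg) auto
  then have n\<gamma>: "n / \<gamma> = 10 * M * L + q" using pos \<gamma> by (simp add: q_def[symmetric])
  define r where "r = sqrt (K * M)"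
  have "r * r = K * M" unfolding r_def using pos by (intro real_sqrt_mult_self[THEN trans]) simp
  moreover have "r \<noteq> 0" "q = sqrt S * r" "sqrt S / r = sqrt S / sqrt M / sqrt K"
    using pos by (simp_all add: r_def q_def real_sqrt_mult mult.commute)
  ultimately have r: "r * r = K * M" "r \<noteq> 0" "q = sqrt S * r" "sqrt S / r = sqrt S / sqrt M / sqrt K" by auto
  have qKM: "q / (K * M) = sqrt S / sqrt M / sqrt K"
    unfolding r(1)[symmetric] r(3) r(4)[symmetric] using r(2) by simp
  have "S / q = (sqrt S * sqrt S) / (sqrt S * r)" using pos by (simp add: r(3))
  also have "\<dots> = sqrt S / r" using pos by (subst mult_divide_mult_cancel_left) auto
  finally have Sq: "S / q = sqrt S / sqrt M / sqrt K" by (simp only: r(4))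
  have 1: "2 * n * \<Delta> / (\<gamma> * M) / K = 20 * \<Delta> * L / K + 2 * \<Delta> * (sqrt S / sqrt M / sqrt K)"
  proof -
    have "2 * n * \<Delta> / (\<gamma> * M) / K = 2 * \<Delta> * (n / \<gamma>) / (K * M)" by (simp add: mult_ac)
    also have "\<dots> = 20 * \<Delta> * L / K + 2 * \<Delta> * (q / (K * M))"
      unfolding n\<gamma> using pos by (simp add: field_simps)
    finally show ?thesis by (simp only: qKM)
  qed
  have 2: "2 * (\<gamma> * L / (n * M)) * (K * (M * \<sigma>\<^sup>2 + 2 * M\<^sup>2 * \<zeta>\<^sup>2)) / K \<le> 2 * L * (sqrt S / sqrt M / sqrt K)"
  proof -
    have "2 * (\<gamma> * L / (n * M)) * (K * (M * \<sigma>\<^sup>2 + 2 * M\<^sup>2 * \<zeta>\<^sup>2)) / K = 2 * L * (\<gamma> / n) * (\<sigma>\<^sup>2 + 2 * M * \<zeta>\<^sup>2)"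
      using pos by (simp add: field_simps power2_eq_square)
    also have "\<dots> \<le> 2 * L * (1 / q) * S"
    proof (intro mult_mono mult_left_mono)
      show "\<gamma> / n \<le> 1 / q" using \<gamma>_le pos q0 by (simp add: q_def[symmetric] field_simps)
      show "\<sigma>\<^sup>2 + 2 * M * \<zeta>\<^sup>2 \<le> S" using pos by (simp add: S_def mult_right_mono)
    qed (use pos q0 in auto)
    also have "\<dots> = 2 * L * (S / q)" by simp
    finally show ?thesis by (simp only: Sq)
  qed
  have "N / K \<le> (2 * n * \<Delta> / (\<gamma> * M) + 2 * (\<gamma> * L / (n * M)) * (K * (M * \<sigma>\<^sup>2 + 2 * M\<^sup>2 * \<zeta>\<^sup>2))) / K"
    using N pos by (intro divide_right_mono) auto
  also have "\<dots> \<le> 20 * \<Delta> * L / K + 2 * \<Delta> * (sqrt S / sqrt M / sqrt K) + 2 * L * (sqrt S / sqrt M / sqrt K)"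
    unfolding add_divide_distrib 1 using 2 by (intro add_left_mono)
  also have "\<dots> = 20 * \<Delta> * L / K + 2 * (\<Delta> + L) * sqrt (\<sigma>\<^sup>2 / M + 6 * \<zeta>\<^sup>2) / sqrt K"
    unfolding sq by (simp add: distrib_left distrib_right add_divide_distrib)
  finally show ?thesis .
qed

theorem corollary2:
  fixes P :: "'w measure"
    and I :: "'n::finite pmf"
    and D :: "'n \<Rightarrow> 's measure"
    and F :: "'n \<Rightarrow> real^'d \<Rightarrow> 's \<Rightarrow> real"
    and gF :: "'n \<Rightarrow> real^'d \<Rightarrow> 's \<Rightarrow> real^'d"
    and f :: "real^'d \<Rightarrow> real"
    and fl :: "'n \<Rightarrow> real^'d \<Rightarrow> real"
    and fstar n L \<sigma> \<zeta> \<rho> \<gamma> T :: real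
    and M K :: nat
    and x0 :: "real^'d"
    and ik :: "nat \<Rightarrow> 'w \<Rightarrow> 'n"
    and W :: "nat \<Rightarrow> 'w \<Rightarrow> real^'n^'n"
    and \<xi> :: "nat \<Rightarrow> 'n \<Rightarrow> nat \<Rightarrow> 'w \<Rightarrow> 's"
    and \<tau> :: "nat \<Rightarrow> nat"
    and X :: "nat \<Rightarrow> 'w \<Rightarrow> real^'n^'d"
  assumes n: "n = real CARD('n)"
    and f_local: "fl = local_loss D F"
    and f_global: "f = global_loss I D F"
    and f_bounded: "bdd_below (range f)"
    and f_opt: "fstar = (INF x. f x)"
    and prob: "prob_space P" "\<And>i. prob_space (D i)"
    and loss_integrable: "\<And>i x. integrable (D i) (F i x)"
    and gF_gradient: "\<And>i x. AE s in D i. GDERIV (\<lambda>y. F i y s) x :> gF i x s"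
    and gF_measurable: "\<And>i. (\<lambda>(x, s). gF i x s) \<in> borel_measurable (borel \<Otimes>\<^sub>M D i)"
    \<comment> \<open>algorithm\<close>
    and params: "M \<ge> 1" "K \<ge> 1" "\<gamma> > 0"
    and ik_rv: "\<And>k. ik k \<in> measurable P (count_space UNIV)"
    and ik_distr: "\<And>k. distr P (count_space UNIV) (ik k) = measure_pmf I"
    and W_rv: "\<And>k. W k \<in> borel_measurable P"
    and \<xi>_rv: "\<And>k i j. j \<in> {1..M} \<Longrightarrow> \<xi> k i j \<in> measurable P (D i)"
    and \<xi>_distr: "\<And>k i j. j \<in> {1..M} \<Longrightarrow> distr P (D i) (\<xi> k i j) = D i"
    and \<xi>_batch: "\<And>k i. prob_space.indep_vars P (\<lambda>_. D i) (\<xi> k i) {1..M}"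
    and delay: "\<And>k. \<tau> k \<le> k"
    and X_init: "\<And>\<omega> i. \<omega> \<in> space P \<Longrightarrow> column i (X 0 \<omega>) = x0"
    and X_step: "\<And>k \<omega>. \<omega> \<in> space P \<Longrightarrow>
        X (Suc k) \<omega> = X k \<omega> ** W k \<omega>
          - \<gamma> *\<^sub>R batch_update gF M (X (k - \<tau> k) \<omega>) (\<lambda>j. \<xi> k (ik k \<omega>) j \<omega>) (ik k \<omega>)"
    \<comment> \<open>standing assumptions\<close>
    and A1: "\<And>i x. fl i differentiable (at x)" "\<And>i. L-lipschitz_on UNIV (gradient (fl i))"
    and A2: "\<And>k. AE \<omega> in P. doubly_stochastic (W k \<omega>)"
    and A3: "0 \<le> \<rho>" "\<rho> < 1"
      "\<And>k. let A = (\<integral>\<omega>. transpose (W k \<omega>) ** W k \<omega> \<partial>P)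
            in max \<bar>eigenvalue_nth 2 A\<bar> \<bar>eigenvalue_nth CARD('n) A\<bar> \<le> \<rho>"
    and A4: "\<And>i x. integrable (D i) (gF i x)"
      "\<And>i x. (\<integral>s. gF i x s \<partial>D i) = gradient (fl i) x"
      "\<And>x. measure_pmf.expectation I (\<lambda>i. \<integral>s. gF i x s \<partial>D i) = gradient f x"
    and A5: "0 \<le> \<sigma>" "0 \<le> \<zeta>"
      "\<And>i x. integrable (D i) (\<lambda>s. (norm (gF i x s - gradient (fl i) x))\<^sup>2)"
      "\<And>i x. (\<integral>s. (norm (gF i x s - gradient (fl i) x))\<^sup>2 \<partial>D i) \<le> \<sigma>\<^sup>2"
      "\<And>x. measure_pmf.expectation I (\<lambda>i. (norm (gradient (fl i) x - gradient f x))\<^sup>2) \<le> \<zeta>\<^sup>2"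
    and A6: "independent_sources P D M ik W \<xi>"
    and A7: "\<And>k. real (\<tau> k) \<le> T"
    \<comment> \<open>step size and number of iterations\<close>
    and noise_pos: "\<sigma>\<^sup>2 + 6 * M * \<zeta>\<^sup>2 > 0"
    and step_size: "\<gamma> = n / (10 * M * L + sqrt (\<sigma>\<^sup>2 + 6 * M * \<zeta>\<^sup>2) * sqrt (K * M))"
    and K_large: "real K \<ge> M * L\<^sup>2 * n\<^sup>2 / (\<sigma>\<^sup>2 + 6 * M * \<zeta>\<^sup>2) *
      Max {192 * (T * ((n - 1) / n) + rho_bar n \<rho>),
           64 * T ^ 4 / n\<^sup>2,
           1024 * n\<^sup>2 * (rho_bar n \<rho>)\<^sup>2,
           (8 * sqrt 6 * T powr (2/3) + 8)\<^sup>2 * (T + rho_bar n \<rho> * (n / (n - 1))) powr (2/3)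
             * (n - 1) powr (1/2) / n powr (1/6)}"
  shows "(\<forall>k<K. integrable P (\<lambda>\<omega>. (norm (gradient f ((1 / n) *\<^sub>R (X k \<omega> *v 1))))\<^sup>2)) \<and>
    (\<Sum>k<K. \<integral>\<omega>. (norm (gradient f ((1 / n) *\<^sub>R (X k \<omega> *v 1))))\<^sup>2 \<partial>P) / K
      \<le> 20 * (f x0 - fstar) * L / K
        + 2 * (f x0 - fstar + L) * sqrt (\<sigma>\<^sup>2 / M + 6 * \<zeta>\<^sup>2) / sqrt K"
proof -
  define Tn where "Tn = nat \<lfloor>T\<rfloor>"
  have T0: "0 \<le> T" using A7[of 0] by linarith
  have \<tau>_le: "\<tau> k \<le> Tn" for k using A7[of k] by (simp add: Tn_def le_nat_floor)
  have Tn_le: "real Tn \<le> T" using T0 by (simp add: Tn_def)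
  have pmf_expectation: "measure_pmf.expectation I h = (\<Sum>i\<in>UNIV. pmf I i *\<^sub>R h i)" for h :: "'n \<Rightarrow> 'z::euclidean_space"
    by (rule integral_measure_pmf) auto
  have fl_GDERIV: "GDERIV (fl i) x :> gradient (fl i) x" for i x
    by (rule differentiable_imp_GDERIV_gradient[OF A1(1)])
  have f_eq: "f = (\<lambda>x. \<Sum>i\<in>UNIV. pmf I i * fl i x)"
    unfolding f_global f_local global_loss_def[abs_def] pmf_expectation by simp
  have f_GDERIV: "GDERIV f x :> (\<Sum>i\<in>UNIV. pmf I i *\<^sub>R gradient (fl i) x)" for x
  proof -
    have "((\<lambda>x. \<Sum>i\<in>UNIV. pmf I i * fl i x) has_derivative (\<lambda>h. \<Sum>i\<in>UNIV. pmf I i * (h \<bullet> gradient (fl i) x))) (at x)"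
      using fl_GDERIV unfolding gderiv_def
      by (intro has_derivative_sum has_derivative_mult_right) auto
    then show ?thesis by (simp add: f_eq gderiv_def inner_sum_right)
  qed
  have gradient_f: "gradient f x = (\<Sum>i\<in>UNIV. pmf I i *\<^sub>R gradient (fl i) x)" for x
    by (rule gradient_eqI[OF f_GDERIV])
  have f_lower: "fstar \<le> f x" for x
    unfolding f_opt using f_bounded by (intro cINF_lower) auto
  have spectral: "eigenvalue_nth 2 (\<integral>\<omega>. transpose (W k \<omega>) ** W k \<omega> \<partial>P) \<le> \<rho>" for k
    using A3(3)[of k] by (simp add: Let_def abs_le_iff)
  interpret P: prob_space P by (rule prob(1))
  interpret ad_psgd P I D gF "\<lambda>i. gradient (fl i)" f fstar n L \<sigma> \<zeta> \<rho> \<gamma> M Tn x0 ik W \<xi> \<tau> X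
  proof
    show "(\<Sum>i\<in>UNIV. pmf I i * (norm (gradient (fl i) x - (\<Sum>i\<in>UNIV. pmf I i *\<^sub>R gradient (fl i) x)))\<^sup>2) \<le> \<zeta>\<^sup>2" for x
      using A5(5)[of x] unfolding pmf_expectation gradient_f by simp
  qed (fact n params(1,3) gF_measurable A4(1,2) A5(3,4) A1(2) f_GDERIV f_lower ik_rv ik_distr W_rv \<xi>_rv
      \<xi>_distr \<xi>_batch A6 \<tau>_le A2 A3(1,2) spectral X_init X_step)+
  have gf_eq: "gradient f = gf" by (rule ext) (simp add: gradient_f gf_def)
  have xbar_eq: "(1 / n) *\<^sub>R (X k \<omega> *v 1) = xbar k \<omega>" for k \<omega> by (simp add: xbar_def)

  have n1: "1 \<le> n" by (simp add: n Suc_leI)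
  define S where "S = \<sigma>\<^sup>2 + 6 * M * \<zeta>\<^sup>2"
  have S_eq: "S = \<sigma>\<^sup>2 + 6 * real M * \<zeta>\<^sup>2" by (simp add: S_def)
  have S0: "0 < S" using noise_pos by (simp add: S_def)
  note K_large' = K_large[folded S_def]
  have pos: "1 \<le> real M" "1 \<le> real K" using params by auto
  have \<gamma>_eq: "\<gamma> = n / (10 * real M * L + sqrt S * sqrt (real K * real M))"
    using step_size by (simp add: S_def)
  have cond: "M * L\<^sup>2 * n\<^sup>2 / S * c \<le> K" if "c \<in> {192 * (T * ((n - 1) / n) + rho_bar n \<rho>),
           64 * T ^ 4 / n\<^sup>2,
           1024 * n\<^sup>2 * (rho_bar n \<rho>)\<^sup>2,
           (8 * sqrt 6 * T powr (2/3) + 8)\<^sup>2 * (T + rho_bar n \<rho> * (n / (n - 1))) powr (2/3)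
             * (n - 1) powr (1/2) / n powr (1/6)}" (is "_ \<in> ?C") for c
  proof -
    have "c \<le> Max ?C" using that by (intro Max_ge) auto
    then have "M * L\<^sup>2 * n\<^sup>2 / S * c \<le> M * L\<^sup>2 * n\<^sup>2 / S * Max ?C"
      using S0 by (intro mult_left_mono) auto
    also have "\<dots> \<le> K" using K_large' .
    finally show ?thesis .
  qed
  have \<rho>_bar: "(n - 1) * (1 / (1 - sqrt \<rho>)\<^sup>2) \<le> n * rho_bar n \<rho>" "n - 1 \<le> n * rho_bar n \<rho>"
    using rho_bar_lower_bound[OF n1 \<rho>] by auto
  have \<rho>_bar0: "0 \<le> n * rho_bar n \<rho>" using \<rho>_bar(2) n1 by linarith
  define a where "a = \<gamma> * M * L"
  have a0: "0 \<le> a" using \<gamma> L by (simp add: a_def)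
  have "M * L\<^sup>2 * n\<^sup>2 / S * (64 * T ^ 4 / n\<^sup>2) \<le> K" by (rule cond) simp
  note small_T = step_size_small[OF n1 pos(1) L S0 pos(2) _ \<gamma>_eq this]
  have "M * L\<^sup>2 * n\<^sup>2 / S * (1024 * n\<^sup>2 * (rho_bar n \<rho>)\<^sup>2) \<le> K" by (rule cond) simp
  note small_\<rho> = step_size_small(3)[OF n1 pos(1) L S0 pos(2) _ \<gamma>_eq this]
  \<comment> \<open>The second entry of the maximum keeps the staleness small, the third one the disagreement.\<close>
  have "sqrt (64 * T ^ 4 / n\<^sup>2) = sqrt ((8 * T\<^sup>2 / n)\<^sup>2)" by (simp add: power_mult_distrib power_divide)
  also have "\<dots> = 8 * T\<^sup>2 / n" using n1 by (intro real_sqrt_unique) auto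
  finally have "a * (8 * T\<^sup>2 / n) \<le> 1" using small_T(3) unfolding a_def by simp
  then have aT: "8 * (a * T\<^sup>2) \<le> n" using n1 by (simp add: field_simps)
  have "sqrt (1024 * n\<^sup>2 * (rho_bar n \<rho>)\<^sup>2) = sqrt ((32 * (n * rho_bar n \<rho>))\<^sup>2)" by (simp add: power_mult_distrib)
  also have "\<dots> = 32 * (n * rho_bar n \<rho>)" using \<rho>_bar0 by (intro real_sqrt_unique) auto
  finally have a\<rho>: "32 * (a * (n * rho_bar n \<rho>)) \<le> 1" using small_\<rho> by (simp add: a_def mult_ac)

  \<comment> \<open>The midpoint of sqrt \<rho> and 1 is positive and only doubles 1 / (1 - sqrt \<rho>).\<close>
  define s where "s = (1 + sqrt \<rho>) / 2"
  have t: "0 \<le> sqrt \<rho>" "sqrt \<rho> < 1" using \<rho> by auto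
  have s: "0 < s" "s < 1" using t by (simp_all add: s_def add_pos_nonneg)
  have "(sqrt \<rho>)\<^sup>2 \<le> s\<^sup>2" using t by (intro power_mono) (auto simp: s_def)
  then have \<rho>s: "\<rho> \<le> s\<^sup>2" using \<rho> by simp
  have R: "(1 / (1 - s))\<^sup>2 = 4 * (1 / (1 - sqrt \<rho>)\<^sup>2)"
  proof -
    have half: "1 - s = (1 - sqrt \<rho>) / 2" by (simp add: s_def field_simps)
    show ?thesis unfolding half by (simp add: power_divide)
  qed
  have sum: "(\<Sum>k<K. \<integral>\<omega>. (norm (gf (xbar k \<omega>)))\<^sup>2 \<partial>P)
    \<le> 2 * n * (f x0 - fstar) / (\<gamma> * real M)
      + 2 * (\<gamma> * L / (n * real M)) * (real K * (real M * \<sigma>\<^sup>2 + 2 * (real M)\<^sup>2 * \<zeta>\<^sup>2))"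
  proof (rule order_trans[OF gradient_sum_bound[OF s \<rho>s refl]])
    show "10 * (\<gamma> * M * L) \<le> n" by (rule small_T(1)) simp
    have "a * (real Tn)\<^sup>2 \<le> a * T\<^sup>2" using a0 Tn_le by (intro mult_left_mono power_mono) auto
    then show "8 * (\<gamma> * M * L * (real Tn)\<^sup>2) \<le> n" using aT by (simp add: a_def)
    have "a * ((n - 1) * (1 / (1 - sqrt \<rho>)\<^sup>2)) \<le> a * (n * rho_bar n \<rho>)"
      using a0 \<rho>_bar(1) by (rule mult_left_mono[rotated])
    then have "32 * (a * ((n - 1) * (1 / (1 - sqrt \<rho>)\<^sup>2))) \<le> 1" using a\<rho> by linarith
    then show "8 * (\<gamma> * M * L * (n - 1) * (1 / (1 - s))\<^sup>2) \<le> 1"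
      unfolding R a_def by (simp add: mult_ac)
    have "a * (n - 1) \<le> a * (n * rho_bar n \<rho>)" using a0 \<rho>_bar(2) by (intro mult_left_mono)
    then show "32 * (\<gamma> * M * L * (n - 1)) \<le> 1" using a\<rho> by (simp add: a_def)
  qed simp
  have "\<gamma> * (sqrt S * sqrt (real K * real M)) \<le> n" by (rule small_T(2)) simp
  then have "(\<Sum>k<K. \<integral>\<omega>. (norm (gf (xbar k \<omega>)))\<^sup>2 \<partial>P) / K \<le> 20 * (f x0 - fstar) * L / K
        + 2 * (f x0 - fstar + L) * sqrt (\<sigma>\<^sup>2 / M + 6 * \<zeta>\<^sup>2) / sqrt K"
    using rate_of_sum_bound[OF n1 pos(1) L S0[unfolded S_eq] pos(2) \<gamma> \<gamma>_eq[unfolded S_eq] _ sum]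
    unfolding S_eq by blast
  moreover have "integrable P (\<lambda>\<omega>. (norm (gf (xbar k \<omega>)))\<^sup>2)" for k
    by (rule P.square_integrableD(2)[OF square_integrable_gf_xbar])
  ultimately show ?thesis unfolding gf_eq xbar_eq by blast
qed

end
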